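(* For each $n$ let $L_n$ be a random lattice distributed according to $\mu_n$ on $\mathbb X_n$. Let $\gamma>1$ and $0<c<1$. For $L\in\mathbb X_n$ define $$ \Pi_{n,c}^{\lambda}(\gamma,L)= \frac{\sum_{u\in L_{\mathrm{prim}}^\sharp,\ \|u\|\le\gamma\lambda_1(L)}g_{n,c}(\tau_n(u))}{\sum_{u\in L_{\mathrm{prim}}^\sharp}g_{n,c}(\tau_n(u))}. $$ Then, as $n\to\infty$, $\Pi_{n,c}^{\lambda}(\gamma,L_n)\to0$ in probability if $c<\gamma^{-2}$, while $\Pi_{n,c}^{\lambda}(\gamma,L_n)\to1$ in probability if $\gamma^{-2}<c<1$.
   Context: $\mathbb X_n=\mathrm{SL}(n,\mathbb Z)\backslash \mathrm{SL}(n,\mathbb R)$ is the space of unimodular (covolume one) lattices in $\mathbb R^n$, where the class of $A$ is identified with $L=\mathbb Z^nA$ (row vectors), and $\mu_n$ is its $\mathrm{SL}(n,\mathbb R)$-invariant Borel probability measure. $\|\cdot\|$ is the Euclidean norm, $v_n$ is the volume of the Euclidean unit ball in $\mathbb R^n$, and $\lambda_1(L)=\min\{\|v\|:v\in L\setminus\{0\}\}$ is the usual shortest length of the full lattice. A nonzero vector $v\in L$ is primitive if there are no integer $m\ge2$ and $w\in L$ with $v=mw$. $L_{\mathrm{prim}}^\sharp$ is the set of primitive vectors of $L$ modulo $v\sim-v$; for $u\in L_{\mathrm{prim}}^\sharp$, $\|u\|$ is the norm of either representative. Put $\tau_n(u)=v_n\|u\|^n$ and $g_{n,c}(s)=\exp\left\{-\frac{cn}{2}(s^{2/n}-1)\right\}$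 for $s>0$. *)

theory Defs
  imports "HOL-Probability.Probability" "Jordan_Normal_Form.Determinant"
begin

no_notation inner (infix "\<bullet>" 70)
no_notation Finite_Cartesian_Product.vec_nth (infixl "$" 90)

hide_const (open) Determinants.det

text \<open>Dimensions vary with \<open>n\<close>, so vectors in \<open>\<real>\<^sup>n\<close> and real \<open>n \<times> n\<close> matrices are elements
  of \<open>carrier_vec n\<close> and \<open>carrier_mat n n\<close>. A row vector \<open>x\<close> and its product \<open>x A\<close> are rendered
  by the vector \<open>x\<close> and \<open>A\<^sup>T *\<^sub>v x\<close>.\<close>

definition vnorm :: "real vec \<Rightarrow> real" where
  "vnorm v = sqrt (v \<bullet> v)"

definition SL :: "nat \<Rightarrow> real mat set" where
  "SL n = {A \<in> carrier_mat n n. det A = 1}"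

definition SL_topology :: "nat \<Rightarrow> real mat topology" where
  "SL_topology n = pullback_topology (SL n)
     (\<lambda>A. \<lambda>ij \<in> {..<n} \<times> {..<n}. A $$ ij)
     (product_topology (\<lambda>_. euclideanreal) ({..<n} \<times> {..<n}))"

text \<open>The lattice \<open>\<int>\<^sup>n A\<close>, for \<open>A\<close> of size \<open>n \<times> n\<close>.\<close>

definition lattice_of :: "real mat \<Rightarrow> real vec set" where
  "lattice_of A = {A\<^sup>T *\<^sub>v map_vec real_of_int z | z. z \<in> carrier_vec (dim_row A)}"

text \<open>For \<open>A, B \<in> SL n\<close>, \<open>lattice_of A = lattice_of B\<close> holds iff \<open>SL(n,\<int>) A = SL(n,\<int>) B\<close>.
  So the set of lattices below is the quotient of \<open>SL(n,\<real>)\<close> by \<open>SL(n,\<int>)\<close> on the left,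
  and it carries the quotient topology.\<close>

definition unimodular_lattices :: "nat \<Rightarrow> real vec set set" where
  "unimodular_lattices n = lattice_of ` SL n"

definition lattice_topology :: "nat \<Rightarrow> real vec set topology" where
  "lattice_topology n = topology (\<lambda>U. U \<subseteq> unimodular_lattices n \<and>
     openin (SL_topology n) {A \<in> SL n. lattice_of A \<in> U})"

lemma topspace_SL_topology [simp]: "topspace (SL_topology n) = SL n"
  by (auto simp: SL_topology_def topspace_pullback_topology)

lemma openin_lattice_topology:
  "openin (lattice_topology n) U \<longleftrightarrow> U \<subseteq> unimodular_lattices n \<and>
     openin (SL_topology n) {A \<in> SL n. lattice_of A \<in> U}"
proof -
  have "istopology (\<lambda>U. U \<subseteq> unimodular_lattices n \<and>
     openin (SL_topology n) {A \<in> SL n. lattice_of A \<in> U})"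
    unfolding istopology_def
  proof (intro conjI allI impI; (elim conjE)?)
    fix S T
    assume "S \<subseteq> unimodular_lattices n"
      and "openin (SL_topology n) {A \<in> SL n. lattice_of A \<in> S}"
      and "openin (SL_topology n) {A \<in> SL n. lattice_of A \<in> T}"
    moreover have "{A \<in> SL n. lattice_of A \<in> S \<inter> T} =
        {A \<in> SL n. lattice_of A \<in> S} \<inter> {A \<in> SL n. lattice_of A \<in> T}"
      by auto
    ultimately show "S \<inter> T \<subseteq> unimodular_lattices n"
      and "openin (SL_topology n) {A \<in> SL n. lattice_of A \<in> S \<inter> T}"
      by auto
  next
    fix K
    assume K: "\<forall>S\<in>K. S \<subseteq> unimodular_lattices n \<and>
      openin (SL_topology n) {A \<in> SL n. lattice_of A \<in> S}"
    then show "\<Union>K \<subseteq> unimodular_lattices n" by auto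
    have "{A \<in> SL n. lattice_of A \<in> \<Union>K} = (\<Union>S\<in>K. {A \<in> SL n. lattice_of A \<in> S})"
      by auto
    then show "openin (SL_topology n) {A \<in> SL n. lattice_of A \<in> \<Union>K}"
      using K by auto
  qed
  then show ?thesis
    by (simp add: lattice_topology_def topology_inverse')
qed

lemma topspace_lattice_topology [simp]:
  "topspace (lattice_topology n) = unimodular_lattices n"
proof -
  have "{A \<in> SL n. lattice_of A \<in> unimodular_lattices n} = topspace (SL_topology n)"
    by (auto simp: unimodular_lattices_def)
  then have "openin (lattice_topology n) (unimodular_lattices n)"
    unfolding openin_lattice_topology by (metis openin_topspace order_refl)
  then show ?thesis
    by (metis openin_lattice_topology openin_subset openin_topspace subset_antisym)
qed

lemma quotient_map_lattice_of: "quotient_map (SL_topology n) (lattice_topology n) lattice_of"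
  by (auto simp: quotient_map_def openin_lattice_topology unimodular_lattices_def)

definition lattice_borel :: "nat \<Rightarrow> real vec set measure" where
  "lattice_borel n = sigma (unimodular_lattices n) {U. openin (lattice_topology n) U}"

text \<open>\<open>SL(n,\<real>)\<close> acts on lattices from the right: \<open>(\<int>\<^sup>n A) g = \<int>\<^sup>n (A g)\<close>. The predicate
  determines \<open>\<mu>\<close> uniquely.\<close>

definition lattice_act :: "real mat \<Rightarrow> real vec set \<Rightarrow> real vec set" where
  "lattice_act g L = (\<lambda>v. g\<^sup>T *\<^sub>v v) ` L"

definition invariant_lattice_prob :: "nat \<Rightarrow> real vec set measure \<Rightarrow> bool" where
  "invariant_lattice_prob n \<mu> \<longleftrightarrow> prob_space \<mu> \<and> sets \<mu> = sets (lattice_borel n) \<and>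
     (\<forall>g \<in> SL n. distr \<mu> \<mu> (lattice_act g) = \<mu>)"

definition lambda1 :: "real vec set \<Rightarrow> real" where
  "lambda1 L = (LEAST r. \<exists>v \<in> L. v \<noteq> 0\<^sub>v (dim_vec v) \<and> r = vnorm v)"

definition primitive_vectors :: "real vec set \<Rightarrow> real vec set" where
  "primitive_vectors L = {v \<in> L. v \<noteq> 0\<^sub>v (dim_vec v) \<and>
     \<not> (\<exists>m :: int. \<exists>w \<in> L. m \<ge> 2 \<and> v = real_of_int m \<cdot>\<^sub>v w)}"

definition prim_sharp :: "real vec set \<Rightarrow> real vec set set" where
  "prim_sharp L = primitive_vectors L //
     {(v, w). v \<in> primitive_vectors L \<and> w \<in> primitive_vectors L \<and> (w = v \<or> w = - v)}"

text \<open>Norm of a class \<open>{v, -v}\<close>; both representatives have the same norm.\<close>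

definition class_norm :: "real vec set \<Rightarrow> real" where
  "class_norm u = the_elem (vnorm ` u)"

text \<open>\<open>unit_ball_vol (real n)\<close> is the volume of the Euclidean unit ball in \<open>\<real>\<^sup>n\<close>
  (see \<open>content_cball\<close>).\<close>

definition tau :: "nat \<Rightarrow> real vec set \<Rightarrow> real" where
  "tau n u = unit_ball_vol (real n) * class_norm u ^ n"

definition g_weight :: "nat \<Rightarrow> real \<Rightarrow> real \<Rightarrow> real" where
  "g_weight n c s = exp (- (c * real n / 2) * (s powr (2 / real n) - 1))"

definition Pi_lambda :: "nat \<Rightarrow> real \<Rightarrow> real \<Rightarrow> real vec set \<Rightarrow> real" where
  "Pi_lambda n c \<gamma> L =
     (\<Sum>\<^sub>\<infinity>u \<in> {u \<in> prim_sharp L. class_norm u \<le> \<gamma> * lambda1 L}. g_weight n c (tau n u)) /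
     (\<Sum>\<^sub>\<infinity>u \<in> prim_sharp L. g_weight n c (tau n u))"

text \<open>Convergence in probability to a constant of random variables \<open>X n\<close>, \<open>n \<ge> 1\<close>, each on its own
  probability space. Measurability is part of the notion: \<^const>\<open>measure\<close> is \<open>0\<close> on
  non-measurable sets.\<close>

definition converges_in_prob ::
    "(nat \<Rightarrow> 'w measure) \<Rightarrow> (nat \<Rightarrow> 'w \<Rightarrow> real) \<Rightarrow> real \<Rightarrow> bool" where
  "converges_in_prob P X a \<longleftrightarrow>
     (\<forall>n\<ge>1. X n \<in> borel_measurable (P n)) \<and>
     (\<forall>\<epsilon>>0. (\<lambda>n. measure (P n) {\<omega> \<in> space (P n). \<bar>X n \<omega> - a\<bar> > \<epsilon>}) \<longlonglongrightarrow> 0)"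

end

theory Submission
  imports Defs
begin

text \<open>Write \<open>R\<close> for the radius of the ball of volume one and \<open>\<rho> = \<parallel>v\<parallel> / R\<close>. Then
  \<open>g(\<tau>(v)) * \<rho>^n = \<phi>(\<rho>)^n\<close> with \<open>\<phi>(r) = r exp(-c(r\<^sup>2 - 1)/2)\<close>, which has its strict maximum at
  \<open>r = 1 / sqrt c > 1\<close>. Since a ball of radius \<open>rR\<close> contains about \<open>r^n / 2\<close> classes of primitive
  vectors for \<open>r > 1\<close> and typically none for \<open>r < 1\<close>, the shortest length is close to \<open>R\<close>, and
  the sum concentrates exponentially on the vectors with \<open>\<rho>\<close> near \<open>1 / sqrt c\<close>. These are cut off
  by \<open>\<rho> \<le> \<gamma>\<close> or not according to the sign of \<open>\<gamma> - 1 / sqrt c\<close>. Upper bounds need only the first moment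
  of the number of lattice vectors in a ball, the lower bound needs the second moment of
  the number of primitive ones.

  The moments are not taken from Siegel's and Rogers' formulas. An invariant probability
  measure is unique, so it agrees with its average over the rescaled sublattices
  of prime index \<open>p\<close>. By Fatou's lemma it suffices to bound these averages for every fixed lattice
  as \<open>p \<rightarrow> \<infinity>\<close>. There the membership of a vector in a random sublattice is the condition
  \<open>x \<bullet> k \<equiv> 0 (mod p)\<close> for random \<open>x\<close>; these events are pairwise independent for primitive vectors up
  to sign, since for \<open>n \<ge> 3\<close> the \<open>2 \<times> 2\<close> minors of vectors of length \<open>O(p^(1/n))\<close> are smaller than
  \<open>p\<close>.\<close>

section \<open>Lattices, bases and the Borel structure\<close>

text \<open>Uniqueness of the invariant measure rests on ergodicity: a right-invariant measure on
  \<open>SL n\<close> has null sets that are also preserved by left translation, so an invariant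
  function of lattices is almost everywhere constant. Applied to the density of one invariant
  probability measure with respect to the sum of two, this identifies them. The Fubini arguments
  need a basis that depends measurably on the lattice; it exists because the quotient map is open
  and locally injective.

  For a fixed lattice the averages are bounded only for p large in terms of that lattice. Passing to
  the limit under the integral therefore requires bounded functions: the vector count is truncated
  first and the truncation is removed by monotone convergence, while the second moment enters only
  through the probability of a deviation.

  Constant factors may be lost freely, because in the end n-th powers of different numbers are
  compared. So the density of primitive classes is replaced by a crude fraction of the volume, and
  the weights by their maxima on geometric shells.\<close>

definition int_vecs :: "nat \<Rightarrow> (nat \<Rightarrow> int) set" where
  "int_vecs n = {..<n} \<rightarrow>\<^sub>E UNIV"

definition lvec :: "real mat \<Rightarrow> (nat \<Rightarrow> int) \<Rightarrow> real vec" where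
  "lvec A k = vec (dim_col A) (\<lambda>j. \<Sum>i<dim_row A. real_of_int (k i) * A $$ (i,j))"

text \<open>The integer matrices are kept as real matrices, so that they multiply elements of
  \<open>SL n\<close> without coercions.\<close>

definition SLZ :: "nat \<Rightarrow> real mat set" where
  "SLZ n = {A \<in> SL n. \<forall>i<n. \<forall>j<n. A $$ (i,j) \<in> \<int>}"

lemma SL_carrier: "A \<in> SL n \<Longrightarrow> A \<in> carrier_mat n n"
  by (simp add: SL_def)

lemma SL_dim [simp]: "A \<in> SL n \<Longrightarrow> dim_row A = n" "A \<in> SL n \<Longrightarrow> dim_col A = n"
  by (auto simp: SL_def)

lemma SLZ_SL: "A \<in> SLZ n \<Longrightarrow> A \<in> SL n"
  by (simp add: SLZ_def)

lemma mat_mult_entry: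
  assumes "A \<in> carrier_mat n m" "B \<in> carrier_mat m k" "i < n" "j < k"
  shows "(A * B) $$ (i,j) = (\<Sum>l<m. A $$ (i,l) * B $$ (l,j))"
  using assms by (auto simp: scalar_prod_def atLeast0LessThan intro!: sum.cong)

lemma SL_mult: "A \<in> SL n \<Longrightarrow> B \<in> SL n \<Longrightarrow> A * B \<in> SL n"
  by (auto simp: SL_def det_mult)

lemma SL_one: "1\<^sub>m n \<in> SL n"
  by (simp add: SL_def)

lemma SL_adj:
  assumes "A \<in> SL n"
  shows "adj_mat A \<in> SL n" "A * adj_mat A = 1\<^sub>m n" "adj_mat A * A = 1\<^sub>m n"
proof -
  have A: "A \<in> carrier_mat n n" and d: "det A = 1" using assms by (auto simp: SL_def)
  show *: "A * adj_mat A = 1\<^sub>m n" "adj_mat A * A = 1\<^sub>m n"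
    using adj_mat[OF A] d by (auto intro!: eq_matI)
  have "det A * det (adj_mat A) = 1"
    using det_mult[OF A adj_mat(1)[OF A]] * by simp
  then show "adj_mat A \<in> SL n" using adj_mat(1)[OF A] d by (simp add: SL_def)
qed

lemma det_Ints:
  fixes A :: "real mat"
  assumes "\<And>i j. i < dim_row A \<Longrightarrow> j < dim_col A \<Longrightarrow> A $$ (i,j) \<in> \<int>"
  shows "det A \<in> \<int>"
proof (cases "dim_row A = dim_col A")
  case True
  have "signof p * (\<Prod>i = 0..<dim_row A. A $$ (i, p i)) \<in> \<int>"
    if "p permutes {0..<dim_row A}" for p
  proof -
    have "A $$ (i, p i) \<in> \<int>" if "i \<in> {0..<dim_row A}" for i
      using that \<open>p permutes _\<close> assms True permutes_in_image[of p "{0..<dim_row A}" i] by auto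
    then have "(\<Prod>i = 0..<dim_row A. A $$ (i, p i)) \<in> \<int>" by (rule Ints_prod)
    then show ?thesis by (auto simp: sign_def intro!: Ints_mult)
  qed
  then show ?thesis using True unfolding det_def by (auto intro!: Ints_sum)
qed (simp add: det_def)

text \<open>For determinant one the adjugate is the inverse, and its entries are signed determinants
  of integer matrices. This makes \<open>SLZ n\<close> a group. That inverses are polynomial in the
  entries also makes inversion measurable later.\<close>

lemma SLZ_adj:
  assumes "A \<in> SLZ n"
  shows "adj_mat A \<in> SLZ n"
proof -
  have A: "A \<in> carrier_mat n n" using assms by (auto simp: SLZ_def SL_def)
  have "adj_mat A $$ (i,j) \<in> \<int>" if "i < n" "j < n" for i j
  proof -
    have "det (mat_delete A j i) \<in> \<int>"
      by (rule det_Ints) (use A that assms in \<open>auto simp: mat_delete_def SLZ_def\<close>)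
    then show ?thesis using A that by (auto simp: adj_mat_def cofactor_def intro!: Ints_mult)
  qed
  then show ?thesis using assms SL_adj(1)[of A n] by (auto simp: SLZ_def)
qed

lemma SLZ_mult:
  assumes "A \<in> SLZ n" "B \<in> SLZ n"
  shows "A * B \<in> SLZ n"
proof -
  have "(A * B) $$ (i,j) \<in> \<int>" if "i < n" "j < n" for i j
    using assms that
    by (subst mat_mult_entry[of _ n n _ n]) (auto simp: SLZ_def SL_def intro!: Ints_sum Ints_mult)
  then show ?thesis using assms SL_mult[of A n B] by (auto simp: SLZ_def)
qed

lemma SLZ_one: "1\<^sub>m n \<in> SLZ n"
  by (auto simp: SLZ_def SL_one)

lemma dim_lvec [simp]: "dim_vec (lvec A k) = dim_col A"
  by (simp add: lvec_def)

lemma lattice_of_eq_lvec: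
  assumes "A \<in> carrier_mat n n"
  shows "lattice_of A = lvec A ` int_vecs n"
proof -
  have eq: "A\<^sup>T *\<^sub>v map_vec real_of_int z = lvec A (restrict (\<lambda>i. z $ i) {..<n})"
    if "z \<in> carrier_vec n" for z
    using assms that by (auto simp: lvec_def scalar_prod_def atLeast0LessThan mult.commute intro!: sum.cong)
  show ?thesis
  proof (intro equalityI subsetI)
    fix v assume "v \<in> lattice_of A"
    then obtain z where z: "z \<in> carrier_vec n" "v = A\<^sup>T *\<^sub>v map_vec real_of_int z"
      using assms by (auto simp: lattice_of_def)
    then show "v \<in> lvec A ` int_vecs n"
      using eq[OF z(1)] by (auto simp: int_vecs_def)
  next
    fix v assume "v \<in> lvec A ` int_vecs n"
    then obtain k where k: "k \<in> int_vecs n" "v = lvec A k" by auto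
    have "restrict (\<lambda>i. vec n k $ i) {..<n} = k"
      using k(1) by (auto simp: int_vecs_def fun_eq_iff PiE_def extensional_def)
    then have "v = A\<^sup>T *\<^sub>v map_vec real_of_int (vec n k)"
      using eq[of "vec n k"] k by simp
    moreover have "vec n k \<in> carrier_vec (dim_row A)" using assms by auto
    ultimately show "v \<in> lattice_of A"
      unfolding lattice_of_def by blast
  qed
qed

lemma lattice_of_mult:
  assumes "A \<in> carrier_mat n n" "g \<in> carrier_mat n n"
  shows "lattice_of (A * g) = lattice_act g (lattice_of A)"
proof -
  have "(A * g)\<^sup>T *\<^sub>v map_vec real_of_int z = g\<^sup>T *\<^sub>v (A\<^sup>T *\<^sub>v map_vec real_of_int z)"
    if "z \<in> carrier_vec n" for z
  proof -
    have "(A * g)\<^sup>T = g\<^sup>T * A\<^sup>T" using assms by (rule transpose_mult)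
    then show ?thesis using assms that by (simp add: assoc_mult_mat_vec[of _ n n _ n])
  qed
  then show ?thesis using assms
    unfolding lattice_of_def lattice_act_def by (auto simp: image_iff) metis+
qed

text \<open>An integer matrix on the left moves onto the coefficients, since z (H A) = (z H) A.
  Changes of basis and the passage to sublattices are both read off from this.\<close>

lemma lvec_int_mult:
  assumes A: "A \<in> carrier_mat n n" and H: "H \<in> carrier_mat n n"
    and h: "\<And>i l. i < n \<Longrightarrow> l < n \<Longrightarrow> H $$ (i,l) = real_of_int (h i l)"
  shows "lvec (H * A) z = lvec A (\<lambda>l\<in>{..<n}. \<Sum>i<n. z i * h i l)"
proof (rule eq_vecI)
  fix j assume "j < dim_vec (lvec A (\<lambda>l\<in>{..<n}. \<Sum>i<n. z i * h i l))"
  then have j: "j < n" using A by simp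
  have "lvec (H * A) z $ j = (\<Sum>i<n. z i * (\<Sum>l<n. H $$ (i,l) * A $$ (l,j)))"
    using j A H by (auto simp: lvec_def mat_mult_entry[of _ n n _ n] simp del: index_mult_mat(1))
  also have "\<dots> = (\<Sum>i<n. \<Sum>l<n. z i * h i l * A $$ (l,j))"
    by (auto simp: sum_distrib_left h mult.assoc intro!: sum.cong)
  also have "\<dots> = (\<Sum>l<n. (\<Sum>i<n. z i * h i l) * A $$ (l,j))"
    by (subst sum.swap) (simp add: sum_distrib_right)
  also have "\<dots> = lvec A (\<lambda>l\<in>{..<n}. \<Sum>i<n. z i * h i l) $ j"
    using j A by (auto simp: lvec_def)
  finally show "lvec (H * A) z $ j = lvec A (\<lambda>l\<in>{..<n}. \<Sum>i<n. z i * h i l) $ j" .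
qed (use A in auto)

lemma lattice_of_SLZ_subset:
  assumes "c \<in> SLZ n" "A \<in> carrier_mat n n"
  shows "lattice_of (c * A) \<subseteq> lattice_of A"
proof -
  have cc: "c \<in> carrier_mat n n" using assms by (auto simp: SLZ_def SL_def)
  have "c $$ (i,l) = real_of_int \<lfloor>c $$ (i,l)\<rfloor>" if "i < n" "l < n" for i l
    using assms that by (auto simp: SLZ_def elim!: Ints_cases)
  note eq = lvec_int_mult[OF assms(2) cc this]
  have "lattice_of (c * A) = lvec (c * A) ` int_vecs n"
    using cc assms(2) by (intro lattice_of_eq_lvec) simp
  then show ?thesis
    unfolding lattice_of_eq_lvec[OF assms(2)] by (auto simp: eq int_vecs_def)
qed

lemma lattice_of_SLZ:
  assumes "c \<in> SLZ n" "A \<in> carrier_mat n n"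
  shows "lattice_of (c * A) = lattice_of A"
proof
  show "lattice_of (c * A) \<subseteq> lattice_of A" using assms by (rule lattice_of_SLZ_subset)
  have cc: "c \<in> carrier_mat n n" using assms by (auto simp: SLZ_def SL_def)
  have "lattice_of (adj_mat c * (c * A)) \<subseteq> lattice_of (c * A)"
    using assms cc by (intro lattice_of_SLZ_subset[of _ n] SLZ_adj) auto
  moreover have "adj_mat c * (c * A) = A"
    using assms cc SL_adj[of c n] SLZ_SL[OF assms(1)] adj_mat(1)[OF cc]
    by (subst assoc_mult_mat[symmetric, of _ n n _ n _ n]) auto
  ultimately show "lattice_of A \<subseteq> lattice_of (c * A)" by simp
qed

text \<open>Each row of \<open>B\<close> is a lattice vector and so has integer coefficients in the
  basis \<open>A\<close>. These form the matrix \<open>c\<close>, and \<open>det c = 1\<close>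
  because both bases have determinant one.\<close>

lemma lattice_of_eq_iff:
  assumes A: "A \<in> SL n" and B: "B \<in> SL n"
  shows "lattice_of A = lattice_of B \<longleftrightarrow> (\<exists>c \<in> SLZ n. B = c * A)"
proof
  assume "\<exists>c \<in> SLZ n. B = c * A"
  then show "lattice_of A = lattice_of B" using lattice_of_SLZ SL_carrier[OF A] by metis
next
  assume eq: "lattice_of A = lattice_of B"
  have cA: "A \<in> carrier_mat n n" and cB: "B \<in> carrier_mat n n" using A B by (auto simp: SL_def)
  have "\<exists>k \<in> int_vecs n. vec n (\<lambda>j. B $$ (i,j)) = lvec A k" if "i < n" for i
  proof -
    \<comment> \<open>The i-th unit coefficient vector; it selects row \<open>i\<close> of
      \<open>B\<close>.\<close>
    define e where "e = restrict (\<lambda>l. if l = i then 1 else (0::int)) {..<n}"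
    have "(\<Sum>l<n. real_of_int (e l) * B $$ (l,j)) = (\<Sum>l<n. if l = i then B $$ (i,j) else 0)" for j
      by (rule sum.cong) (auto simp: e_def)
    then have "lvec B e = vec n (\<lambda>j. B $$ (i,j))"
      using cB that by (auto simp: lvec_def)
    moreover have "e \<in> int_vecs n" by (auto simp: e_def int_vecs_def)
    ultimately have "vec n (\<lambda>j. B $$ (i,j)) \<in> lattice_of B"
      unfolding lattice_of_eq_lvec[OF cB] by (metis imageI)
    then show ?thesis using eq lattice_of_eq_lvec[OF cA] by auto
  qed
  then obtain k where k: "\<And>i. i < n \<Longrightarrow> vec n (\<lambda>j. B $$ (i,j)) = lvec A (k i)" by metis
  define c where "c = mat n n (\<lambda>(i,j). real_of_int (k i j))"
  have cc: "c \<in> carrier_mat n n" by (simp add: c_def)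
  have BcA: "B = c * A"
  proof (rule eq_matI)
    fix i j assume "i < dim_row (c * A)" "j < dim_col (c * A)"
    then have ij: "i < n" "j < n" using cc cA by auto
    have "B $$ (i,j) = lvec A (k i) $ j"
      using arg_cong[OF k[OF ij(1)], of "\<lambda>v. v $ j"] ij by simp
    also have "\<dots> = (c * A) $$ (i,j)"
      using ij cc cA by (simp add: mat_mult_entry[of _ n n _ n] lvec_def c_def del: index_mult_mat(1))
    finally show "B $$ (i,j) = (c * A) $$ (i,j)" .
  qed (use cc cA cB in auto)
  have "det c * det A = det B" using det_mult[OF cc cA] BcA by simp
  then have "det c = 1" using A B by (simp add: SL_def)
  then have "c \<in> SLZ n" using cc by (auto simp: SLZ_def SL_def c_def)
  then show "\<exists>c \<in> SLZ n. B = c * A" using BcA by blast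
qed

lemma lattice_act_SL:
  assumes "L \<in> unimodular_lattices n" "g \<in> SL n"
  shows "lattice_act g L \<in> unimodular_lattices n"
proof -
  obtain A where A: "A \<in> SL n" "L = lattice_of A"
    using assms by (auto simp: unimodular_lattices_def)
  then show ?thesis
    using assms lattice_of_mult[of A n g] SL_mult[of A n g] by (auto simp: unimodular_lattices_def SL_carrier)
qed

section \<open>Entrywise description of the topology and the Borel sets of
  \<open>SL n\<close>\<close>

lemma openin_SL_iff:
  "openin (SL_topology n) U \<longleftrightarrow> U \<subseteq> SL n \<and>
    (\<forall>A\<in>U. \<exists>d>0. \<forall>B\<in>SL n. (\<forall>i<n. \<forall>j<n. \<bar>B $$ (i,j) - A $$ (i,j)\<bar> < d) \<longrightarrow> B \<in> U)"
  (is "?l \<longleftrightarrow> ?r")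
proof
  define I where "I = {..<n} \<times> {..<n}"
  define f where "f = (\<lambda>A::real mat. \<lambda>ij\<in>I. A $$ ij)"
  define T where "T = product_topology (\<lambda>_. euclideanreal) I"
  have top: "SL_topology n = pullback_topology (SL n) f T"
    by (simp add: SL_topology_def f_def I_def T_def)
  have finI: "finite I" by (simp add: I_def)
  {
    assume ?l
    then obtain V where V: "openin T V" "U = f -` V \<inter> SL n"
      by (auto simp: top openin_pullback_topology)
    have "\<exists>d>0. \<forall>B\<in>SL n. (\<forall>i<n. \<forall>j<n. \<bar>B $$ (i,j) - A $$ (i,j)\<bar> < d) \<longrightarrow> B \<in> U"
      if "A \<in> U" for A
    proof -
      have "f A \<in> V" using V that by auto
      then obtain W where W: "\<And>ij. ij \<in> I \<Longrightarrow> open (W ij)" "f A \<in> Pi\<^sub>E I W" "Pi\<^sub>E I W \<subseteq> V"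
        using V(1) unfolding T_def openin_product_topology_alt by auto metis
      have "\<exists>d>0. \<forall>y. \<bar>y - A $$ ij\<bar> < d \<longrightarrow> y \<in> W ij" if "ij \<in> I" for ij
      proof -
        have "A $$ ij \<in> W ij" using W(2) that by (auto simp: f_def PiE_iff)
        then show ?thesis using W(1)[OF that] by (auto simp: open_dist dist_real_def)
      qed
      then obtain d where d: "\<And>ij. ij \<in> I \<Longrightarrow> d ij > 0"
        "\<And>ij y. ij \<in> I \<Longrightarrow> \<bar>y - A $$ ij\<bar> < d ij \<Longrightarrow> y \<in> W ij" by metis
      \<comment> \<open>The inserted 1 keeps the minimum meaningful for \<open>n = 0\<close>, when
        \<open>I\<close> is empty.\<close>
      define e where "e = Min (insert 1 (d ` I))"
      have e: "e > 0" "\<And>ij. ij \<in> I \<Longrightarrow> e \<le> d ij" using finI d(1) by (auto simp: e_def)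
      have "B \<in> U" if "B \<in> SL n" "\<forall>i<n. \<forall>j<n. \<bar>B $$ (i,j) - A $$ (i,j)\<bar> < e" for B
      proof -
        have "f B \<in> Pi\<^sub>E I W" using that e(2) d(2)
          by (fastforce simp: f_def I_def)
        then show ?thesis using W(3) V(2) that by auto
      qed
      then show ?thesis using e(1) by blast
    qed
    then show ?r using V(2) by auto
  }
  {
    assume r: ?r
    then obtain d where d: "\<And>A. A \<in> U \<Longrightarrow> d A > 0"
      "\<And>A B. A \<in> U \<Longrightarrow> B \<in> SL n \<Longrightarrow> (\<forall>i<n. \<forall>j<n. \<bar>B $$ (i,j) - A $$ (i,j)\<bar> < d A) \<Longrightarrow> B \<in> U"
      by metis
    define V where "V = (\<Union>A\<in>U. Pi\<^sub>E I (\<lambda>ij. ball (A $$ ij) (d A)))"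
    have "openin T V" unfolding V_def T_def
      by (intro openin_Union ballI, auto intro!: openin_Union simp: openin_PiE finI)
    moreover have "U = f -` V \<inter> SL n"
    proof (intro equalityI subsetI)
      fix A assume "A \<in> U"
      then show "A \<in> f -` V \<inter> SL n" using d(1) r
        by (auto simp: V_def f_def intro!: bexI[of _ A])
    next
      fix B assume "B \<in> f -` V \<inter> SL n"
      then obtain A where A: "A \<in> U" "B \<in> SL n" "f B \<in> Pi\<^sub>E I (\<lambda>ij. ball (A $$ ij) (d A))"
        by (auto simp: V_def)
      have "\<bar>B $$ (i,j) - A $$ (i,j)\<bar> < d A" if "i < n" "j < n" for i j
        using PiE_mem[OF A(3), of "(i,j)"] that by (auto simp: f_def I_def dist_real_def abs_minus_commute)
      then show "B \<in> U" using d(2)[OF A(1,2)] by auto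
    qed
    ultimately show ?l unfolding top openin_pullback_topology by auto
  }
qed

definition SL_borel :: "nat \<Rightarrow> real mat measure" where
  "SL_borel n = sigma (SL n) {U. openin (SL_topology n) U}"

lemma open_SL_subset: "{U. openin (SL_topology n) U} \<subseteq> Pow (SL n)"
  using openin_subset[of "SL_topology n"] by auto

lemma open_lattice_subset: "{U. openin (lattice_topology n) U} \<subseteq> Pow (unimodular_lattices n)"
  using openin_subset[of "lattice_topology n"] by auto

lemma space_SL_borel [simp]: "space (SL_borel n) = SL n"
  unfolding SL_borel_def by (rule space_measure_of[OF open_SL_subset])

lemma sets_SL_borel: "sets (SL_borel n) = sigma_sets (SL n) {U. openin (SL_topology n) U}"
  unfolding SL_borel_def by (rule sets_measure_of[OF open_SL_subset])

lemma space_lattice_borel [simp]: "space (lattice_borel n) = unimodular_lattices n"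
  unfolding lattice_borel_def by (rule space_measure_of[OF open_lattice_subset])

lemma sets_lattice_borel:
  "sets (lattice_borel n) = sigma_sets (unimodular_lattices n) {U. openin (lattice_topology n) U}"
  unfolding lattice_borel_def by (rule sets_measure_of[OF open_lattice_subset])

definition SL_box :: "nat \<Rightarrow> (nat \<times> nat \<Rightarrow> real) \<Rightarrow> real \<Rightarrow> real mat set" where
  "SL_box n q d = {A \<in> SL n. \<forall>i<n. \<forall>j<n. \<bar>A $$ (i,j) - q (i,j)\<bar> < d}"

definition rational_boxes :: "nat \<Rightarrow> real mat set set" where
  "rational_boxes n = (\<lambda>(q, m). SL_box n q (1 / real (Suc m))) ` (({..<n} \<times> {..<n} \<rightarrow>\<^sub>E \<rat>) \<times> (UNIV :: nat set))"

lemma countable_rational_boxes: "countable (rational_boxes n)"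
  unfolding rational_boxes_def
  by (intro countable_image countable_SIGMA countable_PiE) (auto simp: countable_rat)

lemma openin_SL_box: "openin (SL_topology n) (SL_box n q d)"
  unfolding openin_SL_iff
proof (intro conjI ballI)
  show "SL_box n q d \<subseteq> SL n" by (auto simp: SL_box_def)
  fix A assume A: "A \<in> SL_box n q d"
  define I where "I = {..<n} \<times> {..<n}"
  define e where "e = Min (insert 1 ((\<lambda>ij. d - \<bar>A $$ ij - q ij\<bar>) ` I))"
  have fin: "finite I" by (simp add: I_def)
  have e0: "e > 0" using A fin by (auto simp: e_def SL_box_def I_def)
  have e: "e \<le> d - \<bar>A $$ (i,j) - q (i,j)\<bar>" if "i < n" "j < n" for i j
    unfolding e_def by (rule Min_le) (use fin that in \<open>auto simp: I_def\<close>)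
  have "B \<in> SL_box n q d" if "B \<in> SL n" "\<forall>i<n. \<forall>j<n. \<bar>B $$ (i,j) - A $$ (i,j)\<bar> < e" for B
    using that e by (fastforce simp: SL_box_def)
  then show "\<exists>d'>0. \<forall>B\<in>SL n. (\<forall>i<n. \<forall>j<n. \<bar>B $$ (i,j) - A $$ (i,j)\<bar> < d') \<longrightarrow> B \<in> SL_box n q d"
    using e0 by blast
qed

text \<open>The centre lies within one radius of \<open>A\<close> in every entry, so the box stays
  within two radii of \<open>A\<close>; hence a radius below d / 2. The countable base obtained here
  is what reduces measurability to single entries.\<close>

lemma rational_box_basis:
  assumes "openin (SL_topology n) U" "A \<in> U"
  obtains b where "b \<in> rational_boxes n" "A \<in> b" "b \<subseteq> U"
proof -
  have AS: "A \<in> SL n" using assms openin_subset by fastforce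
  obtain d where d: "d > 0" "\<And>B. B \<in> SL n \<Longrightarrow> (\<forall>i<n. \<forall>j<n. \<bar>B $$ (i,j) - A $$ (i,j)\<bar> < d) \<Longrightarrow> B \<in> U"
    using assms unfolding openin_SL_iff by blast
  obtain m where m: "1 / real (Suc m) < d / 2"
    using d(1) nat_approx_posE[of "d/2"] by auto
  have "\<exists>q\<in>\<rat>. \<bar>A $$ ij - q\<bar> < 1 / real (Suc m)" for ij
  proof -
    obtain q where "q \<in> \<rat>" "A $$ ij < q" "q < A $$ ij + 1 / real (Suc m)"
      using Rats_dense_in_real[of "A $$ ij" "A $$ ij + 1 / real (Suc m)"] by auto
    then show ?thesis by (intro bexI[of _ q]) auto
  qed
  then obtain q where q: "\<And>ij. q ij \<in> \<rat>" "\<And>ij. \<bar>A $$ ij - q ij\<bar> < 1 / real (Suc m)" by metis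
  define q' where "q' = restrict q ({..<n} \<times> {..<n})"
  have "SL_box n q' (1 / real (Suc m)) \<in> rational_boxes n"
    unfolding rational_boxes_def using q(1) by (intro image_eqI[of _ _ "(q', m)"]) (auto simp: q'_def)
  moreover have "A \<in> SL_box n q' (1 / real (Suc m))"
    using AS q(2) by (auto simp: SL_box_def q'_def)
  moreover have "SL_box n q' (1 / real (Suc m)) \<subseteq> U"
  proof
    fix B assume B: "B \<in> SL_box n q' (1 / real (Suc m))"
    have "\<bar>B $$ (i,j) - A $$ (i,j)\<bar> < d" if "i < n" "j < n" for i j
    proof -
      have "\<bar>B $$ (i,j) - q (i,j)\<bar> < 1 / real (Suc m)"
        using B that by (auto simp: SL_box_def q'_def)
      then show ?thesis using q(2)[of "(i,j)"] m by linarith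
    qed
    then show "B \<in> U" using d(2) B by (auto simp: SL_box_def)
  qed
  ultimately show thesis by (rule that)
qed

lemma rational_box_Union:
  assumes "openin (SL_topology n) U"
  shows "U = \<Union>{b \<in> rational_boxes n. b \<subseteq> U}"
  using rational_box_basis[OF assms] by blast

text \<open>An open set is a countable union of boxes, and the preimage of a box is a finite
  conjunction of conditions on single entries.\<close>

lemma measurable_SL_borelI:
  assumes "\<And>x. x \<in> space M \<Longrightarrow> f x \<in> SL n"
    and "\<And>i j. i < n \<Longrightarrow> j < n \<Longrightarrow> (\<lambda>x. f x $$ (i,j)) \<in> borel_measurable M"
  shows "f \<in> M \<rightarrow>\<^sub>M SL_borel n"
  unfolding SL_borel_def
proof (rule measurable_measure_of[OF open_SL_subset])
  show "f \<in> space M \<rightarrow> SL n" using assms by auto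
  fix U assume "U \<in> {U. openin (SL_topology n) U}"
  then have U: "openin (SL_topology n) U" by simp
  have "f -` U \<inter> space M = (\<Union>b\<in>{b \<in> rational_boxes n. b \<subseteq> U}. f -` b \<inter> space M)"
    by (subst rational_box_Union[OF U]) auto
  also have "\<dots> \<in> sets M"
  proof (rule sets.countable_UN'')
    show "countable {b \<in> rational_boxes n. b \<subseteq> U}"
      using countable_rational_boxes by (rule countable_subset[rotated]) auto
    fix b assume "b \<in> {b \<in> rational_boxes n. b \<subseteq> U}"
    then obtain q d where b: "b = SL_box n q d" by (auto simp: rational_boxes_def)
    have "f -` b \<inter> space M =
        {x \<in> space M. \<forall>i\<in>{..<n}. \<forall>j\<in>{..<n}. \<bar>f x $$ (i,j) - q (i,j)\<bar> < d}"
      using assms(1) by (auto simp: b SL_box_def)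
    also have "\<dots> \<in> sets M"
    proof (intro sets.sets_Collect_finite_All finite_lessThan)
      fix i j assume "i \<in> {..<n}" "j \<in> {..<n}"
      then have [measurable]: "(\<lambda>x. f x $$ (i,j)) \<in> borel_measurable M" using assms(2) by auto
      show "{x \<in> space M. \<bar>f x $$ (i,j) - q (i,j)\<bar> < d} \<in> sets M" by measurable
    qed
    finally show "f -` b \<inter> space M \<in> sets M" .
  qed
  finally show "f -` U \<inter> space M \<in> sets M" .
qed

lemma measurable_SL_entry [measurable]:
  assumes "i < n" "j < n"
  shows "(\<lambda>A. A $$ (i,j)) \<in> borel_measurable (SL_borel n)"
proof (rule borel_measurableI)
  fix S :: "real set" assume S: "open S"
  have "openin (SL_topology n) ((\<lambda>A. A $$ (i,j)) -` S \<inter> SL n)"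
    unfolding openin_SL_iff
  proof (intro conjI ballI)
    fix A assume A: "A \<in> (\<lambda>A. A $$ (i,j)) -` S \<inter> SL n"
    then obtain e where "e > 0" "\<And>y. \<bar>y - A $$ (i,j)\<bar> < e \<Longrightarrow> y \<in> S"
      using S by (auto simp: open_dist dist_real_def)
    then show "\<exists>d>0. \<forall>B\<in>SL n. (\<forall>i<n. \<forall>j<n. \<bar>B $$ (i,j) - A $$ (i,j)\<bar> < d) \<longrightarrow>
        B \<in> (\<lambda>A. A $$ (i,j)) -` S \<inter> SL n"
      using assms by (intro exI[of _ e]) auto
  qed auto
  then show "(\<lambda>A. A $$ (i,j)) -` S \<inter> space (SL_borel n) \<in> sets (SL_borel n)"
    by (simp add: sets_SL_borel sigma_sets.Basic)
qed

lemma measurable_SL_mult [measurable]: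
  assumes f: "f \<in> M \<rightarrow>\<^sub>M SL_borel n" and g: "g \<in> M \<rightarrow>\<^sub>M SL_borel n"
  shows "(\<lambda>x. f x * g x) \<in> M \<rightarrow>\<^sub>M SL_borel n"
proof (rule measurable_SL_borelI)
  fix x assume x: "x \<in> space M"
  show "f x * g x \<in> SL n"
    using measurable_space[OF f x] measurable_space[OF g x] by (simp add: SL_mult)
next
  fix i j assume ij: "i < n" "j < n"
  have "(\<lambda>x. \<Sum>l<n. f x $$ (i,l) * g x $$ (l,j)) \<in> borel_measurable M"
    using ij by (intro borel_measurable_sum borel_measurable_times
        measurable_compose[OF f measurable_SL_entry] measurable_compose[OF g measurable_SL_entry]) auto
  also have "?this \<longleftrightarrow> (\<lambda>x. (f x * g x) $$ (i,j)) \<in> borel_measurable M"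
    by (rule measurable_cong)
      (use ij measurable_space[OF f] measurable_space[OF g] in
        \<open>simp add: mat_mult_entry[of _ n n _ n] SL_carrier del: index_mult_mat\<close>)
  finally show "(\<lambda>x. (f x * g x) $$ (i,j)) \<in> borel_measurable M" .
qed


lemma measurable_lattice_of [measurable]: "lattice_of \<in> SL_borel n \<rightarrow>\<^sub>M lattice_borel n"
  unfolding lattice_borel_def
proof (rule measurable_measure_of[OF open_lattice_subset])
  show "lattice_of \<in> space (SL_borel n) \<rightarrow> unimodular_lattices n"
    by (auto simp: unimodular_lattices_def)
  fix U assume "U \<in> {U. openin (lattice_topology n) U}"
  then have "openin (SL_topology n) {A \<in> SL n. lattice_of A \<in> U}"
    by (simp add: openin_lattice_topology)
  moreover have "lattice_of -` U \<inter> space (SL_borel n) = {A \<in> SL n. lattice_of A \<in> U}" by auto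
  ultimately show "lattice_of -` U \<inter> space (SL_borel n) \<in> sets (SL_borel n)"
    by (simp add: sets_SL_borel sigma_sets.Basic)
qed

lemma measurable_det:
  assumes "\<And>x. x \<in> space M \<Longrightarrow> F x \<in> carrier_mat m m"
    and "\<And>i j. i < m \<Longrightarrow> j < m \<Longrightarrow> (\<lambda>x. F x $$ (i,j)) \<in> borel_measurable M"
  shows "(\<lambda>x. det (F x) :: real) \<in> borel_measurable M"
proof -
  have "(\<lambda>x. \<Sum>p | p permutes {0..<m}. signof p * (\<Prod>i = 0..<m. F x $$ (i, p i))) \<in> borel_measurable M"
  proof (intro borel_measurable_sum borel_measurable_times borel_measurable_prod borel_measurable_const)
    fix p i assume "p \<in> {p. p permutes {0..<m}}" "i \<in> {0..<m}"
    then show "(\<lambda>x. F x $$ (i, p i)) \<in> borel_measurable M"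
      using permutes_in_image[of p "{0..<m}" i] by (intro assms(2)) auto
  qed
  also have "?this \<longleftrightarrow> (\<lambda>x. det (F x)) \<in> borel_measurable M"
    by (rule measurable_cong, subst det_def'[OF assms(1)]) auto
  finally show ?thesis .
qed

lemma measurable_SL_adj [measurable]:
  assumes f: "f \<in> M \<rightarrow>\<^sub>M SL_borel n"
  shows "(\<lambda>x. adj_mat (f x)) \<in> M \<rightarrow>\<^sub>M SL_borel n"
proof (rule measurable_SL_borelI)
  fix x assume "x \<in> space M"
  then show "adj_mat (f x) \<in> SL n" using measurable_space[OF f] SL_adj(1) by auto
next
  fix i j assume ij: "i < n" "j < n"
  have dim: "f x \<in> carrier_mat n n" if "x \<in> space M" for x
    using measurable_space[OF f that] by (simp add: SL_carrier)
  have "(\<lambda>x. det (mat_delete (f x) j i)) \<in> borel_measurable M"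
  proof (rule measurable_det[where m = "n - 1"])
    fix k l assume kl: "k < n - 1" "l < n - 1"
    define k' l' where "k' = (if k < j then k else Suc k)" and "l' = (if l < i then l else Suc l)"
    have "(\<lambda>x. f x $$ (k',l')) \<in> borel_measurable M"
      by (rule measurable_compose[OF f measurable_SL_entry]) (use kl in \<open>auto simp: k'_def l'_def\<close>)
    also have "?this \<longleftrightarrow> (\<lambda>x. mat_delete (f x) j i $$ (k,l)) \<in> borel_measurable M"
    proof (rule measurable_cong)
      fix x assume "x \<in> space M"
      then show "f x $$ (k',l') = mat_delete (f x) j i $$ (k,l)"
        using dim[of x] kl by (simp add: mat_delete_def k'_def l'_def)
    qed
    finally show "(\<lambda>x. mat_delete (f x) j i $$ (k,l)) \<in> borel_measurable M" .
  qed (use dim ij in \<open>fastforce simp: mat_delete_def\<close>)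
  then have "(\<lambda>x. (-1) ^ (j + i) * det (mat_delete (f x) j i)) \<in> borel_measurable M"
    by measurable
  also have "?this \<longleftrightarrow> (\<lambda>x. adj_mat (f x) $$ (i,j)) \<in> borel_measurable M"
  proof (rule measurable_cong)
    fix x assume "x \<in> space M"
    then show "(-1) ^ (j + i) * det (mat_delete (f x) j i) = adj_mat (f x) $$ (i,j)"
      using dim[of x] ij by (simp add: adj_mat_def cofactor_def)
  qed
  finally show "(\<lambda>x. adj_mat (f x) $$ (i,j)) \<in> borel_measurable M" .
qed

section \<open>Openness and local injectivity of the quotient map\<close>

definition mnorm :: "nat \<Rightarrow> real mat \<Rightarrow> real" where
  "mnorm n A = (\<Sum>i<n. \<Sum>j<n. \<bar>A $$ (i,j)\<bar>)"

lemma mnorm_nonneg: "mnorm n A \<ge> 0"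
  by (simp add: mnorm_def sum_nonneg)

lemma entry_le_mnorm: "i < n \<Longrightarrow> j < n \<Longrightarrow> \<bar>A $$ (i,j)\<bar> \<le> mnorm n A"
proof -
  assume "i < n" "j < n"
  then have "\<bar>A $$ (i,j)\<bar> \<le> (\<Sum>j<n. \<bar>A $$ (i,j)\<bar>)"
    by (intro member_le_sum) auto
  also have "\<dots> \<le> mnorm n A" unfolding mnorm_def
    using \<open>i < n\<close> by (intro member_le_sum[of i "{..<n}" "\<lambda>i. \<Sum>j<n. \<bar>A $$ (i,j)\<bar>"]) (auto simp: sum_nonneg)
  finally show ?thesis .
qed

text \<open>The entrywise sum norm is used because it dominates every entry and is
  submultiplicative, so that perturbations of a basis can be followed through products.\<close>

lemma mnorm_mult:
  assumes "A \<in> carrier_mat n n" "B \<in> carrier_mat n n"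
  shows "mnorm n (A * B) \<le> mnorm n A * mnorm n B"
proof -
  have "\<bar>(A * B) $$ (i,j)\<bar> \<le> (\<Sum>l<n. \<bar>A $$ (i,l)\<bar> * \<bar>B $$ (l,j)\<bar>)" if "i < n" "j < n" for i j
    using sum_abs[of "\<lambda>l. A $$ (i,l) * B $$ (l,j)" "{..<n}"] that assms
    by (simp add: mat_mult_entry[of _ n n _ n] abs_mult del: index_mult_mat)
  then have "mnorm n (A * B) \<le> (\<Sum>i<n. \<Sum>j<n. \<Sum>l<n. \<bar>A $$ (i,l)\<bar> * \<bar>B $$ (l,j)\<bar>)"
    unfolding mnorm_def by (intro sum_mono) auto
  also have "\<dots> = (\<Sum>i<n. \<Sum>l<n. \<bar>A $$ (i,l)\<bar> * (\<Sum>j<n. \<bar>B $$ (l,j)\<bar>))"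
    by (subst sum.swap) (simp add: sum_distrib_left)
  also have "\<dots> \<le> (\<Sum>i<n. \<Sum>l<n. \<bar>A $$ (i,l)\<bar> * mnorm n B)"
    unfolding mnorm_def
    by (intro sum_mono mult_left_mono member_le_sum[of _ "{..<n}" "\<lambda>i. \<Sum>j<n. \<bar>B $$ (i,j)\<bar>"])
      (auto simp: sum_nonneg)
  also have "\<dots> = mnorm n A * mnorm n B"
    by (simp add: mnorm_def sum_distrib_right)
  finally show ?thesis .
qed

lemma mnorm_diff_less:
  assumes "A \<in> carrier_mat n n" "B \<in> carrier_mat n n"
    and "\<forall>i<n. \<forall>j<n. \<bar>A $$ (i,j) - B $$ (i,j)\<bar> < d"
  shows "mnorm n (A - B) \<le> real n * real n * d"
proof -
  have "mnorm n (A - B) \<le> (\<Sum>i<n. \<Sum>j<n. d)"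
    unfolding mnorm_def using assms by (intro sum_mono) (auto intro: less_imp_le)
  then show ?thesis by simp
qed

text \<open>If \<open>c * A\<close> lies in \<open>W\<close>, then so does \<open>c * A'\<close> for
  \<open>A'\<close> close to \<open>A\<close>, since left multiplication is continuous. Hence the
  set of all bases of lattices in the image is open, which is openness in the quotient
  topology.\<close>

lemma openin_lattice_image:
  assumes W: "openin (SL_topology n) W"
  shows "openin (lattice_topology n) (lattice_of ` W)"
  unfolding openin_lattice_topology
proof
  have WS: "W \<subseteq> SL n" using openin_subset[OF W] by simp
  then show "lattice_of ` W \<subseteq> unimodular_lattices n" by (auto simp: unimodular_lattices_def)
  show "openin (SL_topology n) {A \<in> SL n. lattice_of A \<in> lattice_of ` W}"
    unfolding openin_SL_iff
  proof (intro conjI ballI)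
    fix A assume "A \<in> {A \<in> SL n. lattice_of A \<in> lattice_of ` W}"
    then obtain B where A: "A \<in> SL n" and B: "B \<in> W" "lattice_of A = lattice_of B" by auto
    then obtain c where c: "c \<in> SLZ n" "B = c * A" using lattice_of_eq_iff[of A n B] WS by auto
    obtain d where d: "d > 0"
      "\<And>B'. B' \<in> SL n \<Longrightarrow> (\<forall>i<n. \<forall>j<n. \<bar>B' $$ (i,j) - B $$ (i,j)\<bar> < d) \<Longrightarrow> B' \<in> W"
      using W B(1) unfolding openin_SL_iff by blast
    \<comment> \<open>The added 1 makes \<open>K\<close> positive and the final comparison (K - 1) *
      d / K < d strict.\<close>
    define K where "K = mnorm n c * (real n * real n) + 1"
    have K: "K > 0" using mnorm_nonneg[of n c] by (simp add: K_def add_nonneg_pos)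
    have cc: "c \<in> carrier_mat n n" and cA: "A \<in> carrier_mat n n"
      using c A by (auto simp: SLZ_def SL_def)
    have "A' \<in> {A \<in> SL n. lattice_of A \<in> lattice_of ` W}"
      if A': "A' \<in> SL n" and near: "\<forall>i<n. \<forall>j<n. \<bar>A' $$ (i,j) - A $$ (i,j)\<bar> < d / K" for A'
    proof -
      have cA': "A' \<in> carrier_mat n n" using A' by (simp add: SL_def)
      have "\<bar>(c * A') $$ (i,j) - B $$ (i,j)\<bar> < d" if ij: "i < n" "j < n" for i j
      proof -
        have "\<bar>(c * A') $$ (i,j) - B $$ (i,j)\<bar> = \<bar>(c * (A' - A)) $$ (i,j)\<bar>"
          using ij cc cA cA' by (simp add: mult_minus_distrib_mat[of _ n n _ n] c(2) del: index_mult_mat(1))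
        also have "\<dots> \<le> mnorm n (c * (A' - A))" using ij by (rule entry_le_mnorm)
        also have "\<dots> \<le> mnorm n c * mnorm n (A' - A)"
          using cc cA cA' by (intro mnorm_mult) auto
        also have "\<dots> \<le> mnorm n c * (real n * real n * (d / K))"
          using cA cA' near by (intro mult_left_mono mnorm_diff_less mnorm_nonneg) auto
        also have "\<dots> = (K - 1) * d / K" by (simp add: K_def)
        also have "\<dots> < d" using K d(1) by (simp add: field_simps)
        finally show ?thesis .
      qed
      then have "c * A' \<in> W" using d(2) SL_mult[OF SLZ_SL[OF c(1)] A'] by auto
      moreover have "lattice_of (c * A') = lattice_of A'" using c(1) cA' by (rule lattice_of_SLZ)
      ultimately show ?thesis using A' by (metis (mono_tags, lifting) imageI mem_Collect_eq)
    qed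
    then show "\<exists>d>0. \<forall>B\<in>SL n. (\<forall>i<n. \<forall>j<n. \<bar>B $$ (i,j) - A $$ (i,j)\<bar> < d) \<longrightarrow>
        B \<in> {A \<in> SL n. lattice_of A \<in> lattice_of ` W}"
      using K d(1) by (intro exI[of _ "d / K"]) auto
  qed auto
qed

text \<open>This is the discreteness of \<open>SLZ n\<close>: if \<open>B\<close> and
  \<open>c * B\<close> are both close to \<open>A\<close>, then \<open>c\<close> minus the identity
  is an integer matrix of norm less than one, hence zero.\<close>

lemma locally_inj_lattice_of:
  assumes A: "A \<in> SL n"
  obtains W where "openin (SL_topology n) W" "A \<in> W" "inj_on lattice_of W"
proof -
  define b where "b = mnorm n (adj_mat A)"
  define K where "K = real n * real n * b + 1"
  have b0: "b \<ge> 0" unfolding b_def by (rule mnorm_nonneg)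
  then have K: "K > 0" by (simp add: K_def add_nonneg_pos)
  define d where "d = 1 / (4 * K)"
  have d: "d > 0" using K by (simp add: d_def)
  have nd: "real n * real n * d * b \<le> 1 / 4"
  proof -
    have "real n * real n * d * b = (K - 1) * d" by (simp add: K_def)
    also have "\<dots> \<le> K * d" using d by (intro mult_right_mono) auto
    also have "\<dots> = 1 / 4" using K by (simp add: d_def)
    finally show ?thesis .
  qed
  have cA: "A \<in> carrier_mat n n" using A by (simp add: SL_def)
  have cI: "adj_mat A \<in> carrier_mat n n" using adj_mat(1)[OF cA] .
  define W where "W = SL_box n (\<lambda>ij. A $$ ij) d"
  have "inj_on lattice_of W"
  proof (rule inj_onI)
    fix B C assume BC: "B \<in> W" "C \<in> W" "lattice_of B = lattice_of C"
    then have BS: "B \<in> SL n" "C \<in> SL n" by (auto simp: W_def SL_box_def)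
    then obtain c where c: "c \<in> SLZ n" "C = c * B" using BC lattice_of_eq_iff by blast
    have cm: "B \<in> carrier_mat n n" "C \<in> carrier_mat n n" "c \<in> carrier_mat n n"
      using BS c(1) by (auto simp: SLZ_def SL_def)
    define N where "N = c - 1\<^sub>m n"
    have cN: "N \<in> carrier_mat n n" unfolding N_def by (intro minus_carrier_mat one_carrier_mat)
    have NB: "N * B = C - B"
      using cm by (simp add: N_def minus_mult_distrib_mat[of _ n n _ _ n] c(2))
    have "N = N * (A * adj_mat A)" using SL_adj(2)[OF A] cN by simp
    also have "\<dots> = N * A * adj_mat A" using cN cA cI by (simp add: assoc_mult_mat)
    \<comment> \<open>\<open>N * A\<close> is written with two small differences and with
      \<open>N\<close> itself times a small matrix, so that the last term can be absorbed. The
      outcome is |N| \<le> (2 + |N|) / 4, that is, |N| \<le> 2/3.\<close>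
    also have "N * A = (C - A) + (A - B) + N * (A - B)"
    proof -
      have "N * (A - B) = N * A - N * B" using cN cA cm by (simp add: mult_minus_distrib_mat)
      then have "N * (A - B) = N * A - (C - B)" using NB by simp
      then show ?thesis using cN cA cm by (auto intro!: eq_matI)
    qed
    finally have Neq: "N = ((C - A) + (A - B) + N * (A - B)) * adj_mat A" .
    have tri: "mnorm n (X + Y) \<le> mnorm n X + mnorm n Y"
      if "X \<in> carrier_mat n n" "Y \<in> carrier_mat n n" for X Y
    proof -
      have "mnorm n (X + Y) \<le> (\<Sum>i<n. \<Sum>j<n. \<bar>X $$ (i,j)\<bar> + \<bar>Y $$ (i,j)\<bar>)"
        unfolding mnorm_def using that by (intro sum_mono) auto
      then show ?thesis by (simp add: mnorm_def sum.distrib)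
    qed
    have D: "mnorm n (C - A) \<le> real n * real n * d" "mnorm n (A - B) \<le> real n * real n * d"
      using BC cm cA by (auto intro!: mnorm_diff_less simp: W_def SL_box_def abs_minus_commute)
    have "mnorm n N \<le> mnorm n ((C - A) + (A - B) + N * (A - B)) * b"
      unfolding b_def by (subst Neq, rule mnorm_mult) (use cm cA cN cI in auto)
    also have "\<dots> \<le> (mnorm n (C - A) + mnorm n (A - B) + mnorm n N * mnorm n (A - B)) * b"
      using cm cA cN b0
      by (intro mult_right_mono order_trans[OF tri] add_mono mnorm_mult order_refl) auto
    also have "\<dots> \<le> (real n * real n * d + real n * real n * d + mnorm n N * (real n * real n * d)) * b"
      using D b0 by (intro mult_right_mono add_mono mult_left_mono mnorm_nonneg) auto
    also have "\<dots> = (2 + mnorm n N) * (real n * real n * d * b)" by (simp add: algebra_simps)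
    also have "\<dots> \<le> (2 + mnorm n N) * (1 / 4)"
      using nd mnorm_nonneg[of n N] by (intro mult_left_mono) auto
    finally have N1: "mnorm n N < 1" by simp
    have "N $$ (i,j) = 0" if "i < n" "j < n" for i j
    proof -
      have "N $$ (i,j) \<in> \<int>" using that c(1) cm by (auto simp: N_def SLZ_def)
      moreover have "\<bar>N $$ (i,j)\<bar> < 1" using entry_le_mnorm[OF that, of N] N1 by simp
      ultimately show ?thesis by (auto elim!: Ints_cases)
    qed
    then have "c = 1\<^sub>m n" using cm by (intro eq_matI) (fastforce simp: N_def)+
    then show "B = C" using c cm by simp
  qed
  moreover have "A \<in> W" using A d by (simp add: W_def SL_box_def)
  moreover have "openin (SL_topology n) W" unfolding W_def by (rule openin_SL_box)
  ultimately show thesis using that by blast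
qed


text \<open>Open sets have open images. Injectivity on \<open>Q\<close> carries the induction
  through complements, since the image then commutes with set difference.\<close>

lemma lattice_image_borel:
  assumes Q: "Q \<subseteq> SL n" "openin (SL_topology n) Q" "inj_on lattice_of Q"
    and B: "B \<in> sets (SL_borel n)"
  shows "lattice_of ` (B \<inter> Q) \<in> sets (lattice_borel n)"
  using B unfolding sets_SL_borel
proof (induction rule: sigma_sets.induct)
  case (Basic U)
  then have "openin (lattice_topology n) (lattice_of ` (U \<inter> Q))"
    using Q by (intro openin_lattice_image) auto
  then show ?case by (simp add: sets_lattice_borel sigma_sets.Basic)
next
  case Empty
  then show ?case by simp
next
  case (Compl B)
  have "lattice_of ` ((SL n - B) \<inter> Q) = lattice_of ` Q - lattice_of ` (B \<inter> Q)"
    using Q by (auto simp: inj_on_def)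
  moreover have "lattice_of ` Q \<in> sets (lattice_borel n)"
    using Q by (simp add: sets_lattice_borel sigma_sets.Basic openin_lattice_image)
  ultimately show ?case using Compl by auto
next
  case (Union B)
  have "lattice_of ` ((\<Union>i. B i) \<inter> Q) = (\<Union>i. lattice_of ` (B i \<inter> Q))" by auto
  then show ?case using Union by auto
qed

text \<open>Countably many boxes on which the quotient map is injective cover \<open>SL n\<close>. A
  lattice is sent to its unique basis in the first box, in a fixed enumeration, that contains one of
  its bases; on each piece this is an inverse with Borel images.\<close>

lemma ex_lattice_section:
  "\<exists>s. s \<in> lattice_borel n \<rightarrow>\<^sub>M SL_borel n \<and> (\<forall>L \<in> unimodular_lattices n. lattice_of (s L) = L)"
proof -
  define Qs where "Qs = {b \<in> rational_boxes n. inj_on lattice_of b}"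
  have cQs: "countable Qs"
    unfolding Qs_def using countable_rational_boxes by (rule countable_subset[rotated]) auto
  have cover: "\<exists>Q\<in>Qs. A \<in> Q" if A: "A \<in> SL n" for A
  proof -
    obtain W where W: "openin (SL_topology n) W" "A \<in> W" "inj_on lattice_of W"
      using locally_inj_lattice_of[OF A] .
    obtain b where "b \<in> rational_boxes n" "A \<in> b" "b \<subseteq> W" using rational_box_basis[OF W(1,2)] .
    then show ?thesis using W(3) by (auto simp: Qs_def intro: inj_on_subset)
  qed
  then have "Qs \<noteq> {}" using SL_one by auto
  define Q where "Q = from_nat_into Qs"
  have Q: "Q i \<in> Qs" for i unfolding Q_def using \<open>Qs \<noteq> {}\<close> by (rule from_nat_into)
  have Qo: "openin (SL_topology n) (Q i)" and Qi: "inj_on lattice_of (Q i)" for i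
    using Q[of i] by (auto simp: Qs_def rational_boxes_def openin_SL_box)
  have Qsub: "Q i \<subseteq> SL n" for i using openin_subset[OF Qo] by simp
  define V where "V i = lattice_of ` Q i" for i
  have Vm: "V i \<in> sets (lattice_borel n)" for i
    unfolding V_def using Qo by (simp add: sets_lattice_borel sigma_sets.Basic openin_lattice_image)
  have Vcover: "\<exists>i. L \<in> V i" if L: "L \<in> unimodular_lattices n" for L
  proof -
    obtain A where A: "A \<in> SL n" "L = lattice_of A" using L by (auto simp: unimodular_lattices_def)
    obtain q where "q \<in> Qs" "A \<in> q" using cover[OF A(1)] by blast
    moreover from this obtain i where "q = Q i"
      unfolding Q_def using cQs by (metis from_nat_into_to_nat_on)
    ultimately show ?thesis using A by (auto simp: V_def)
  qed
  define ix where "ix L = (LEAST i. L \<in> V i)" for L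
  define s where "s L = the_inv_into (Q (ix L)) lattice_of L" for L
  have ix: "L \<in> V (ix L)" if "L \<in> unimodular_lattices n" for L
    unfolding ix_def using Vcover[OF that] by (rule LeastI_ex)
  have s: "s L \<in> Q (ix L)" "lattice_of (s L) = L" if "L \<in> unimodular_lattices n" for L
  proof -
    have *: "L \<in> lattice_of ` Q (ix L)" using ix[OF that] by (simp add: V_def)
    show "s L \<in> Q (ix L)" unfolding s_def by (rule the_inv_into_into[OF Qi * order_refl])
    show "lattice_of (s L) = L" unfolding s_def by (rule f_the_inv_into_f[OF Qi *])
  qed
  have "s \<in> lattice_borel n \<rightarrow>\<^sub>M SL_borel n"
  proof (rule measurableI)
    fix L assume "L \<in> space (lattice_borel n)"
    then show "s L \<in> space (SL_borel n)" using s(1)[of L] Qsub by auto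
  next
    fix B assume B: "B \<in> sets (SL_borel n)"
    \<comment> \<open>Subtracting the earlier images \<open>V j\<close> leaves exactly the lattices
      for which box \<open>i\<close> is the first choice, so \<open>s\<close> is a single local
      inverse there.\<close>
    have "s -` B \<inter> space (lattice_borel n)
        = (\<Union>i. lattice_of ` (B \<inter> Q i) - (\<Union>j<i. V j))"
    proof (intro equalityI subsetI)
      fix L assume "L \<in> s -` B \<inter> space (lattice_borel n)"
      then have L: "L \<in> unimodular_lattices n" "s L \<in> B" by simp_all
      have "L \<in> lattice_of ` (B \<inter> Q (ix L))"
        using s[OF L(1)] L(2) by (intro image_eqI[of _ _ "s L"]) simp_all
      moreover have "L \<notin> V j" if "j < ix L" for j
        using not_less_Least[of j "\<lambda>i. L \<in> V i"] that by (auto simp: ix_def)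
      ultimately show "L \<in> (\<Union>i. lattice_of ` (B \<inter> Q i) - (\<Union>j<i. V j))" by blast
    next
      fix L assume "L \<in> (\<Union>i. lattice_of ` (B \<inter> Q i) - (\<Union>j<i. V j))"
      then obtain i A where iA: "A \<in> B" "A \<in> Q i" "L = lattice_of A" "\<And>j. j < i \<Longrightarrow> L \<notin> V j" by auto
      have L: "L \<in> unimodular_lattices n" using iA Qsub by (auto simp: unimodular_lattices_def)
      have "L \<in> V i" using iA by (auto simp: V_def)
      then have "ix L = i" unfolding ix_def using iA(4) by (intro Least_equality) (simp, metis not_le)
      then have "s L = A" unfolding s_def iA(3) using the_inv_into_f_f[OF Qi iA(2)] by simp
      then have "s L \<in> B" using iA(1) by simp
      then show "L \<in> s -` B \<inter> space (lattice_borel n)" using L by simp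
    qed
    also have "\<dots> \<in> sets (lattice_borel n)"
      by (intro sets.countable_UN subsetI, elim imageE, hypsubst)
        (intro sets.Diff lattice_image_borel[OF Qsub Qo Qi B] sets.countable_UN'' Vm; simp)
    finally show "s -` B \<inter> space (lattice_borel n) \<in> sets (lattice_borel n)" .
  qed
  then show ?thesis using s(2) by (intro exI[of _ s] conjI ballI)
qed

definition lattice_section :: "nat \<Rightarrow> real vec set \<Rightarrow> real mat" where
  "lattice_section n = (SOME s. s \<in> lattice_borel n \<rightarrow>\<^sub>M SL_borel n \<and>
     (\<forall>L \<in> unimodular_lattices n. lattice_of (s L) = L))"

lemma measurable_lattice_section [measurable]:
    "lattice_section n \<in> lattice_borel n \<rightarrow>\<^sub>M SL_borel n"
  and lattice_of_section [simp]:
    "L \<in> unimodular_lattices n \<Longrightarrow> lattice_of (lattice_section n L) = L"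
  using someI_ex[OF ex_lattice_section[of n]] unfolding lattice_section_def by (simp_all only:)

lemma lattice_section_SL: "L \<in> unimodular_lattices n \<Longrightarrow> lattice_section n L \<in> SL n"
  using measurable_space[OF measurable_lattice_section[of n], of L] by simp

text \<open>The section replaces a lattice by a basis, so that measurability on the quotient can be
  checked on \<open>SL n\<close>, where entries are available.\<close>

lemma measurable_lattice_descent:
  assumes f: "(\<lambda>A. f (lattice_of A)) \<in> SL_borel n \<rightarrow>\<^sub>M M"
  shows "f \<in> lattice_borel n \<rightarrow>\<^sub>M M"
proof -
  have "(\<lambda>L. f (lattice_of (lattice_section n L))) \<in> lattice_borel n \<rightarrow>\<^sub>M M"
    by (rule measurable_compose[OF measurable_lattice_section f])
  also have "?this \<longleftrightarrow> f \<in> lattice_borel n \<rightarrow>\<^sub>M M"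
    by (rule measurable_cong) simp
  finally show ?thesis .
qed

lemma measurable_lattice_act_pair:
  assumes f: "f \<in> M \<rightarrow>\<^sub>M lattice_borel n" and g: "g \<in> M \<rightarrow>\<^sub>M SL_borel n"
  shows "(\<lambda>x. lattice_act (g x) (f x)) \<in> M \<rightarrow>\<^sub>M lattice_borel n"
proof -
  have "(\<lambda>x. lattice_of (lattice_section n (f x) * g x)) \<in> M \<rightarrow>\<^sub>M lattice_borel n"
    using measurable_compose[OF f measurable_lattice_section] g by measurable
  also have "?this \<longleftrightarrow> ?thesis"
  proof (rule measurable_cong)
    fix x assume "x \<in> space M"
    then have "f x \<in> unimodular_lattices n" "g x \<in> SL n"
      using measurable_space[OF f] measurable_space[OF g] by auto
    then show "lattice_of (lattice_section n (f x) * g x) = lattice_act (g x) (f x)"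
      by (simp add: lattice_of_mult[of _ n] SL_carrier lattice_section_SL)
  qed
  finally show ?thesis .
qed

text \<open>Countability makes the counting measure on the fibres sigma-finite, as Fubini
  requires.\<close>

lemma countable_SLZ: "countable (SLZ n)"
proof -
  have "SLZ n \<subseteq> (\<lambda>f. mat n n f) ` ({..<n} \<times> {..<n} \<rightarrow>\<^sub>E \<int>)"
  proof
    fix A assume A: "A \<in> SLZ n"
    have "A = mat n n (restrict (\<lambda>ij. A $$ ij) ({..<n} \<times> {..<n}))"
      using A by (intro eq_matI) (auto simp: SLZ_def)
    moreover have "restrict (\<lambda>ij. A $$ ij) ({..<n} \<times> {..<n}) \<in> {..<n} \<times> {..<n} \<rightarrow>\<^sub>E \<int>"
      using A by (auto simp: SLZ_def)
    ultimately show "A \<in> (\<lambda>f. mat n n f) ` ({..<n} \<times> {..<n} \<rightarrow>\<^sub>E \<int>)" by blast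
  qed
  moreover have "countable ({..<n} \<times> {..<n} \<rightarrow>\<^sub>E (\<int> :: real set))"
    by (intro countable_PiE) (auto simp: countable_int)
  ultimately show ?thesis by (meson countable_image countable_subset)
qed

section \<open>Uniqueness of the invariant probability measure\<close>

lemma SL_inverse_unique:
  assumes "A \<in> SL n" "B \<in> SL n" "A * B = 1\<^sub>m n"
  shows "adj_mat A = B"
proof -
  have c: "A \<in> carrier_mat n n" "B \<in> carrier_mat n n" "adj_mat A \<in> carrier_mat n n"
    using assms SL_adj(1)[OF assms(1)] by (auto simp: SL_def)
  have "adj_mat A = adj_mat A * (A * B)" using assms c by simp
  also have "\<dots> = B" using c SL_adj(3)[OF assms(1)] by (subst assoc_mult_mat[symmetric, of _ n n _ n _ n]) auto
  finally show ?thesis .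
qed

lemma SL_adj_adj: "A \<in> SL n \<Longrightarrow> adj_mat (adj_mat A) = A"
  by (rule SL_inverse_unique) (auto simp: SL_adj)

lemma SL_mult_assoc:
  "A \<in> SL n \<Longrightarrow> B \<in> SL n \<Longrightarrow> C \<in> SL n \<Longrightarrow> A * B * C = A * (B * C)"
  by (rule assoc_mult_mat) (auto intro: SL_carrier)

lemma SL_cancel:
  assumes "A \<in> SL n" "B \<in> SL n"
  shows "A * (adj_mat A * B) = B" "adj_mat A * (A * B) = B"
    "B * A * adj_mat A = B" "B * adj_mat A * A = B"
  using assms SL_adj[OF assms(1)] SL_carrier[OF assms(2)]
  by (simp_all add: SL_mult_assoc[symmetric, of _ n] SL_mult_assoc[of B n] del: assoc_mult_mat)

lemma SL_adj_mult:
  assumes "A \<in> SL n" "B \<in> SL n"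
  shows "adj_mat (A * B) = adj_mat B * adj_mat A"
proof (rule SL_inverse_unique)
  show "A * B * (adj_mat B * adj_mat A) = 1\<^sub>m n"
    using assms SL_adj[OF assms(1)] SL_adj[OF assms(2)] by (simp add: SL_mult_assoc SL_cancel SL_mult)
qed (use assms in \<open>auto intro!: SL_mult SL_adj\<close>)

text \<open>The section commutes with the action only up to an integer matrix. Arguments that move
  the section past \<open>g\<close> absorb this factor by a permutation, of \<open>SLZ n\<close>
  here and of residue vectors for Hecke averages.\<close>

lemma lattice_act_section:
  assumes "L \<in> unimodular_lattices n" "g \<in> SL n"
  obtains c where "c \<in> SLZ n" "lattice_section n L * g = c * lattice_section n (lattice_act g L)"
proof -
  have s: "lattice_section n L \<in> SL n" "lattice_section n (lattice_act g L) \<in> SL n"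
    using assms by (auto intro: lattice_section_SL lattice_act_SL)
  have "lattice_of (lattice_section n L * g) = lattice_act g L"
    using assms s by (simp add: lattice_of_mult[of _ n] SL_carrier)
  then have "lattice_of (lattice_section n (lattice_act g L)) = lattice_of (lattice_section n L * g)"
    using assms by (simp add: lattice_act_SL)
  then show thesis using that lattice_of_eq_iff[of "lattice_section n (lattice_act g L)" n "lattice_section n L * g"] s assms
    by (auto simp: SL_mult)
qed

lemma lattice_act_of: "A \<in> SL n \<Longrightarrow> g \<in> SL n \<Longrightarrow> lattice_act g (lattice_of A) = lattice_of (A * g)"
  by (simp add: lattice_of_mult[of _ n] SL_carrier)

text \<open>The total mass is finite and nonzero rather than one because the context is applied to
  the sum of two probability measures.\<close>

locale invariant_lattice_measure = finite_measure \<nu> for \<nu> :: "real vec set measure" +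
  fixes n :: nat
  assumes sets_nu: "sets \<nu> = sets (lattice_borel n)"
    and inv: "g \<in> SL n \<Longrightarrow> distr \<nu> \<nu> (lattice_act g) = \<nu>"
    and nonzero: "emeasure \<nu> (space \<nu>) \<noteq> 0"
begin

lemma space_nu: "space \<nu> = unimodular_lattices n"
  using sets_eq_imp_space_eq[OF sets_nu] by simp

text \<open>A matrix in \<open>SL n\<close> is a lattice together with a position in the fibre over
  it. Statements about the lifted measure are phrased through \<open>\<Psi>\<close> on this product,
  whose sigma-finiteness is immediate.\<close>

definition W where "W = \<nu> \<Otimes>\<^sub>M count_space (SLZ n)"

text \<open>Pushing \<open>W\<close> forward along \<open>\<Psi>\<close> lifts \<open>\<nu>\<close> to a right Haar measure on \<open>SL n\<close>.\<close>

definition \<Psi> where "\<Psi> w = snd w * lattice_section n (fst w)"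

sublocale cs: sigma_finite_measure "count_space (SLZ n)"
  by (rule sigma_finite_measure_count_space_countable[OF countable_SLZ])

sublocale nc: pair_sigma_finite \<nu> "count_space (SLZ n)" ..

lemma sigma_finite_W: "sigma_finite_measure W"
  unfolding W_def by unfold_locales

sublocale W: sigma_finite_measure W by (rule sigma_finite_W)

sublocale WW: pair_sigma_finite W W ..

sublocale nW: pair_sigma_finite \<nu> W ..

lemma measurable_nu: "f \<in> lattice_borel n \<rightarrow>\<^sub>M M \<longleftrightarrow> f \<in> \<nu> \<rightarrow>\<^sub>M M"
  using measurable_cong_sets[OF sets_nu, of M M] by auto

lemma measurable_Psi [measurable]: "\<Psi> \<in> W \<rightarrow>\<^sub>M SL_borel n"
proof -
  have "snd \<in> W \<rightarrow>\<^sub>M SL_borel n"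
  proof -
    have "(\<lambda>c. c) \<in> count_space (SLZ n) \<rightarrow>\<^sub>M SL_borel n" by (auto simp: SLZ_SL)
    from measurable_compose[OF measurable_snd this] show ?thesis by (simp add: W_def)
  qed
  moreover have "(\<lambda>w. lattice_section n (fst w)) \<in> W \<rightarrow>\<^sub>M SL_borel n"
    unfolding W_def using measurable_compose[OF measurable_fst] measurable_lattice_section measurable_nu by blast
  ultimately show ?thesis unfolding \<Psi>_def by measurable
qed

lemma space_W: "space W = unimodular_lattices n \<times> SLZ n"
  by (simp add: W_def space_pair_measure space_nu)

lemma Psi_SL: "w \<in> space W \<Longrightarrow> \<Psi> w \<in> SL n"
  using measurable_space[OF measurable_Psi] by simp

lemma W_nontrivial: "\<not> (AE w in W. False)"
proof
  assume "AE w in W. False"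
  then have *: "AE L in \<nu>. AE c in count_space (SLZ n). False"
    unfolding W_def by (rule nc.AE_pair)
  have "AE L in \<nu>. False"
  proof -
    have "SLZ n \<noteq> {}" using SLZ_one[of n] by blast
    with * show ?thesis by (simp add: AE_count_space)
  qed
  then have "emeasure \<nu> (space \<nu>) = 0" by (simp add: AE_iff_measurable[of "space \<nu>"])
  then show False using nonzero by simp
qed

lemma nn_integral_W:
  assumes F: "F \<in> borel_measurable (SL_borel n)"
  shows "(\<integral>\<^sup>+w. F (\<Psi> w) \<partial>W) = (\<integral>\<^sup>+L. \<integral>\<^sup>+c. F (c * lattice_section n L) \<partial>count_space (SLZ n) \<partial>\<nu>)"
proof -
  have "(\<lambda>w. F (\<Psi> w)) \<in> borel_measurable (\<nu> \<Otimes>\<^sub>M count_space (SLZ n))"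
    using measurable_compose[OF measurable_Psi F] by (simp add: W_def)
  from cs.nn_integral_fst[OF this] show ?thesis by (simp add: W_def \<Psi>_def)
qed

text \<open>Summing \<open>F\<close> over a fibre gives the function \<open>G\<close> of lattices.
  Acting by \<open>g\<close> changes the representative by \<open>c0\<close>, and right
  multiplication by \<open>c0\<close> merely permutes the fibre; the invariance of
  \<open>\<nu>\<close> does the rest.\<close>

lemma nn_integral_right_invariant:
  assumes F: "F \<in> borel_measurable (SL_borel n)" and g: "g \<in> SL n"
  shows "(\<integral>\<^sup>+w. F (\<Psi> w * g) \<partial>W) = (\<integral>\<^sup>+w. F (\<Psi> w) \<partial>W)"
proof -
  define G where "G L = (\<integral>\<^sup>+c. F (c * lattice_section n L) \<partial>count_space (SLZ n))" for L
  have Gm: "G \<in> borel_measurable \<nu>"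
  proof -
    have "(\<lambda>w. F (\<Psi> w)) \<in> borel_measurable (\<nu> \<Otimes>\<^sub>M count_space (SLZ n))"
      using measurable_compose[OF measurable_Psi F] by (simp add: W_def)
    from cs.borel_measurable_nn_integral_fst[OF this] show ?thesis by (simp add: \<Psi>_def G_def[abs_def])
  qed
  have Fg: "(\<lambda>A. F (A * g)) \<in> borel_measurable (SL_borel n)"
    using g by (intro measurable_compose[OF _ F] measurable_SL_mult) auto
  have "(\<integral>\<^sup>+w. F (\<Psi> w * g) \<partial>W) =
      (\<integral>\<^sup>+L. \<integral>\<^sup>+c. F (c * lattice_section n L * g) \<partial>count_space (SLZ n) \<partial>\<nu>)"
    by (rule nn_integral_W[OF Fg])
  also have "\<dots> = (\<integral>\<^sup>+L. G (lattice_act g L) \<partial>\<nu>)"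
  proof (rule nn_integral_cong)
    fix L assume "L \<in> space \<nu>"
    then have L: "L \<in> unimodular_lattices n" by (simp add: space_nu)
    then obtain c0 where c0: "c0 \<in> SLZ n"
      "lattice_section n L * g = c0 * lattice_section n (lattice_act g L)"
      using lattice_act_section g by blast
    have s: "lattice_section n L \<in> SL n" "lattice_section n (lattice_act g L) \<in> SL n" "c0 \<in> SL n"
      using L g c0 by (auto intro: lattice_section_SL lattice_act_SL SLZ_SL)
    have bij: "bij_betw (\<lambda>c. c * c0) (SLZ n) (SLZ n)"
      by (rule bij_betwI[where g = "\<lambda>c. c * adj_mat c0"])
        (use c0 SL_cancel(3,4)[OF s(3) SLZ_SL] in \<open>auto intro!: SLZ_mult SLZ_adj\<close>)
    have "(\<integral>\<^sup>+c. F (c * lattice_section n L * g) \<partial>count_space (SLZ n)) =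
        (\<integral>\<^sup>+c. F ((c * c0) * lattice_section n (lattice_act g L)) \<partial>count_space (SLZ n))"
    proof (rule nn_integral_cong)
      fix c assume "c \<in> space (count_space (SLZ n))"
      then have c: "c \<in> SL n" by (simp add: SLZ_SL)
      show "F (c * lattice_section n L * g) = F ((c * c0) * lattice_section n (lattice_act g L))"
        using SL_mult_assoc[OF c s(1) g] SL_mult_assoc[OF c s(3) s(2)] c0(2) by simp
    qed
    also have "\<dots> = G (lattice_act g L)"
      unfolding G_def by (rule nn_integral_bij_count_space[OF bij])
    finally show "(\<integral>\<^sup>+c. F (c * lattice_section n L * g) \<partial>count_space (SLZ n)) = G (lattice_act g L)" .
  qed
  also have "\<dots> = (\<integral>\<^sup>+L. G L \<partial>distr \<nu> \<nu> (lattice_act g))"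
  proof -
    have "lattice_act g \<in> \<nu> \<rightarrow>\<^sub>M \<nu>"
      using measurable_lattice_act_pair[of "\<lambda>x. x" "lattice_borel n" n "\<lambda>_. g"] g
        measurable_cong_sets[OF sets_nu sets_nu] by auto
    from nn_integral_distr[OF this, of G] Gm show ?thesis by simp
  qed
  also have "\<dots> = (\<integral>\<^sup>+w. F (\<Psi> w) \<partial>W)"
    unfolding inv[OF g] by (simp add: nn_integral_W[OF F] G_def)
  finally show ?thesis .
qed

lemma AE_right_invariant:
  assumes N: "N \<in> sets (SL_borel n)" and g: "g \<in> SL n"
  shows "(AE w in W. \<Psi> w * g \<notin> N) \<longleftrightarrow> (AE w in W. \<Psi> w \<notin> N)"
proof -
  have ind: "(\<lambda>A. indicator N A :: ennreal) \<in> borel_measurable (SL_borel n)" using N by auto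
  have m: "(\<lambda>w. indicator N (\<Psi> w) :: ennreal) \<in> borel_measurable W"
    by (rule measurable_compose[OF measurable_Psi ind])
  have mg: "(\<lambda>w. indicator N (\<Psi> w * g) :: ennreal) \<in> borel_measurable W"
    using g by (intro measurable_compose[OF _ ind] measurable_SL_mult) auto
  have "(AE w in W. \<Psi> w * g \<notin> N) \<longleftrightarrow> (AE w in W. indicator N (\<Psi> w * g) = (0::ennreal))"
    by (simp add: indicator_eq_0_iff)
  also have "\<dots> \<longleftrightarrow> (\<integral>\<^sup>+w. indicator N (\<Psi> w * g) \<partial>W) = 0"
    using nn_integral_0_iff_AE[OF mg] by simp
  also have "\<dots> \<longleftrightarrow> (\<integral>\<^sup>+w. indicator N (\<Psi> w) \<partial>W) = 0"
    using nn_integral_right_invariant[OF ind g] by simp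
  also have "\<dots> \<longleftrightarrow> (AE w in W. indicator N (\<Psi> w) = (0::ennreal))"
    using nn_integral_0_iff_AE[OF m] by simp
  also have "\<dots> \<longleftrightarrow> (AE w in W. \<Psi> w \<notin> N)" by (simp add: indicator_eq_0_iff)
  finally show ?thesis .
qed

text \<open>For fixed w', right invariance shows that \<Psi> w (\<Psi> w')^(-1) avoids
  \<open>N\<close> for almost every w. Fubini exchanges the quantifiers, so some w0 works for almost
  every w'. After inversion, \<Psi> w' (\<Psi> w0)^(-1) avoids the inverse of \<open>N\<close>, and
  right invariance removes the fixed factor.\<close>

lemma AE_inverse:
  assumes N: "N \<in> sets (SL_borel n)" and null: "AE w in W. \<Psi> w \<notin> N"
  shows "AE w in W. adj_mat (\<Psi> w) \<notin> N"
proof -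
  have "AE w' in W. AE w in W. \<Psi> w * adj_mat (\<Psi> w') \<notin> N"
    by (rule AE_I2, subst AE_right_invariant[OF N]) (simp_all add: SL_adj Psi_SL null)
  moreover have "{x \<in> space (W \<Otimes>\<^sub>M W). \<Psi> (snd x) * adj_mat (\<Psi> (fst x)) \<notin> N} \<in> sets (W \<Otimes>\<^sub>M W)"
  proof -
    have "(\<lambda>x. \<Psi> (snd x) * adj_mat (\<Psi> (fst x))) \<in> W \<Otimes>\<^sub>M W \<rightarrow>\<^sub>M SL_borel n"
      by measurable
    from measurable_sets[OF this sets.compl_sets[OF N]]
    have "(\<lambda>x. \<Psi> (snd x) * adj_mat (\<Psi> (fst x))) -` (SL n - N) \<inter> space (W \<Otimes>\<^sub>M W) \<in> sets (W \<Otimes>\<^sub>M W)"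
      by simp
    also have "(\<lambda>x. \<Psi> (snd x) * adj_mat (\<Psi> (fst x))) -` (SL n - N) \<inter> space (W \<Otimes>\<^sub>M W)
      = {x \<in> space (W \<Otimes>\<^sub>M W). \<Psi> (snd x) * adj_mat (\<Psi> (fst x)) \<notin> N}"
      by (auto simp: space_pair_measure intro!: SL_mult SL_adj Psi_SL)
    finally show ?thesis .
  qed
  ultimately have ae: "AE w in W. AE w' in W. \<Psi> w * adj_mat (\<Psi> w') \<notin> N"
    using WW.AE_commute[of "\<lambda>w' w. \<Psi> w * adj_mat (\<Psi> w') \<notin> N"] by simp
  \<comment> \<open>Because \<open>W\<close> is not the zero measure, an almost everywhere statement
    holds at some actual point.\<close>
  have "\<exists>w0\<in>space W. AE w' in W. \<Psi> w0 * adj_mat (\<Psi> w') \<notin> N"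
  proof (rule ccontr)
    assume *: "\<not> ?thesis"
    from ae have "AE w in W. False"
      by (rule AE_mp) (rule AE_I2, use * in blast)
    then show False using W_nontrivial by simp
  qed
  then obtain w0 where w0: "w0 \<in> space W" "AE w' in W. \<Psi> w0 * adj_mat (\<Psi> w') \<notin> N"
    by blast
  define N' where "N' = (\<lambda>A. adj_mat A) -` N \<inter> space (SL_borel n)"
  have N': "N' \<in> sets (SL_borel n)"
    unfolding N'_def by (rule measurable_sets[OF measurable_SL_adj N]) simp
  have "AE w' in W. \<Psi> w' * adj_mat (\<Psi> w0) \<notin> N'"
    using w0(2)
  proof (rule AE_mp, intro AE_I2 impI)
    fix w' assume w': "w' \<in> space W" "\<Psi> w0 * adj_mat (\<Psi> w') \<notin> N"
    have "adj_mat (\<Psi> w' * adj_mat (\<Psi> w0)) = \<Psi> w0 * adj_mat (\<Psi> w')"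
      using SL_adj_mult[OF Psi_SL[OF w'(1)] SL_adj(1)[OF Psi_SL[OF w0(1)]]]
        SL_adj_adj[OF Psi_SL[OF w0(1)]] by simp
    then show "\<Psi> w' * adj_mat (\<Psi> w0) \<notin> N'" using w'(2) by (simp add: N'_def)
  qed
  then have "AE w' in W. \<Psi> w' \<notin> N'"
    using AE_right_invariant[OF N'] w0(1) Psi_SL SL_adj by blast
  then show ?thesis
  proof (rule AE_mp, intro AE_I2 impI)
    fix w assume w: "w \<in> space W" "\<Psi> w \<notin> N'"
    then show "adj_mat (\<Psi> w) \<notin> N" using Psi_SL[OF w(1)] by (simp add: N'_def)
  qed
qed

text \<open>Inversion preserves null sets and turns left multiplication into right multiplication,
  so right invariance is transported by inverting before and after.\<close>

lemma AE_left_invariant: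
  assumes N: "N \<in> sets (SL_borel n)" and a: "a \<in> SL n" and null: "AE w in W. \<Psi> w \<notin> N"
  shows "AE w in W. a * \<Psi> w \<notin> N"
proof -
  define N1 where "N1 = (\<lambda>A. a * adj_mat A) -` N \<inter> space (SL_borel n)"
  have N1: "N1 \<in> sets (SL_borel n)"
    unfolding N1_def using a by (intro measurable_sets[OF _ N] measurable_SL_mult measurable_SL_adj) auto
  have "AE w in W. adj_mat (\<Psi> w) \<notin> N" using AE_inverse[OF N null] .
  then have "AE w in W. \<Psi> w * a \<notin> N1"
  proof (rule AE_mp, intro AE_I2 impI)
    fix w assume w: "w \<in> space W" "adj_mat (\<Psi> w) \<notin> N"
    have "a * adj_mat (\<Psi> w * a) = adj_mat (\<Psi> w)"
      using SL_adj_mult[OF Psi_SL[OF w(1)] a] SL_cancel(1)[OF a SL_adj(1)[OF Psi_SL[OF w(1)]]] by simp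
    then show "\<Psi> w * a \<notin> N1" using w by (simp add: N1_def)
  qed
  then have "AE w in W. \<Psi> w \<notin> N1" using AE_right_invariant[OF N1 a] by simp
  from AE_inverse[OF N1 this] show ?thesis
  proof (rule AE_mp, intro AE_I2 impI)
    fix w assume w: "w \<in> space W" "adj_mat (\<Psi> w) \<notin> N1"
    then show "a * \<Psi> w \<notin> N"
      using SL_adj_adj[OF Psi_SL[OF w(1)]] SL_adj(1)[OF Psi_SL[OF w(1)]] by (simp add: N1_def)
  qed
qed

text \<open>The exceptional null set in \<open>hinv\<close> depends on \<open>g\<close>. By Fubini,
  almost every lattice satisfies the identity for almost every \<open>g\<close>. For such a lattice
  with basis a, left translation by the inverse of a shows that h of the lattice of \<Psi> w equals
  the value at the given lattice for almost every w. The left side does not mention the given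
  lattice, so all these values agree.\<close>

lemma invariant_function_const:
  fixes h :: "real vec set \<Rightarrow> ennreal"
  assumes h: "h \<in> borel_measurable \<nu>"
    and hinv: "\<And>g. g \<in> SL n \<Longrightarrow> AE L in \<nu>. h (lattice_act g L) = h L"
  shows "\<exists>k. AE L in \<nu>. h L = k"
proof -
  have hl: "h \<in> borel_measurable (lattice_borel n)" using h measurable_nu by blast
  have hp: "(\<lambda>A. h (lattice_of A)) \<in> borel_measurable (SL_borel n)"
    by (rule measurable_compose[OF measurable_lattice_of hl])
  have "AE w in W. AE L in \<nu>. h (lattice_act (\<Psi> w) L) = h L"
    by (intro AE_I2 hinv Psi_SL)
  moreover have "{x \<in> space (\<nu> \<Otimes>\<^sub>M W). h (lattice_act (\<Psi> (snd x)) (fst x)) = h (fst x)} \<in> sets (\<nu> \<Otimes>\<^sub>M W)"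
  proof -
    have f: "fst \<in> \<nu> \<Otimes>\<^sub>M W \<rightarrow>\<^sub>M lattice_borel n"
      using measurable_fst[of \<nu> W] measurable_cong_sets[OF refl sets_nu] by auto
    have "(\<lambda>x. h (lattice_act (\<Psi> (snd x)) (fst x))) \<in> borel_measurable (\<nu> \<Otimes>\<^sub>M W)"
      by (intro measurable_compose[OF _ hl] measurable_lattice_act_pair[OF f]) measurable
    moreover have "(\<lambda>x. h (fst x)) \<in> borel_measurable (\<nu> \<Otimes>\<^sub>M W)"
      by (rule measurable_compose[OF f hl])
    ultimately show ?thesis by measurable
  qed
  ultimately have ae: "AE L in \<nu>. AE w in W. h (lattice_act (\<Psi> w) L) = h L"
    using nW.AE_commute[of "\<lambda>L w. h (lattice_act (\<Psi> w) L) = h L"] by simp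
  have gen: "AE w in W. h (lattice_of (\<Psi> w)) = h L"
    if L: "L \<in> unimodular_lattices n" and *: "AE w in W. h (lattice_act (\<Psi> w) L) = h L" for L
  proof -
    define a where "a = lattice_section n L"
    have a: "a \<in> SL n" "lattice_of a = L" using L by (auto simp: a_def lattice_section_SL)
    define N where "N = {A \<in> space (SL_borel n). h (lattice_of (a * A)) \<noteq> h L}"
    have "(\<lambda>A. h (lattice_of (a * A))) \<in> borel_measurable (SL_borel n)"
      using a by (intro measurable_compose[OF _ hp] measurable_SL_mult) auto
    then have N: "N \<in> sets (SL_borel n)" unfolding N_def by measurable
    have "AE w in W. \<Psi> w \<notin> N"
      using *
    proof (rule AE_mp, intro AE_I2 impI)
      fix w assume w: "w \<in> space W" "h (lattice_act (\<Psi> w) L) = h L"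
      then show "\<Psi> w \<notin> N" using lattice_act_of[OF a(1) Psi_SL[OF w(1)]] a(2) by (simp add: N_def)
    qed
    then have "AE w in W. adj_mat a * \<Psi> w \<notin> N"
      using AE_left_invariant[OF N] a SL_adj by blast
    then show ?thesis
    proof (rule AE_mp, intro AE_I2 impI)
      fix w assume w: "w \<in> space W" "adj_mat a * \<Psi> w \<notin> N"
      then show "h (lattice_of (\<Psi> w)) = h L"
        using SL_cancel(1)[OF a(1) Psi_SL[OF w(1)]] SL_mult[OF SL_adj(1)[OF a(1)] Psi_SL[OF w(1)]]
        by (simp add: N_def)
    qed
  qed
  have "\<exists>L0\<in>space \<nu>. AE w in W. h (lattice_act (\<Psi> w) L0) = h L0"
  proof (rule ccontr)
    assume *: "\<not> ?thesis"
    from ae have "AE L in \<nu>. False"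
      by (rule AE_mp) (rule AE_I2, use * in blast)
    then have "emeasure \<nu> (space \<nu>) = 0" by (simp add: AE_iff_measurable[of "space \<nu>"])
    then show False using nonzero by simp
  qed
  then obtain L0 where L0: "L0 \<in> unimodular_lattices n" "AE w in W. h (lattice_of (\<Psi> w)) = h L0"
    using gen space_nu by auto
  have "AE L in \<nu>. h L = h L0"
    using ae
  proof (rule AE_mp, intro AE_I2 impI)
    fix L assume "L \<in> space \<nu>" "AE w in W. h (lattice_act (\<Psi> w) L) = h L"
    then have "AE w in W. h (lattice_of (\<Psi> w)) = h L" using gen space_nu by auto
    with L0(2) have "AE w in W. h L = h L0" by eventually_elim simp
    then show "h L = h L0" using W_nontrivial by (cases "h L = h L0") auto
  qed
  then show ?thesis by blast
qed

end


text \<open>Both measures are dominated by their sum, and the density of the first with respect to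
  it is invariant under the action, hence constant. The total masses 1 and 2 determine the
  constant.\<close>

lemma invariant_lattice_prob_unique:
  assumes "invariant_lattice_prob n \<mu>1" "invariant_lattice_prob n \<mu>2"
  shows "\<mu>1 = \<mu>2"
proof -
  have sets1: "sets \<mu>1 = sets (lattice_borel n)" and sets2: "sets \<mu>2 = sets (lattice_borel n)"
    and inv1: "\<And>g. g \<in> SL n \<Longrightarrow> distr \<mu>1 \<mu>1 (lattice_act g) = \<mu>1"
    and inv2: "\<And>g. g \<in> SL n \<Longrightarrow> distr \<mu>2 \<mu>2 (lattice_act g) = \<mu>2"
    using assms by (auto simp: invariant_lattice_prob_def)
  interpret p1: prob_space \<mu>1 using assms(1) by (simp add: invariant_lattice_prob_def)
  interpret p2: prob_space \<mu>2 using assms(2) by (simp add: invariant_lattice_prob_def)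
  have space1: "space \<mu>1 = unimodular_lattices n" and space2: "space \<mu>2 = unimodular_lattices n"
    using sets_eq_imp_space_eq[OF sets1] sets_eq_imp_space_eq[OF sets2] by simp_all
  define \<nu> where "\<nu> = measure_of (unimodular_lattices n) (sets (lattice_borel n)) (\<lambda>E. emeasure \<mu>1 E + emeasure \<mu>2 E)"
  have sub: "sets (lattice_borel n) \<subseteq> Pow (unimodular_lattices n)"
    using sets.sets_into_space[of _ "lattice_borel n"] by auto
  have ssets: "sigma_sets (unimodular_lattices n) (sets (lattice_borel n)) = sets (lattice_borel n)"
    using sets.sigma_sets_eq[of "lattice_borel n"] by simp
  have sets\<nu>: "sets \<nu> = sets (lattice_borel n)"
    unfolding \<nu>_def by (simp add: sets_measure_of[OF sub] ssets)
  have space\<nu>: "space \<nu> = unimodular_lattices n"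
    using sets_eq_imp_space_eq[OF sets\<nu>] by simp
  have em\<nu>: "emeasure \<nu> E = emeasure \<mu>1 E + emeasure \<mu>2 E" if "E \<in> sets (lattice_borel n)" for E
    unfolding \<nu>_def
  proof (rule emeasure_measure_of_sigma)
    show "sigma_algebra (unimodular_lattices n) (sets (lattice_borel n))"
      using sets.sigma_algebra_axioms[of "lattice_borel n"] by simp
    show "positive (sets (lattice_borel n)) (\<lambda>E. emeasure \<mu>1 E + emeasure \<mu>2 E)"
      by (simp add: positive_def)
    show "countably_additive (sets (lattice_borel n)) (\<lambda>E. emeasure \<mu>1 E + emeasure \<mu>2 E)"
    proof (rule countably_additiveI)
      fix A :: "nat \<Rightarrow> real vec set set"
      assume A: "range A \<subseteq> sets (lattice_borel n)" "disjoint_family A"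
      have "(\<Sum>i. emeasure \<mu>1 (A i) + emeasure \<mu>2 (A i)) = (\<Sum>i. emeasure \<mu>1 (A i)) + (\<Sum>i. emeasure \<mu>2 (A i))"
        by (rule suminf_add[symmetric]) auto
      then show "(\<Sum>i. emeasure \<mu>1 (A i) + emeasure \<mu>2 (A i)) = emeasure \<mu>1 (\<Union>i. A i) + emeasure \<mu>2 (\<Union>i. A i)"
        using suminf_emeasure[of A \<mu>1] suminf_emeasure[of A \<mu>2] A sets1 sets2 by simp
    qed
  qed fact
  have act: "lattice_act g \<in> lattice_borel n \<rightarrow>\<^sub>M lattice_borel n" if "g \<in> SL n" for g
    using measurable_lattice_act_pair[of "\<lambda>x. x" "lattice_borel n" n "\<lambda>_. g"] that by simp
  have pre: "lattice_act g -` E \<inter> unimodular_lattices n \<in> sets (lattice_borel n)"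
    if "g \<in> SL n" "E \<in> sets (lattice_borel n)" for g E
    using measurable_sets[OF act[OF that(1)] that(2)] by simp
  have actM: "lattice_act g \<in> M \<rightarrow>\<^sub>M M" if "sets M = sets (lattice_borel n)" "g \<in> SL n" for g M
    using measurable_cong_sets[OF that(1) that(1)] act that by auto
  have pres: "emeasure M (lattice_act g -` E \<inter> unimodular_lattices n) = emeasure M E"
    if "sets M = sets (lattice_borel n)" "distr M M (lattice_act g) = M" "g \<in> SL n" "E \<in> sets (lattice_borel n)"
    for M g E
    using emeasure_distr[OF actM[OF that(1,3)], of E] that sets_eq_imp_space_eq[OF that(1)] by simp
  have dist\<nu>: "distr \<nu> \<nu> (lattice_act g) = \<nu>" if g: "g \<in> SL n" for g
  proof (rule measure_eqI)
    fix E assume "E \<in> sets (distr \<nu> \<nu> (lattice_act g))"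
    then have E: "E \<in> sets (lattice_borel n)" by (simp add: sets\<nu>)
    have "emeasure (distr \<nu> \<nu> (lattice_act g)) E = emeasure \<nu> (lattice_act g -` E \<inter> unimodular_lattices n)"
      using emeasure_distr[OF actM[OF sets\<nu> g], of E] E by (simp add: sets\<nu> space\<nu>)
    then show "emeasure (distr \<nu> \<nu> (lattice_act g)) E = emeasure \<nu> E"
      using E g pres[OF sets1 inv1 g E] pres[OF sets2 inv2 g E] pre[OF g E] by (simp add: em\<nu>)
  qed simp
  have top: "unimodular_lattices n \<in> sets (lattice_borel n)"
    using sets.top[of "lattice_borel n"] by simp
  have total: "emeasure \<nu> (space \<nu>) = 2"
    unfolding space\<nu> em\<nu>[OF top]
    using p1.emeasure_space_1 p2.emeasure_space_1 unfolding space1 space2 by simp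
  interpret invariant_lattice_measure \<nu> n
  proof (intro invariant_lattice_measure.intro invariant_lattice_measure_axioms.intro finite_measureI)
    show "emeasure \<nu> (space \<nu>) \<noteq> \<infinity>" unfolding total by simp
    show "emeasure \<nu> (space \<nu>) \<noteq> 0" unfolding total by simp
  qed (use dist\<nu> sets\<nu> in simp_all)
  have ac: "absolutely_continuous \<nu> \<mu>1"
    unfolding absolutely_continuous_def null_sets_def using sets\<nu> sets1 by (auto simp: em\<nu>)
  obtain h where h: "h \<in> borel_measurable \<nu>" "density \<nu> h = \<mu>1"
    using Radon_Nikodym[OF ac] sets\<nu> sets1 by auto
  have hE: "emeasure \<mu>1 E = (\<integral>\<^sup>+L. h L * indicator E L \<partial>\<nu>)" if "E \<in> sets \<nu>" for E
    using emeasure_density[OF h(1) that] h(2) by simp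
  have "AE L in \<nu>. h (lattice_act g L) = h L" if g: "g \<in> SL n" for g
  proof (rule density_unique_finite_measure)
    show hg: "(\<lambda>L. h (lattice_act g L)) \<in> borel_measurable \<nu>"
      by (rule measurable_compose[OF actM[OF sets\<nu> g] h(1)])
    fix E assume "E \<in> sets \<nu>"
    then have E: "E \<in> sets (lattice_borel n)" by (simp add: sets\<nu>)
    \<comment> \<open>\<open>E'\<close> is \<open>E\<close> moved by \<open>g\<close>, so that the
      indicator of \<open>E\<close> also becomes a function of \<open>lattice_act g L\<close> and
      the whole integrand can be transformed at once.\<close>
    define E' where "E' = lattice_act (adj_mat g) -` E \<inter> unimodular_lattices n"
    have E': "E' \<in> sets (lattice_borel n)" unfolding E'_def using g E by (intro pre SL_adj)
    have ind: "indicator E L = (indicator E' (lattice_act g L) :: ennreal)" if "L \<in> space \<nu>" for L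
    proof -
      have L: "L \<in> unimodular_lattices n" using that space\<nu> by simp
      then obtain A where A: "A \<in> SL n" "L = lattice_of A" by (auto simp: unimodular_lattices_def)
      have "lattice_act (adj_mat g) (lattice_act g L) = L"
        unfolding A(2) lattice_act_of[OF A(1) g] lattice_act_of[OF SL_mult[OF A(1) g] SL_adj(1)[OF g]]
        by (simp only: SL_cancel(3)[OF g A(1)])
      then show ?thesis using lattice_act_SL[OF L g] by (auto simp: E'_def indicator_def)
    qed
    have "(\<integral>\<^sup>+L. h (lattice_act g L) * indicator E L \<partial>\<nu>) =
        (\<integral>\<^sup>+L. h (lattice_act g L) * indicator E' (lattice_act g L) \<partial>\<nu>)"
      by (intro nn_integral_cong) (simp add: ind)
    also have "\<dots> = (\<integral>\<^sup>+L. h L * indicator E' L \<partial>distr \<nu> \<nu> (lattice_act g))"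
    proof -
      have "(\<lambda>L. h L * indicator E' L) \<in> borel_measurable \<nu>"
        using h(1) E' sets\<nu> by (intro borel_measurable_times_ennreal borel_measurable_indicator) simp_all
      with nn_integral_distr[OF actM[OF sets\<nu> g], of "\<lambda>L. h L * indicator E' L"] show ?thesis by simp
    qed
    also have "\<dots> = emeasure \<mu>1 E'" using hE[of E'] E' dist\<nu>[OF g] by (simp add: sets\<nu>)
    also have "\<dots> = emeasure \<mu>1 E"
      unfolding E'_def by (rule pres[OF sets1 inv1[OF SL_adj(1)[OF g]] SL_adj(1)[OF g] E])
    finally show "(\<integral>\<^sup>+L. h (lattice_act g L) * indicator E L \<partial>\<nu>) = (\<integral>\<^sup>+L. h L * indicator E L \<partial>\<nu>)"
      using hE[of E] E by (simp add: sets\<nu>)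
  qed (use h in auto)
  then obtain k where k: "AE L in \<nu>. h L = k"
    using invariant_function_const[OF h(1)] by blast
  have mu1: "emeasure \<mu>1 E = k * emeasure \<nu> E" if "E \<in> sets \<nu>" for E
  proof -
    have "emeasure \<mu>1 E = (\<integral>\<^sup>+L. k * indicator E L \<partial>\<nu>)"
      unfolding hE[OF that] using k by (intro nn_integral_cong_AE) auto
    then show ?thesis using that by (simp add: nn_integral_cmult_indicator)
  qed
  have k2: "1 = k * 2"
    using mu1[of "space \<nu>"] total p1.emeasure_space_1 top by (simp add: space1 space\<nu> sets\<nu>)
  show ?thesis
  proof (rule measure_eqI)
    show "sets \<mu>1 = sets \<mu>2" using sets1 sets2 by simp
    fix E assume "E \<in> sets \<mu>1"
    then have E: "E \<in> sets (lattice_borel n)" by (simp add: sets1)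
    have "emeasure \<mu>1 E = k * (emeasure \<mu>1 E + emeasure \<mu>2 E)"
      using mu1[of E] E em\<nu>[OF E] by (simp add: sets\<nu>)
    \<comment> \<open>Doubling allows \<open>k2\<close> to eliminate \<open>k\<close> without
      dividing in the extended reals; afterwards one copy of the finite value
      \<open>emeasure \<mu>1 E\<close> cancels.\<close>
    then have "2 * emeasure \<mu>1 E = 2 * (k * (emeasure \<mu>1 E + emeasure \<mu>2 E))" by simp
    also have "\<dots> = (k * 2) * (emeasure \<mu>1 E + emeasure \<mu>2 E)" by (simp only: mult_ac)
    finally have "2 * emeasure \<mu>1 E = (k * 2) * (emeasure \<mu>1 E + emeasure \<mu>2 E)" .
    then have "emeasure \<mu>1 E + emeasure \<mu>1 E = emeasure \<mu>1 E + emeasure \<mu>2 E"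
      using k2 by (simp add: mult_2)
    then show "emeasure \<mu>1 E = emeasure \<mu>2 E"
      using p1.emeasure_finite[of E] by (simp add: ennreal_add_left_cancel)
  qed
qed

section \<open>Volumes of ellipsoids and lattice point counting\<close>

abbreviation leb :: "nat set \<Rightarrow> (nat \<Rightarrow> real) measure" where
  "leb I \<equiv> Pi\<^sub>M I (\<lambda>_. lborel)"

lemma product_sigma_finite_lborel: "product_sigma_finite (\<lambda>_::nat. lborel :: real measure)"
  by (simp add: product_sigma_finite_def lborel.sigma_finite_measure_axioms)

lemma nn_integral_lborel_affine:
  fixes F :: "real \<Rightarrow> ennreal"
  assumes F: "F \<in> borel_measurable borel" and c: "c \<noteq> 0"
  shows "ennreal \<bar>c\<bar> * (\<integral>\<^sup>+x. F (t + c * x) \<partial>lborel) = (\<integral>\<^sup>+x. F x \<partial>lborel)"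
  using nn_integral_real_affine[OF F c, of t] by simp

lemma leb_translate:
  assumes "finite I" "F \<in> borel_measurable (leb I)"
  shows "(\<integral>\<^sup>+x. F (\<lambda>i\<in>I. x i + b i) \<partial>leb I) = (\<integral>\<^sup>+x. F x \<partial>leb I)"
proof -
  interpret product_sigma_finite "\<lambda>_::nat. lborel :: real measure" by (rule product_sigma_finite_lborel)
  define T where "T = (\<lambda>x::nat \<Rightarrow> real. \<lambda>i\<in>I. x i + b i)"
  have T: "T \<in> leb I \<rightarrow>\<^sub>M leb I" unfolding T_def by measurable
  have "distr (leb I) (leb I) T = leb I"
  proof (rule PiM_eqI[OF assms(1)])
    fix A :: "nat \<Rightarrow> real set" assume A: "\<And>i. i \<in> I \<Longrightarrow> A i \<in> sets lborel"
    have "T -` Pi\<^sub>E I A \<inter> space (leb I) = (\<Pi>\<^sub>E i\<in>I. (\<lambda>y. b i + y) -` A i)"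
      by (auto simp: T_def space_PiM PiE_iff add.commute extensional_def)
    then have "emeasure (distr (leb I) (leb I) T) (Pi\<^sub>E I A) = emeasure (leb I) (\<Pi>\<^sub>E i\<in>I. (\<lambda>y. b i + y) -` A i)"
      using A by (subst emeasure_distr[OF T]) (auto intro!: sets_PiM_I_finite assms(1))
    also have "\<dots> = (\<Prod>i\<in>I. emeasure lborel ((\<lambda>y. b i + y) -` A i))"
    proof (rule emeasure_PiM[OF assms(1)])
      fix i assume "i \<in> I"
      then show "(\<lambda>y. b i + y) -` A i \<in> sets lborel"
        using measurable_sets[of "\<lambda>y. b i + y" borel borel "A i"] A by simp
    qed
    also have "\<dots> = (\<Prod>i\<in>I. emeasure lborel (A i))"
    proof (rule prod.cong[OF refl])
      fix i assume "i \<in> I"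
      then have "emeasure (distr lborel borel ((+) (b i))) (A i) = emeasure lborel ((\<lambda>y. b i + y) -` A i)"
        using A by (subst emeasure_distr) auto
      then show "emeasure lborel ((\<lambda>y. b i + y) -` A i) = emeasure lborel (A i)"
        by (simp add: lborel_distr_plus)
    qed
    finally show "emeasure (distr (leb I) (leb I) T) (Pi\<^sub>E I A) = (\<Prod>i\<in>I. emeasure lborel (A i))" .
  qed simp
  then show ?thesis
    using nn_integral_distr[OF T, of F] assms(2) by (simp add: T_def)
qed

section \<open>Change of variables under an invertible matrix\<close>

definition matvec :: "nat \<Rightarrow> real mat \<Rightarrow> (nat \<Rightarrow> real) \<Rightarrow> nat \<Rightarrow> real" where
  "matvec n M x = (\<lambda>i\<in>{..<n}. \<Sum>j<n. M $$ (i,j) * x j)"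

lemma matvec_measurable [measurable]: "matvec n M \<in> leb {..<n} \<rightarrow>\<^sub>M leb {..<n}"
  unfolding matvec_def
  by (intro measurable_restrict borel_measurable_sum borel_measurable_times measurable_const) simp_all

lemma matvec_mult:
  assumes "A \<in> carrier_mat n n" "B \<in> carrier_mat n n"
  shows "matvec n (A * B) x = matvec n A (matvec n B x)"
proof -
  have "(\<Sum>j<n. (A * B) $$ (i,j) * x j) = (\<Sum>l<n. A $$ (i,l) * (\<Sum>j<n. B $$ (l,j) * x j))" if "i < n" for i
  proof -
    have "(\<Sum>j<n. (A * B) $$ (i,j) * x j) = (\<Sum>j<n. \<Sum>l<n. A $$ (i,l) * (B $$ (l,j) * x j))"
      using that assms by (simp add: mat_mult_entry[of _ n n _ n] sum_distrib_right mult.assoc del: index_mult_mat)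
    also have "\<dots> = (\<Sum>l<n. \<Sum>j<n. A $$ (i,l) * (B $$ (l,j) * x j))" by (rule sum.swap)
    finally show ?thesis by (simp add: sum_distrib_left)
  qed
  then show ?thesis by (auto simp: matvec_def)
qed

text \<open>Quantifying over all measurable integrands makes the property pass to products of
  matrices by substituting twice.\<close>

definition volume_scaling :: "nat \<Rightarrow> real mat \<Rightarrow> bool" where
  "volume_scaling n M \<longleftrightarrow> (\<forall>F \<in> borel_measurable (leb {..<n}).
     ennreal \<bar>det M\<bar> * (\<integral>\<^sup>+x. F (matvec n M x) \<partial>leb {..<n}) = (\<integral>\<^sup>+x. F x \<partial>leb {..<n}))"

lemma volume_scaling_mult:
  assumes "A \<in> carrier_mat n n" "B \<in> carrier_mat n n" "volume_scaling n A" "volume_scaling n B"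
  shows "volume_scaling n (A * B)"
  unfolding volume_scaling_def
proof
  fix F :: "(nat \<Rightarrow> real) \<Rightarrow> ennreal" assume F: "F \<in> borel_measurable (leb {..<n})"
  have FA: "(\<lambda>x. F (matvec n A x)) \<in> borel_measurable (leb {..<n})"
    by (rule measurable_compose[OF matvec_measurable F])
  have "ennreal \<bar>det (A * B)\<bar> * (\<integral>\<^sup>+x. F (matvec n (A * B) x) \<partial>leb {..<n})
      = ennreal \<bar>det A\<bar> * (ennreal \<bar>det B\<bar> * (\<integral>\<^sup>+x. F (matvec n A (matvec n B x)) \<partial>leb {..<n}))"
    using assms(1,2) by (simp add: matvec_mult det_mult abs_mult ennreal_mult mult.assoc)
  also have "\<dots> = (\<integral>\<^sup>+x. F x \<partial>leb {..<n})"
    using bspec[OF assms(4)[unfolded volume_scaling_def] FA] bspec[OF assms(3)[unfolded volume_scaling_def] F]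
    by simp
  finally show "ennreal \<bar>det (A * B)\<bar> * (\<integral>\<^sup>+x. F (matvec n (A * B) x) \<partial>leb {..<n}) = (\<integral>\<^sup>+x. F x \<partial>leb {..<n})" .
qed

text \<open>The identity with column \<open>k\<close> replaced by \<open>e\<close>. This one family
  contains both coordinate scalings and shears, and its invertible members factor every invertible
  matrix.\<close>

definition col_mat :: "nat \<Rightarrow> nat \<Rightarrow> (nat \<Rightarrow> real) \<Rightarrow> real mat" where
  "col_mat n k e = mat n n (\<lambda>(i,j). if j = k then e i else if i = j then 1 else 0)"

lemma col_mat_carrier [simp]: "col_mat n k e \<in> carrier_mat n n"
  by (simp add: col_mat_def)

lemma col_mat_mult_entry:
  assumes "M \<in> carrier_mat n n" "k < n" "i < n" "j < n"
  shows "(col_mat n k e * M) $$ (i,j) = (if i = k then 0 else M $$ (i,j)) + e i * M $$ (k,j)"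
proof -
  have "(col_mat n k e * M) $$ (i,j) = (\<Sum>l<n. col_mat n k e $$ (i,l) * M $$ (l,j))"
    using assms by (intro mat_mult_entry[of _ n n _ n]) auto
  also have "\<dots> = (\<Sum>l<n. (if l = i then (if i = k then 0 else M $$ (i,j)) else 0) + (if l = k then e i * M $$ (k,j) else 0))"
    using assms by (intro sum.cong) (auto simp: col_mat_def)
  also have "\<dots> = (if i = k then 0 else M $$ (i,j)) + e i * M $$ (k,j)"
    using assms by (simp add: sum.distrib)
  finally show ?thesis .
qed

text \<open>Expansion along column \<open>k\<close> sees only the other columns, so the cofactors
  are those of the identity, known from its adjugate.\<close>

lemma det_col_mat:
  assumes k: "k < n"
  shows "det (col_mat n k e) = e k"
proof -
  have "det (col_mat n k e) = (\<Sum>i<n. col_mat n k e $$ (i,k) * cofactor (col_mat n k e) i k)"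
    using k by (intro laplace_expansion_column) auto
  also have "\<dots> = (\<Sum>i<n. e i * cofactor (1\<^sub>m n) i k)"
  proof (rule sum.cong[OF refl])
    fix i assume "i \<in> {..<n}"
    moreover have "mat_delete (col_mat n k e) i k = mat_delete (1\<^sub>m n) i k"
      by (rule eq_matI) (auto simp: mat_delete_def col_mat_def)
    ultimately show "col_mat n k e $$ (i,k) * cofactor (col_mat n k e) i k = e i * cofactor (1\<^sub>m n) i k"
      using k by (simp add: cofactor_def col_mat_def)
  qed
  also have "\<dots> = (\<Sum>i<n. if i = k then e k else 0)"
  proof (rule sum.cong[OF refl])
    fix i assume i: "i \<in> {..<n}"
    have "cofactor (1\<^sub>m n) i k = adj_mat (1\<^sub>m n) $$ (k,i)"
      using i k by (simp add: adj_mat_def)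
    also have "adj_mat (1\<^sub>m n) = (1\<^sub>m n :: real mat)"
      using SL_adj(2)[OF SL_one[of n]] left_mult_one_mat[OF SL_carrier[OF SL_adj(1)[OF SL_one[of n]]]]
      by simp
    finally have "cofactor (1\<^sub>m n) i k = (if i = k then 1 else 0 :: real)" using i k by simp
    then show "e i * cofactor (1\<^sub>m n) i k = (if i = k then e k else 0)" by simp
  qed
  also have "\<dots> = e k" using k by simp
  finally show ?thesis .
qed

text \<open>For a fixed value y of coordinate \<open>k\<close>, the other coordinates are translated
  by \<open>e i * y\<close>, while y is scaled by \<open>e k\<close>. Integrating over the other
  coordinates first reduces the claim to translation invariance and the scaling rule on the
  line.\<close>

lemma volume_scaling_col_mat:
  assumes k: "k < n" and ek: "e k \<noteq> 0"
  shows "volume_scaling n (col_mat n k e)"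
  unfolding volume_scaling_def
proof
  fix F :: "(nat \<Rightarrow> real) \<Rightarrow> ennreal" assume F: "F \<in> borel_measurable (leb {..<n})"
  interpret product_sigma_finite "\<lambda>_::nat. lborel :: real measure" by (rule product_sigma_finite_lborel)
  define J where "J = {..<n} - {k}"
  have J: "insert k J = {..<n}" "finite J" "k \<notin> J" using k by (auto simp: J_def)
  have FJ: "F \<in> borel_measurable (leb (insert k J))" using F J by simp
  have GJ: "(\<lambda>x. F (matvec n (col_mat n k e) x)) \<in> borel_measurable (leb (insert k J))"
    using measurable_compose[OF matvec_measurable F] J by simp
  have mv: "matvec n (col_mat n k e) (x(k := y)) = (\<lambda>i\<in>J. x i + e i * y)(k := e k * y)" for x y
  proof
    fix i
    show "matvec n (col_mat n k e) (x(k := y)) i = ((\<lambda>i\<in>J. x i + e i * y)(k := e k * y)) i"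
    proof (cases "i < n")
      case True
      have "matvec n (col_mat n k e) (x(k := y)) i = (\<Sum>j<n. col_mat n k e $$ (i,j) * (x(k := y)) j)"
        using True by (simp add: matvec_def)
      also have "\<dots> = (\<Sum>j<n. (if j = i then (if i = k then 0 else x i) else 0) + (if j = k then e i * y else 0))"
        using True k by (intro sum.cong) (auto simp: col_mat_def)
      also have "\<dots> = (if i = k then 0 else x i) + e i * y"
        using True k by (simp add: sum.distrib)
      finally show ?thesis using True k by (auto simp: J_def)
    qed (use k in \<open>auto simp: matvec_def J_def\<close>)
  qed
  define H where "H y = (\<integral>\<^sup>+x. F (x(k := y)) \<partial>leb J)" for y
  have Fpair: "(\<lambda>(y, x). F (x(k := y))) \<in> borel_measurable (lborel \<Otimes>\<^sub>M leb J)"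
  proof -
    have "(\<lambda>(x, y). x(k := y)) \<in> leb J \<Otimes>\<^sub>M lborel \<rightarrow>\<^sub>M leb (insert k J)"
      by (rule measurable_add_dim)
    from measurable_compose[OF measurable_pair_swap' measurable_compose[OF this FJ]]
    show ?thesis by (simp add: split_beta')
  qed
  interpret pJ: sigma_finite_measure "leb J" by (rule sigma_finite[OF J(2)])
  have Hm: "H \<in> borel_measurable borel"
    using pJ.borel_measurable_nn_integral_fst[OF Fpair] by (simp add: H_def[abs_def])
  have "(\<integral>\<^sup>+x. F (matvec n (col_mat n k e) x) \<partial>leb {..<n})
      = (\<integral>\<^sup>+y. \<integral>\<^sup>+x. F (matvec n (col_mat n k e) (x(k := y))) \<partial>leb J \<partial>lborel)"
    using product_nn_integral_insert_rev[OF J(2,3) GJ] J(1) by simp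
  also have "\<dots> = (\<integral>\<^sup>+y. \<integral>\<^sup>+x. F ((\<lambda>i\<in>J. x i + e i * y)(k := e k * y)) \<partial>leb J \<partial>lborel)"
    by (simp add: mv)
  also have "\<dots> = (\<integral>\<^sup>+y. H (e k * y) \<partial>lborel)"
  proof (rule nn_integral_cong)
    fix y :: real
    have "(\<lambda>x. F (x(k := e k * y))) \<in> borel_measurable (leb J)"
    proof -
      have "(\<lambda>x. (e k * y, x)) \<in> leb J \<rightarrow>\<^sub>M lborel \<Otimes>\<^sub>M leb J" by (intro measurable_Pair) auto
      from measurable_compose[OF this Fpair] show ?thesis by simp
    qed
    from leb_translate[OF J(2) this, of "\<lambda>i. e i * y"]
    show "(\<integral>\<^sup>+x. F ((\<lambda>i\<in>J. x i + e i * y)(k := e k * y)) \<partial>leb J) = H (e k * y)"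
      by (simp add: H_def)
  qed
  finally have "ennreal \<bar>e k\<bar> * (\<integral>\<^sup>+x. F (matvec n (col_mat n k e) x) \<partial>leb {..<n}) = (\<integral>\<^sup>+y. H y \<partial>lborel)"
    using nn_integral_lborel_affine[OF Hm ek, of 0] by simp
  also have "\<dots> = (\<integral>\<^sup>+x. F x \<partial>leb {..<n})"
    using product_nn_integral_insert_rev[OF J(2,3) FJ] J(1) by (simp add: H_def)
  finally show "ennreal \<bar>det (col_mat n k e)\<bar> * (\<integral>\<^sup>+x. F (matvec n (col_mat n k e) x) \<partial>leb {..<n}) = (\<integral>\<^sup>+x. F x \<partial>leb {..<n})"
    by (simp add: det_col_mat[OF k])
qed


lemma volume_scaling_one: "volume_scaling n (1\<^sub>m n)"
proof -
  have "matvec n (1\<^sub>m n) x = x" if "x \<in> space (leb {..<n})" for x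
  proof
    fix i
    have "(\<Sum>j<n. (1\<^sub>m n) $$ (i,j) * x j) = (\<Sum>j<n. if j = i then x i else 0)" if "i < n"
      using that by (intro sum.cong) auto
    then show "matvec n (1\<^sub>m n) x i = x i"
      using \<open>x \<in> space _\<close> by (auto simp: matvec_def space_PiM PiE_iff extensional_def)
  qed
  then show ?thesis
    unfolding volume_scaling_def by (auto intro!: nn_integral_cong)
qed

text \<open>One step of Gaussian elimination. \<open>E\<close> carries column \<open>k\<close> of
  \<open>M\<close>, and its inverse turns that column into a unit vector; the earlier columns
  survive because their entry in row \<open>k\<close> is zero.\<close>

lemma volume_scaling_pivot:
  assumes M: "M \<in> carrier_mat n n" "det M \<noteq> 0" and k: "k < n" "M $$ (k,k) \<noteq> 0"
    and id: "\<And>i j. i < n \<Longrightarrow> j < k \<Longrightarrow> M $$ (i,j) = (if i = j then 1 else 0)"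
    and IH: "\<And>M'. M' \<in> carrier_mat n n \<Longrightarrow> det M' \<noteq> 0 \<Longrightarrow>
      (\<And>i j. i < n \<Longrightarrow> j < Suc k \<Longrightarrow> M' $$ (i,j) = (if i = j then 1 else 0)) \<Longrightarrow> volume_scaling n M'"
  shows "volume_scaling n M"
proof -
  define E where "E = col_mat n k (\<lambda>i. M $$ (i,k))"
  define M' where "M' = col_mat n k (\<lambda>i. if i = k then 1 / M $$ (k,k) else - M $$ (i,k) / M $$ (k,k)) * M"
  have M'c: "M' \<in> carrier_mat n n" unfolding M'_def by (rule mult_carrier_mat[OF col_mat_carrier M(1)])
  have M'e: "M' $$ (i,j) = (if i = k then M $$ (k,j) / M $$ (k,k) else M $$ (i,j) - M $$ (i,k) / M $$ (k,k) * M $$ (k,j))"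
    if "i < n" "j < n" for i j
    unfolding M'_def col_mat_mult_entry[OF M(1) k(1) that] by auto
  have eq: "M = E * M'"
  proof (rule eq_matI)
    fix i j assume "i < dim_row (E * M')" "j < dim_col (E * M')"
    then have ij: "i < n" "j < n" using M'c by (auto simp: E_def col_mat_def)
    show "M $$ (i,j) = (E * M') $$ (i,j)"
      unfolding E_def col_mat_mult_entry[OF M'c k(1) ij] M'e[OF ij] M'e[OF k(1) ij(2)]
      using k(2) by (simp add: field_simps)
  qed (use M M'c in \<open>auto simp: E_def col_mat_def\<close>)
  have "det M = det E * det M'" using M'c by (subst eq, intro det_mult[of _ n]) (auto simp: E_def)
  then have "det M' \<noteq> 0" using M(2) by auto
  then have "volume_scaling n M'"
  proof (rule IH[OF M'c])
    fix i j assume ij: "i < n" "j < Suc k"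
    then have j: "j < n" using k by simp
    show "M' $$ (i,j) = (if i = j then 1 else 0)"
    proof (cases "j = k")
      case True
      then show ?thesis using k(2) M'e[OF ij(1) k(1)] by simp
    next
      case False
      then show ?thesis using id[of k j] id[of i j] ij k(1) M'e[OF ij(1) j] by auto
    qed
  qed
  then have "volume_scaling n (E * M')"
    unfolding E_def using k M'c by (intro volume_scaling_mult volume_scaling_col_mat) auto
  then show ?thesis by (simp only: eq[symmetric])
qed

text \<open>Induction on the number \<open>d\<close> of final columns that are not yet known to be
  unit vectors.\<close>

lemma volume_scaling_elim:
  assumes "M \<in> carrier_mat n n" "det M \<noteq> 0" "d \<le> n"
    and "\<And>i j. i < n \<Longrightarrow> j < n - d \<Longrightarrow> M $$ (i,j) = (if i = j then 1 else 0)"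
  shows "volume_scaling n M"
  using assms
proof (induction d arbitrary: M)
  case 0
  then have "M = 1\<^sub>m n" by (intro eq_matI) auto
  then show ?case by (simp add: volume_scaling_one)
next
  case (Suc d)
  define k where "k = n - Suc d"
  have k: "k < n" "n - d = Suc k" using Suc.prems(3) by (auto simp: k_def)
  have id: "M $$ (i,j) = (if i = j then 1 else 0)" if "i < n" "j < k" for i j
    using Suc.prems(4) that by (simp add: k_def)
  have pivot: "volume_scaling n M'"
    if "M' \<in> carrier_mat n n" "det M' \<noteq> 0" "M' $$ (k,k) \<noteq> 0"
      "\<And>i j. i < n \<Longrightarrow> j < k \<Longrightarrow> M' $$ (i,j) = (if i = j then 1 else 0)" for M'
    by (rule volume_scaling_pivot[OF that(1,2) k(1) that(3,4)], simp, simp,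
        rule Suc.IH, use Suc.prems(3) k(2) in auto)
  show ?case
  proof (cases "M $$ (k,k) = 0")
    case False
    then show ?thesis using Suc.prems id by (intro pivot) auto
  next
    case True
    have "\<exists>i. k < i \<and> i < n \<and> M $$ (i,k) \<noteq> 0"
    proof (rule ccontr)
      assume no: "\<not> ?thesis"
      then have z: "M $$ (i,k) = 0" if "k \<le> i" "i < n" for i
        using that True by (cases "i = k") auto
      \<comment> \<open>If column \<open>k\<close> vanished from row \<open>k\<close> on, it would
        be a combination of the preceding unit columns; \<open>v\<close> records this relation and
        contradicts the nonzero determinant.\<close>
      define v where "v = vec n (\<lambda>j. if j < k then - M $$ (j,k) else if j = k then 1 else 0)"
      have "M *\<^sub>v v = 0\<^sub>v n"
      proof (rule eq_vecI)
        fix i assume "i < dim_vec (0\<^sub>v n :: real vec)"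
        then have i: "i < n" by simp
        have "(M *\<^sub>v v) $ i = (\<Sum>j<n. M $$ (i,j) * v $ j)"
          using i Suc.prems(1) by (auto simp: scalar_prod_def v_def atLeast0LessThan intro!: sum.cong)
        also have "\<dots> = (\<Sum>j<n. (if j = i then (if i < k then - M $$ (i,k) else 0) else 0) + (if j = k then M $$ (i,k) else 0))"
          using id[OF i] i k by (intro sum.cong) (auto simp: v_def)
        also have "\<dots> = 0" using i k z[of i] by (simp add: sum.distrib)
        finally show "(M *\<^sub>v v) $ i = 0\<^sub>v n $ i" using i by simp
      qed (use Suc.prems in auto)
      moreover have "v \<noteq> 0\<^sub>v n"
      proof
        assume "v = 0\<^sub>v n"
        then have "v $ k = 0" using k by simp
        then show False using k by (simp add: v_def)
      qed
      moreover have "v \<in> carrier_vec n" by (simp add: v_def)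
      ultimately show False using det_0_iff_vec_prod_zero[OF Suc.prems(1)] Suc.prems(2) by blast
    qed
    then obtain i where i: "k < i" "i < n" "M $$ (i,k) \<noteq> 0" by blast
    \<comment> \<open>Adding row \<open>i\<close> to row \<open>k\<close> creates a pivot and is
      itself multiplication by a \<open>col_mat\<close>, unlike a row exchange.\<close>
    define M1 where "M1 = col_mat n i (\<lambda>l. if l = i \<or> l = k then 1 else 0) * M"
    have M1c: "M1 \<in> carrier_mat n n" unfolding M1_def by (rule mult_carrier_mat[OF col_mat_carrier Suc.prems(1)])
    have M1e: "M1 $$ (a,b) = M $$ (a,b) + (if a = k then M $$ (i,b) else 0)" if "a < n" "b < n" for a b
      unfolding M1_def col_mat_mult_entry[OF Suc.prems(1) i(2) that] using i(1) by auto
    have eq: "M = col_mat n i (\<lambda>l. if l = i then 1 else if l = k then -1 else 0) * M1"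
    proof (rule eq_matI)
      fix a b assume "a < dim_row (col_mat n i (\<lambda>l. if l = i then 1 else if l = k then -1 else 0) * M1)"
        "b < dim_col (col_mat n i (\<lambda>l. if l = i then 1 else if l = k then -1 else 0) * M1)"
      then have ab: "a < n" "b < n" using M1c by (auto simp: col_mat_def)
      show "M $$ (a,b) = (col_mat n i (\<lambda>l. if l = i then 1 else if l = k then -1 else 0) * M1) $$ (a,b)"
        unfolding col_mat_mult_entry[OF M1c i(2) ab] M1e[OF ab] M1e[OF i(2) ab(2)]
        using i(1) by auto
    qed (use Suc.prems M1c in \<open>auto simp: col_mat_def\<close>)
    have "det M1 = det M"
      unfolding M1_def using Suc.prems(1) i by (subst det_mult[of _ n]) (auto simp: det_col_mat)
    then have "volume_scaling n M1"
      using Suc.prems i True k(1) by (intro pivot M1c) (auto simp: M1e id)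
    then have "volume_scaling n (col_mat n i (\<lambda>l. if l = i then 1 else if l = k then -1 else 0) * M1)"
      using i M1c by (intro volume_scaling_mult volume_scaling_col_mat) auto
    then show ?thesis by (simp only: eq[symmetric])
  qed
qed

lemma volume_scaling_det: "M \<in> carrier_mat n n \<Longrightarrow> det M \<noteq> 0 \<Longrightarrow> volume_scaling n M"
  by (rule volume_scaling_elim[of M n n]) auto

section \<open>Lattice points in ellipsoids\<close>

definition qnorm :: "nat \<Rightarrow> real mat \<Rightarrow> (nat \<Rightarrow> real) \<Rightarrow> real" where
  "qnorm n A x = L2_set (\<lambda>j. \<Sum>i<n. x i * A $$ (i,j)) {..<n}"

lemma vnorm_eq_L2_set: "vnorm v = L2_set (\<lambda>j. v $ j) {..<dim_vec v}"
  by (simp add: vnorm_def L2_set_def scalar_prod_def power2_eq_square atLeast0LessThan)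

lemma vnorm_lvec: "A \<in> carrier_mat n n \<Longrightarrow> vnorm (lvec A k) = qnorm n A (\<lambda>i. real_of_int (k i))"
  by (auto simp: vnorm_eq_L2_set qnorm_def lvec_def intro!: L2_set_cong)

lemma vnorm_nonneg: "vnorm v \<ge> 0"
  by (simp add: vnorm_eq_L2_set)

lemma qnorm_add: "qnorm n A (\<lambda>i. x i + y i) \<le> qnorm n A x + qnorm n A y"
  using L2_set_triangle_ineq[of "\<lambda>j. \<Sum>i<n. x i * A $$ (i,j)" "\<lambda>j. \<Sum>i<n. y i * A $$ (i,j)" "{..<n}"]
  by (simp add: qnorm_def algebra_simps sum.distrib)

lemma qnorm_le_mnorm:
  assumes "\<And>i. i < n \<Longrightarrow> \<bar>x i\<bar> \<le> 1"
  shows "qnorm n A x \<le> mnorm n A"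
proof -
  have "qnorm n A x \<le> (\<Sum>j<n. \<bar>\<Sum>i<n. x i * A $$ (i,j)\<bar>)"
    unfolding qnorm_def by (rule L2_set_le_sum_abs)
  also have "\<dots> \<le> (\<Sum>j<n. \<Sum>i<n. \<bar>A $$ (i,j)\<bar>)"
  proof (intro sum_mono order_trans[OF sum_abs])
    fix i j assume "i \<in> {..<n}"
    then show "\<bar>x i * A $$ (i,j)\<bar> \<le> \<bar>A $$ (i,j)\<bar>"
      using mult_right_mono[OF assms[of i], of "\<bar>A $$ (i,j)\<bar>"] by (simp add: abs_mult)
  qed
  also have "\<dots> = mnorm n A" unfolding mnorm_def by (rule sum.swap)
  finally show ?thesis .
qed

lemma qnorm_measurable [measurable]: "qnorm n A \<in> borel_measurable (leb {..<n})"
  unfolding qnorm_def[abs_def] L2_set_def by measurable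

text \<open>The map x -> x A has determinant one and carries this region onto the ball of radius
  \<open>t\<close>.\<close>

lemma emeasure_ellipsoid:
  assumes A: "A \<in> SL n" and t: "t > 0"
  shows "emeasure (leb {..<n}) {x \<in> space (leb {..<n}). qnorm n A x \<le> t} = ennreal (unit_ball_vol (real n) * t ^ n)"
proof -
  have At: "A\<^sup>T \<in> carrier_mat n n" "det (A\<^sup>T) = 1"
    using A det_transpose[of A n] by (auto simp: SL_def)
  define B where "B = {f. sqrt (\<Sum>i<n. (f i)\<^sup>2) \<le> t} \<inter> space (leb {..<n})"
  have B: "B \<in> sets (leb {..<n})"
  proof -
    have "B = {f \<in> space (leb {..<n}). sqrt (\<Sum>i<n. (f i)\<^sup>2) \<le> t}" by (auto simp: B_def)
    also have "\<dots> \<in> sets (leb {..<n})" by measurable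
    finally show ?thesis .
  qed
  have "(\<integral>\<^sup>+x. indicator B (matvec n (A\<^sup>T) x) \<partial>leb {..<n}) = (\<integral>\<^sup>+x. indicator B x \<partial>leb {..<n})"
    using volume_scaling_det[OF At(1)] At(2) B by (simp add: volume_scaling_def)
  also have "(\<integral>\<^sup>+x. indicator B (matvec n (A\<^sup>T) x) \<partial>leb {..<n}) =
      (\<integral>\<^sup>+x. indicator {x \<in> space (leb {..<n}). qnorm n A x \<le> t} x \<partial>leb {..<n})"
  proof (rule nn_integral_cong)
    fix x assume x: "x \<in> space (leb {..<n})"
    have "sqrt (\<Sum>i<n. (matvec n (A\<^sup>T) x i)\<^sup>2) = qnorm n A x"
      unfolding qnorm_def L2_set_def using A by (intro arg_cong[where f = sqrt] sum.cong)
        (auto simp: matvec_def mult.commute)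
    moreover have "matvec n (A\<^sup>T) x \<in> space (leb {..<n})"
      using measurable_space[OF matvec_measurable x] .
    ultimately show "indicator B (matvec n (A\<^sup>T) x) =
        (indicator {x \<in> space (leb {..<n}). qnorm n A x \<le> t} x :: ennreal)"
      using x by (auto simp: B_def indicator_def)
  qed
  also have "(\<integral>\<^sup>+x. indicator B x \<partial>leb {..<n}) = ennreal (unit_ball_vol (real n) * t ^ n)"
    using B emeasure_cball_aux[of "{..<n}" t] t by (simp add: B_def)
  finally show ?thesis by simp
qed

definition lattice_points :: "nat \<Rightarrow> real mat \<Rightarrow> real \<Rightarrow> (nat \<Rightarrow> int) set" where
  "lattice_points n A t = {k \<in> int_vecs n. vnorm (lvec A k) \<le> t}"

text \<open>The cubes are half-open so that distinct integer points give disjoint cubes which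
  together cover space.\<close>

definition unit_cube :: "nat \<Rightarrow> (nat \<Rightarrow> int) \<Rightarrow> (nat \<Rightarrow> real) set" where
  "unit_cube n k = (\<Pi>\<^sub>E i\<in>{..<n}. {real_of_int (k i)..<real_of_int (k i) + 1})"

lemma sets_unit_cube [measurable]: "unit_cube n k \<in> sets (leb {..<n})"
  unfolding unit_cube_def by (intro sets_PiM_I_finite) auto

lemma emeasure_Union_unit_cube:
  assumes F: "finite F" "F \<subseteq> int_vecs n"
  shows "emeasure (leb {..<n}) (\<Union>k\<in>F. unit_cube n k) = of_nat (card F)"
proof -
  interpret product_sigma_finite "\<lambda>_::nat. lborel :: real measure" by (rule product_sigma_finite_lborel)
  have one: "emeasure (leb {..<n}) (unit_cube n k) = 1" for k
    unfolding unit_cube_def by (subst emeasure_PiM) simp_all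
  have "disjoint_family_on (unit_cube n) F"
    unfolding disjoint_family_on_def
  proof (intro ballI impI equals0I)
    fix k l x assume kl: "k \<in> F" "l \<in> F" "k \<noteq> l" and x: "x \<in> unit_cube n k \<inter> unit_cube n l"
    have "k i = l i" if "i < n" for i
    proof -
      have "real_of_int (k i) \<le> x i" "x i < real_of_int (k i) + 1"
        "real_of_int (l i) \<le> x i" "x i < real_of_int (l i) + 1"
        using x that by (auto simp: unit_cube_def PiE_iff)
      then show ?thesis by linarith
    qed
    moreover have "k \<in> int_vecs n" "l \<in> int_vecs n" using kl F(2) by auto
    ultimately have "k = l" unfolding int_vecs_def by (auto intro: PiE_ext)
    then show False using kl by simp
  qed
  then have "emeasure (leb {..<n}) (\<Union>k\<in>F. unit_cube n k) = (\<Sum>k\<in>F. emeasure (leb {..<n}) (unit_cube n k))"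
    using F by (intro sum_emeasure[symmetric]) auto
  then show ?thesis by (simp add: one)
qed

text \<open>The unit cubes at the lattice points fit into an ellipsoid enlarged by the largest
  \<open>qnorm\<close> of a displacement within a cube, at most \<open>mnorm n A\<close>. The bound
  is proved for finite subsets first, and this forces the whole set to be finite. The extra 1 keeps
  the radius positive.\<close>

lemma lattice_points_upper:
  assumes A: "A \<in> SL n" and t: "t \<ge> 0"
  shows "finite (lattice_points n A t)"
    and "real (card (lattice_points n A t)) \<le> unit_ball_vol (real n) * (t + (mnorm n A + 1)) ^ n"
proof -
  define d where "d = mnorm n A + 1"
  have d: "d > 0" using mnorm_nonneg[of n A] by (simp add: d_def)
  have bound: "real (card F) \<le> unit_ball_vol (real n) * (t + d) ^ n"
    if F: "finite F" "F \<subseteq> lattice_points n A t" for F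
  proof -
    have "(\<Union>k\<in>F. unit_cube n k) \<subseteq> {x \<in> space (leb {..<n}). qnorm n A x \<le> t + d}"
    proof (intro UN_least subsetI)
      fix k x assume kx: "k \<in> F" "x \<in> unit_cube n k"
      have "qnorm n A x = qnorm n A (\<lambda>i. real_of_int (k i) + (x i - real_of_int (k i)))" by simp
      also have "\<dots> \<le> qnorm n A (\<lambda>i. real_of_int (k i)) + qnorm n A (\<lambda>i. x i - real_of_int (k i))"
        by (rule qnorm_add)
      also have "\<dots> \<le> t + mnorm n A"
      proof (intro add_mono qnorm_le_mnorm)
        show "qnorm n A (\<lambda>i. real_of_int (k i)) \<le> t"
          using F kx vnorm_lvec[OF SL_carrier[OF A]] by (auto simp: lattice_points_def)
        fix i assume "i < n"
        then have "x i \<in> {real_of_int (k i)..<real_of_int (k i) + 1}"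
          using kx by (auto simp: unit_cube_def PiE_iff)
        then show "\<bar>x i - real_of_int (k i)\<bar> \<le> 1" by auto
      qed
      finally show "x \<in> {x \<in> space (leb {..<n}). qnorm n A x \<le> t + d}"
        using kx by (auto simp: d_def unit_cube_def space_PiM PiE_iff)
    qed
    then have "emeasure (leb {..<n}) (\<Union>k\<in>F. unit_cube n k) \<le> emeasure (leb {..<n}) {x \<in> space (leb {..<n}). qnorm n A x \<le> t + d}"
      by (rule emeasure_mono) measurable
    also have "\<dots> = ennreal (unit_ball_vol (real n) * (t + d) ^ n)"
      using A t d by (intro emeasure_ellipsoid) auto
    also have "emeasure (leb {..<n}) (\<Union>k\<in>F. unit_cube n k) = ennreal (real (card F))"
      using F by (subst emeasure_Union_unit_cube) (auto simp: lattice_points_def ennreal_of_nat_eq_real_of_nat)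
    finally show ?thesis using t d by (subst (asm) ennreal_le_iff) auto
  qed
  show fin: "finite (lattice_points n A t)"
  proof (rule ccontr)
    assume inf: "infinite (lattice_points n A t)"
    obtain N :: nat where N: "unit_ball_vol (real n) * (t + d) ^ n < real N" using reals_Archimedean2 by blast
    obtain F where "finite F" "card F = N" "F \<subseteq> lattice_points n A t"
      using infinite_arbitrarily_large[OF inf] by blast
    then show False using bound[of F] N by auto
  qed
  show "real (card (lattice_points n A t)) \<le> unit_ball_vol (real n) * (t + (mnorm n A + 1)) ^ n"
    using bound[OF fin] by (simp add: d_def)
qed

text \<open>Rounding all coordinates down changes the norm by at most \<open>mnorm n A\<close>, so
  the cubes at the counted points cover the shrunken ellipsoid.\<close>

lemma lattice_points_lower:
  assumes A: "A \<in> SL n" and t: "t > mnorm n A + 1"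
  shows "unit_ball_vol (real n) * (t - (mnorm n A + 1)) ^ n \<le> real (card (lattice_points n A t))"
proof -
  define d where "d = mnorm n A + 1"
  have d: "d > 0" using mnorm_nonneg[of n A] by (simp add: d_def)
  have fin: "finite (lattice_points n A t)" using lattice_points_upper(1)[OF A, of t] t d by (simp add: d_def)
  have "{x \<in> space (leb {..<n}). qnorm n A x \<le> t - d} \<subseteq> (\<Union>k\<in>lattice_points n A t. unit_cube n k)"
  proof
    fix x assume "x \<in> {x \<in> space (leb {..<n}). qnorm n A x \<le> t - d}"
    then have x: "x \<in> space (leb {..<n})" "qnorm n A x \<le> t - d" by auto
    define k where "k = (\<lambda>i\<in>{..<n}. \<lfloor>x i\<rfloor>)"
    have "qnorm n A (\<lambda>i. real_of_int (k i)) = qnorm n A (\<lambda>i. x i + (real_of_int (k i) - x i))" by simp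
    also have "\<dots> \<le> qnorm n A x + qnorm n A (\<lambda>i. real_of_int (k i) - x i)" by (rule qnorm_add)
    also have "\<dots> \<le> (t - d) + mnorm n A"
    proof (intro add_mono qnorm_le_mnorm x(2))
      fix i assume "i < n"
      then show "\<bar>real_of_int (k i) - x i\<bar> \<le> 1" unfolding k_def
        using of_int_floor_le[of "x i"] real_of_int_floor_add_one_gt[of "x i"] by (simp; linarith)
    qed
    finally have "k \<in> lattice_points n A t"
      using vnorm_lvec[OF SL_carrier[OF A]] by (simp add: lattice_points_def int_vecs_def k_def d_def)
    moreover have "x \<in> unit_cube n k"
      using x(1) by (auto simp: unit_cube_def k_def space_PiM PiE_iff extensional_def)
    ultimately show "x \<in> (\<Union>k\<in>lattice_points n A t. unit_cube n k)" by blast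
  qed
  then have "emeasure (leb {..<n}) {x \<in> space (leb {..<n}). qnorm n A x \<le> t - d} \<le> emeasure (leb {..<n}) (\<Union>k\<in>lattice_points n A t. unit_cube n k)"
    by (rule emeasure_mono) (auto intro!: sets.finite_UN fin)
  also have "\<dots> = ennreal (real (card (lattice_points n A t)))"
    using fin by (subst emeasure_Union_unit_cube) (auto simp: lattice_points_def ennreal_of_nat_eq_real_of_nat)
  also have "emeasure (leb {..<n}) {x \<in> space (leb {..<n}). qnorm n A x \<le> t - d} = ennreal (unit_ball_vol (real n) * (t - d) ^ n)"
    using A t by (intro emeasure_ellipsoid) (auto simp: d_def)
  finally show ?thesis by (simp add: d_def ennreal_le_iff)
qed

lemma lattice_points_asymp:
  assumes A: "A \<in> SL n"
  shows "((\<lambda>t. real (card (lattice_points n A t)) / t ^ n) \<longlongrightarrow> unit_ball_vol (real n)) at_top"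
proof -
  define d where "d = mnorm n A + 1"
  have lim: "((\<lambda>t::real. unit_ball_vol (real n) * (1 + c / t) ^ n) \<longlongrightarrow> unit_ball_vol (real n) * (1 + 0) ^ n) at_top" for c
    by (intro tendsto_intros real_tendsto_divide_at_top[OF tendsto_const filterlim_ident])
  have lo: "\<forall>\<^sub>F t in at_top. unit_ball_vol (real n) * (1 + (- d) / t) ^ n \<le> real (card (lattice_points n A t)) / t ^ n"
    using eventually_gt_at_top[of "max d 0"]
  proof eventually_elim
    case (elim t)
    then have t: "t > 0" "t > d" by auto
    have "1 + (- d) / t = (t - d) / t" using t by (simp add: field_simps)
    then have "unit_ball_vol (real n) * (1 + (- d) / t) ^ n = unit_ball_vol (real n) * (t - d) ^ n / t ^ n"
      by (simp only: power_divide times_divide_eq_right)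
    also have "\<dots> \<le> real (card (lattice_points n A t)) / t ^ n"
      using lattice_points_lower[OF A, of t] t by (intro divide_right_mono) (auto simp: d_def)
    finally show ?case .
  qed
  have up: "\<forall>\<^sub>F t in at_top. real (card (lattice_points n A t)) / t ^ n \<le> unit_ball_vol (real n) * (1 + d / t) ^ n"
    using eventually_gt_at_top[of 0]
  proof eventually_elim
    case (elim t)
    have "real (card (lattice_points n A t)) / t ^ n \<le> unit_ball_vol (real n) * (t + d) ^ n / t ^ n"
      using lattice_points_upper(2)[OF A, of t] elim by (intro divide_right_mono) (auto simp: d_def)
    also have "unit_ball_vol (real n) * (t + d) ^ n / t ^ n = unit_ball_vol (real n) * (1 + d / t) ^ n"
    proof -
      have "1 + d / t = (t + d) / t" using elim by (simp add: field_simps)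
      then show ?thesis
        by (simp only: power_divide times_divide_eq_right)
    qed
    finally show ?case .
  qed
  show ?thesis
    by (rule tendsto_sandwich[OF lo up]) (use lim[of "-d"] lim[of d] in simp_all)
qed

section \<open>Hecke averages\<close>

definition residues :: "nat \<Rightarrow> nat \<Rightarrow> (nat \<Rightarrow> int) set" where
  "residues p n = ({..<n} \<rightarrow>\<^sub>E {0..<int p})"

text \<open>The nonzero linear forms modulo p. For prime p, each sublattice of index p is the kernel
  of p - 1 of them, so a uniform form gives a uniform sublattice; the zero form would give the whole
  lattice.\<close>

definition nz_residues :: "nat \<Rightarrow> nat \<Rightarrow> (nat \<Rightarrow> int) set" where
  "nz_residues p n = residues p n - {\<lambda>i\<in>{..<n}. 0}"

definition idot :: "nat \<Rightarrow> (nat \<Rightarrow> int) \<Rightarrow> (nat \<Rightarrow> int) \<Rightarrow> int" where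
  "idot n x k = (\<Sum>i<n. x i * k i)"

text \<open>The lattices \<open>hecke p n x A\<close>, for \<open>x \<noteq> 0\<close>, are the sublattices of index \<open>p\<close> of
  \<open>lattice_of A\<close>, rescaled to covolume one.\<close>

definition hecke :: "nat \<Rightarrow> nat \<Rightarrow> (nat \<Rightarrow> int) \<Rightarrow> real mat \<Rightarrow> real vec set" where
  "hecke p n x A = (\<lambda>k. (real p powr (- 1 / real n)) \<cdot>\<^sub>v lvec A k) ` {k \<in> int_vecs n. int p dvd idot n x k}"

lemma finite_residues [simp]: "finite (residues p n)"
  unfolding residues_def by (intro finite_PiE) auto

lemma finite_nz_residues [simp]: "finite (nz_residues p n)"
  by (simp add: nz_residues_def)

lemma card_residues: "card (residues p n) = p ^ n"
  unfolding residues_def by (simp add: card_PiE)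

lemma card_nz_residues: "p > 0 \<Longrightarrow> card (nz_residues p n) = p ^ n - 1"
proof -
  assume "p > 0"
  then have "(\<lambda>i\<in>{..<n}. 0) \<in> residues p n" by (auto simp: residues_def)
  then show ?thesis unfolding nz_residues_def by (simp add: card_Diff_singleton card_residues)
qed

lemma nz_residues_nonempty: "p > 1 \<Longrightarrow> n > 0 \<Longrightarrow> nz_residues p n \<noteq> {}"
proof -
  assume pn: "p > 1" "n > 0"
  have "(\<lambda>i\<in>{..<n}. 1) \<in> residues p n" using pn by (auto simp: residues_def)
  moreover have "(\<lambda>i\<in>{..<n}. 1::int) \<noteq> (\<lambda>i\<in>{..<n}. 0)" using pn by (auto simp: fun_eq_iff)
  ultimately show ?thesis unfolding nz_residues_def by blast
qed

lemma lvec_smult: "lvec (\<theta> \<cdot>\<^sub>m A) k = \<theta> \<cdot>\<^sub>v lvec A k"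
  by (rule eq_vecI) (auto simp: lvec_def sum_distrib_left algebra_simps)

lemma ex_mod_inverse:
  assumes "prime p" "\<not> int p dvd a"
  obtains u where "int p dvd a * u - 1"
proof -
  have "coprime a (int p)"
    using assms prime_imp_coprime[of "int p" a] by (simp add: coprime_commute)
  then obtain y v where "y * a + v * int p = 1" using bezout_int[of a "int p"] by auto
  then have "a * y - 1 = int p * (- v)" by (simp add: algebra_simps)
  then show thesis using that by (metis dvd_triv_left)
qed

text \<open>Some coordinate x_j is a unit modulo p, with inverse \<open>y\<close>. The congruence
  then determines k_j modulo p while the other coordinates are free, which gives the basis p e_j and
  e_i - x_i y e_j; these are the rows of \<open>H\<close>.\<close>

lemma hecke_mat:
  assumes p: "prime p" and n: "n > 0" and x: "x \<in> nz_residues p n"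
  obtains H where "H \<in> carrier_mat n n" "det H = real p"
    "\<And>A. A \<in> carrier_mat n n \<Longrightarrow> hecke p n x A = lattice_of ((real p powr (- 1 / real n)) \<cdot>\<^sub>m (H * A))"
proof -
  obtain j where j: "j < n" "x j \<noteq> 0"
  proof -
    have "\<exists>j<n. x j \<noteq> 0"
    proof (rule ccontr)
      assume "\<not> ?thesis"
      then have "x = (\<lambda>i\<in>{..<n}. 0)" using x
        by (auto simp: nz_residues_def residues_def PiE_iff extensional_def fun_eq_iff)
      then show False using x by (simp add: nz_residues_def)
    qed
    then show thesis using that by blast
  qed
  have xj: "0 \<le> x j" "x j < int p" using x j by (auto simp: nz_residues_def residues_def PiE_iff)
  have "\<not> int p dvd x j" using xj j(2) zdvd_not_zless[of "x j" "int p"] by auto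
  then obtain y where y: "int p dvd x j * y - 1" using ex_mod_inverse[OF p] by blast
  define h where "h i l = (if l = j then (if i = j then int p else - (x i * y)) else if i = l then 1 else 0)" for i l
  define H where "H = col_mat n j (\<lambda>i. real_of_int (h i j))"
  have Hc: "H \<in> carrier_mat n n" by (simp add: H_def)
  have Hh: "H $$ (i,l) = real_of_int (h i l)" if "i < n" "l < n" for i l
    using that by (auto simp: H_def col_mat_def h_def)
  have dH: "det H = real p" using j by (simp add: H_def det_col_mat) (simp add: h_def)
  define \<phi> where "\<phi> z = (\<lambda>l\<in>{..<n}. \<Sum>i<n. z i * h i l)" for z :: "nat \<Rightarrow> int"
  have \<phi>l: "\<phi> z l = z l" if "l < n" "l \<noteq> j" for z l
  proof -
    have "\<phi> z l = (\<Sum>i<n. z i * h i l)" using that by (simp add: \<phi>_def)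
    also have "\<dots> = (\<Sum>i<n. if i = l then z l else 0)"
      using that(2) by (intro sum.cong) (auto simp: h_def)
    finally show ?thesis using that by simp
  qed
  define r where "r z = (\<Sum>i\<in>{..<n}-{j}. z i * x i)" for z :: "nat \<Rightarrow> int"
  have \<phi>j: "\<phi> z j = z j * int p - y * r z" for z
  proof -
    have "\<phi> z j = (\<Sum>i<n. z i * h i j)" using j by (simp add: \<phi>_def)
    also have "\<dots> = z j * h j j + (\<Sum>i\<in>{..<n}-{j}. z i * h i j)"
      using j by (subst sum.remove[of _ j]) auto
    also have "(\<Sum>i\<in>{..<n}-{j}. z i * h i j) = - (y * r z)"
      unfolding r_def sum_distrib_left sum_negf[symmetric]
      by (rule sum.cong) (auto simp: h_def)
    finally show ?thesis by (simp add: h_def)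
  qed
  have dotk: "idot n x k = x j * k j + r k" for k
    unfolding idot_def r_def using j by (subst sum.remove[of _ j]) (auto simp: mult.commute intro!: sum.cong)
  have rphi: "r (\<phi> z) = r z" for z
    unfolding r_def by (rule sum.cong) (auto simp: \<phi>l)
  have img: "\<phi> ` int_vecs n = {k \<in> int_vecs n. int p dvd idot n x k}"
  proof (intro equalityI subsetI)
    fix k assume "k \<in> \<phi> ` int_vecs n"
    then obtain z where k: "k = \<phi> z" by auto
    have "idot n x k = x j * (z j * int p - y * r z) + r z"
      using \<phi>j rphi by (simp add: dotk k)
    also have "\<dots> = int p * (x j * z j) - (x j * y - 1) * r z" by (simp add: algebra_simps)
    finally have "int p dvd idot n x k" using y by simp
    then show "k \<in> {k \<in> int_vecs n. int p dvd idot n x k}" by (simp add: k \<phi>_def int_vecs_def)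
  next
    fix k assume "k \<in> {k \<in> int_vecs n. int p dvd idot n x k}"
    then have k: "k \<in> int_vecs n" "int p dvd idot n x k" by auto
    have "k j + y * r k = y * idot n x k - (x j * y - 1) * k j"
      by (simp add: dotk algebra_simps)
    then have "int p dvd k j + y * r k" using k(2) y by simp
    then obtain q where q: "k j + y * r k = int p * q" by (auto elim: dvdE)
    define z where "z = k(j := q)"
    have "z \<in> int_vecs n" using k(1) j by (auto simp: z_def int_vecs_def PiE_iff extensional_def)
    moreover have "\<phi> z = k"
    proof
      fix l
      have rz: "r z = r k" unfolding r_def by (rule sum.cong) (auto simp: z_def)
      show "\<phi> z l = k l"
      proof (cases "l < n")
        case True
        then show ?thesis using \<phi>l[of l z] \<phi>j[of z] rz q by (cases "l = j") (auto simp: z_def algebra_simps)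
      next
        case False
        then show ?thesis using k(1) by (auto simp: \<phi>_def int_vecs_def PiE_iff extensional_def)
      qed
    qed
    ultimately show "k \<in> \<phi> ` int_vecs n" by blast
  qed
  have "hecke p n x A = lattice_of ((real p powr (- 1 / real n)) \<cdot>\<^sub>m (H * A))" if A: "A \<in> carrier_mat n n" for A
  proof -
    have "lattice_of ((real p powr (- 1 / real n)) \<cdot>\<^sub>m (H * A)) =
        lvec ((real p powr (- 1 / real n)) \<cdot>\<^sub>m (H * A)) ` int_vecs n"
      using A Hc by (intro lattice_of_eq_lvec) auto
    also have "\<dots> = (\<lambda>z. (real p powr (- 1 / real n)) \<cdot>\<^sub>v lvec A (\<phi> z)) ` int_vecs n"
      by (simp add: lvec_smult lvec_int_mult[OF A Hc Hh] \<phi>_def)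
    also have "\<dots> = (\<lambda>k. (real p powr (- 1 / real n)) \<cdot>\<^sub>v lvec A k) ` (\<phi> ` int_vecs n)"
      by (simp add: image_image)
    finally show ?thesis by (simp add: hecke_def img)
  qed
  then show thesis using that Hc dH by blast
qed

lemma hecke_SL_mat:
  assumes p: "prime p" and n: "n > 0" and x: "x \<in> nz_residues p n"
  obtains H where "H \<in> carrier_mat n n" "\<And>A. A \<in> SL n \<Longrightarrow> H * A \<in> SL n"
    "\<And>A. A \<in> SL n \<Longrightarrow> hecke p n x A = lattice_of (H * A)"
proof -
  define \<theta> where "\<theta> = real p powr (- 1 / real n)"
  obtain H where H: "H \<in> carrier_mat n n" "det H = real p"
    "\<And>A. A \<in> carrier_mat n n \<Longrightarrow> hecke p n x A = lattice_of (\<theta> \<cdot>\<^sub>m (H * A))"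
    using hecke_mat[OF assms] unfolding \<theta>_def by blast
  have p0: "real p > 0" using prime_gt_0_nat[OF p] by simp
  have "\<theta> ^ n = real p powr (- 1)"
    using n p0 by (simp add: \<theta>_def powr_power)
  then have th: "\<theta> ^ n * real p = 1" using p0 by (simp add: powr_minus)
  have eq: "(\<theta> \<cdot>\<^sub>m H) * A = \<theta> \<cdot>\<^sub>m (H * A)" if "A \<in> SL n" for A
    using H(1) SL_carrier[OF that] by (rule mult_smult_assoc_mat)
  have "det (\<theta> \<cdot>\<^sub>m H) = 1" using H th by simp
  then have "\<theta> \<cdot>\<^sub>m H \<in> SL n" using H(1) by (simp add: SL_def)
  then have thH: "\<theta> \<cdot>\<^sub>m H \<in> SL n" .
  show thesis
  proof (rule that)
    show "\<theta> \<cdot>\<^sub>m H \<in> carrier_mat n n" using thH by (rule SL_carrier)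
    fix A assume A: "A \<in> SL n"
    show "(\<theta> \<cdot>\<^sub>m H) * A \<in> SL n" using thH A by (rule SL_mult)
    show "hecke p n x A = lattice_of ((\<theta> \<cdot>\<^sub>m H) * A)"
      unfolding eq[OF A] by (rule H(3)[OF SL_carrier[OF A]])
  qed
qed

lemma measurable_hecke:
  assumes "prime p" "n > 0" "x \<in> nz_residues p n" and f: "f \<in> M \<rightarrow>\<^sub>M SL_borel n"
  shows "(\<lambda>y. hecke p n x (f y)) \<in> M \<rightarrow>\<^sub>M lattice_borel n"
proof -
  obtain H where H: "H \<in> carrier_mat n n" "\<And>A. A \<in> SL n \<Longrightarrow> H * A \<in> SL n"
    "\<And>A. A \<in> SL n \<Longrightarrow> hecke p n x A = lattice_of (H * A)"
    using hecke_SL_mat[OF assms(1-3)] by blast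
  have "H \<in> SL n" using H(2)[OF SL_one] H(1) by simp
  then have "(\<lambda>y. lattice_of (H * f y)) \<in> M \<rightarrow>\<^sub>M lattice_borel n"
    using f by (intro measurable_compose[OF _ measurable_lattice_of] measurable_SL_mult) auto
  also have "?this \<longleftrightarrow> ?thesis"
    by (rule measurable_cong) (use H(3) measurable_space[OF f] in auto)
  finally show ?thesis .
qed

lemma hecke_act:
  assumes "prime p" "n > 0" "x \<in> nz_residues p n" "A \<in> SL n" "g \<in> SL n"
  shows "hecke p n x (A * g) = lattice_act g (hecke p n x A)"
proof -
  obtain H where H: "H \<in> carrier_mat n n" "\<And>A. A \<in> SL n \<Longrightarrow> H * A \<in> SL n"
    "\<And>A. A \<in> SL n \<Longrightarrow> hecke p n x A = lattice_of (H * A)"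
    using hecke_SL_mat[OF assms(1-3)] by blast
  have "H * (A * g) = H * A * g"
    using H(1) SL_carrier[OF assms(4)] SL_carrier[OF assms(5)] by (rule assoc_mult_mat[symmetric])
  then show ?thesis
    using lattice_act_of[OF H(2)[OF assms(4)] assms(5)] H(3)[OF assms(4)] H(3)[OF SL_mult[OF assms(4,5)]]
    by simp
qed

text \<open>A single Hecke lattice depends on the basis, since \<open>x\<close> is read in
  coordinates. Changing the basis by \<open>c\<close> replaces the column \<open>x\<close> by c^(-1)
  x modulo p, which permutes the nonzero residue vectors, so the sum depends only on the
  lattice.\<close>

lemma hecke_SLZ:
  fixes F :: "real vec set \<Rightarrow> ennreal"
  assumes p: "p > 0" and c: "c \<in> SLZ n" and A: "A \<in> carrier_mat n n"
  shows "(\<Sum>x\<in>nz_residues p n. F (hecke p n x (c * A))) = (\<Sum>x\<in>nz_residues p n. F (hecke p n x A))"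
proof -
  define d where "d = adj_mat c"
  have dZ: "d \<in> SLZ n" unfolding d_def by (rule SLZ_adj[OF c])
  have cc: "c \<in> carrier_mat n n" and dc: "d \<in> carrier_mat n n"
    using c dZ by (auto simp: SLZ_def SL_def)
  define ci where "ci i l = \<lfloor>c $$ (i,l)\<rfloor>" for i l
  define di where "di i l = \<lfloor>d $$ (i,l)\<rfloor>" for i l
  have ci: "c $$ (i,l) = real_of_int (ci i l)" if "i < n" "l < n" for i l
    using c that by (auto simp: SLZ_def ci_def elim!: Ints_cases)
  have di: "d $$ (i,l) = real_of_int (di i l)" if "i < n" "l < n" for i l
    using dZ that by (auto simp: SLZ_def di_def elim!: Ints_cases)
  have delta: "(\<Sum>l<n. ai i l * bi l m) = (if i = m then 1 else 0)"
    if ab: "a * b = 1\<^sub>m n" "a \<in> carrier_mat n n" "b \<in> carrier_mat n n"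
      "\<And>i l. i < n \<Longrightarrow> l < n \<Longrightarrow> a $$ (i,l) = real_of_int (ai i l)"
      "\<And>i l. i < n \<Longrightarrow> l < n \<Longrightarrow> b $$ (i,l) = real_of_int (bi i l)" and im: "i < n" "m < n"
    for a b :: "real mat" and ai bi i m
  proof -
    have "real_of_int (\<Sum>l<n. ai i l * bi l m) = (\<Sum>l<n. a $$ (i,l) * b $$ (l,m))"
      using ab(4,5) im by simp
    also have "\<dots> = (a * b) $$ (i,m)" by (rule mat_mult_entry[OF ab(2,3) im, symmetric])
    also have "\<dots> = real_of_int (if i = m then 1 else 0)" using im by (simp only: ab(1)) simp
    finally show ?thesis by (simp only: of_int_eq_iff)
  qed
  have cd: "(\<Sum>l<n. ci i l * di l m) = (if i = m then 1 else 0)" if "i < n" "m < n" for i m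
    by (rule delta[OF _ cc dc ci di that]) (use SL_adj(2)[OF SLZ_SL[OF c]] in \<open>auto simp: d_def\<close>)
  have dcd: "(\<Sum>l<n. di i l * ci l m) = (if i = m then 1 else 0)" if "i < n" "m < n" for i m
    by (rule delta[OF _ dc cc di ci that]) (use SL_adj(3)[OF SLZ_SL[OF c]] in \<open>auto simp: d_def\<close>)
  define T where "T a x = (\<lambda>l\<in>{..<n}. (\<Sum>i<n. a l i * x i) mod int p)" for a :: "nat \<Rightarrow> nat \<Rightarrow> int" and x
  have Tres: "T a x \<in> residues p n" for a x using p by (auto simp: T_def residues_def)
  have TT: "T a (T b x) = x"
    if ab: "\<And>i m. i < n \<Longrightarrow> m < n \<Longrightarrow> (\<Sum>l<n. a i l * b l m) = (if i = m then 1 else 0)"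
      and x: "x \<in> residues p n" for a b x
  proof
    fix i
    show "T a (T b x) i = x i"
    proof (cases "i < n")
      case True
      have "T a (T b x) i = (\<Sum>l<n. a i l * ((\<Sum>m<n. b l m * x m) mod int p)) mod int p"
        using True by (simp add: T_def)
      also have "\<dots> = (\<Sum>l<n. a i l * (\<Sum>m<n. b l m * x m)) mod int p"
        by (subst mod_sum_eq[symmetric], subst (2) mod_sum_eq[symmetric]) (simp add: mod_mult_right_eq)
      also have "(\<Sum>l<n. a i l * (\<Sum>m<n. b l m * x m)) = (\<Sum>m<n. (\<Sum>l<n. a i l * b l m) * x m)"
        unfolding sum_distrib_left sum_distrib_right mult.assoc by (rule sum.swap)
      also have "\<dots> = (\<Sum>m<n. if m = i then x i else 0)"
        using ab[OF True] by (intro sum.cong) auto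
      also have "\<dots> mod int p = x i"
        using True x by (auto simp: residues_def PiE_iff)
      finally show ?thesis .
    qed (use x in \<open>auto simp: T_def residues_def PiE_iff extensional_def\<close>)
  qed
  have T0: "T a (\<lambda>i\<in>{..<n}. 0) = (\<lambda>i\<in>{..<n}. 0)" for a
    by (auto simp: T_def)
  have Tnz: "T b x \<in> nz_residues p n"
    if ab: "\<And>i m. i < n \<Longrightarrow> m < n \<Longrightarrow> (\<Sum>l<n. a i l * b l m) = (if i = m then 1 else 0)"
      and x: "x \<in> nz_residues p n" for a b x
    using TT[OF ab, of x] T0[of a] Tres[of b x] x by (auto simp: nz_residues_def)
  have bij: "bij_betw (T di) (nz_residues p n) (nz_residues p n)"
    by (rule bij_betwI[where g = "T ci"])
      (use Tnz[OF cd] Tnz[OF dcd] TT[OF cd] TT[OF dcd] in \<open>auto simp: nz_residues_def\<close>)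
  have "hecke p n x (c * A) = hecke p n (T di x) A" for x
  proof -
    define \<phi> where "\<phi> z = (\<lambda>l\<in>{..<n}. \<Sum>i<n. z i * ci i l)" for z :: "nat \<Rightarrow> int"
    define \<psi> where "\<psi> z = (\<lambda>l\<in>{..<n}. \<Sum>i<n. z i * di i l)" for z :: "nat \<Rightarrow> int"
    have comp: "(\<lambda>l\<in>{..<n}. \<Sum>i<n. ((\<lambda>l\<in>{..<n}. \<Sum>i<n. z i * a i l) i) * b i l) = z"
      if ab: "\<And>i m. i < n \<Longrightarrow> m < n \<Longrightarrow> (\<Sum>l<n. a i l * b l m) = (if i = m then 1 else 0)"
        and z: "z \<in> int_vecs n" for a b and z :: "nat \<Rightarrow> int"
    proof
      fix m
      show "(\<lambda>l\<in>{..<n}. \<Sum>i<n. ((\<lambda>l\<in>{..<n}. \<Sum>i<n. z i * a i l) i) * b i l) m = z m"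
      proof (cases "m < n")
        case True
        have "(\<Sum>l<n. (\<Sum>i<n. z i * a i l) * b l m) = (\<Sum>i<n. z i * (\<Sum>l<n. a i l * b l m))"
          unfolding sum_distrib_left sum_distrib_right mult.assoc by (rule sum.swap)
        also have "\<dots> = (\<Sum>i<n. if i = m then z m else 0)"
          using ab[OF _ True] by (intro sum.cong) auto
        also have "\<dots> = z m" using True by simp
        finally show ?thesis using True by simp
      qed (use z in \<open>auto simp: int_vecs_def PiE_iff extensional_def\<close>)
    qed
    have phipsi: "\<phi> (\<psi> k) = k" "\<psi> (\<phi> k) = k" if "k \<in> int_vecs n" for k
      using comp[OF dcd that] comp[OF cd that] by (simp_all add: \<phi>_def \<psi>_def)
    have mem: "\<phi> k \<in> int_vecs n" "\<psi> k \<in> int_vecs n" for k by (auto simp: \<phi>_def \<psi>_def int_vecs_def)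
    \<comment> \<open>Duality of the two actions: (d x) . k = x . (k d), read modulo p.\<close>
    have dv: "int p dvd idot n (T di x) k \<longleftrightarrow> int p dvd idot n x (\<psi> k)" for k
    proof -
      have "idot n x (\<psi> k) = (\<Sum>l<n. (\<Sum>i<n. di l i * x i) * k l)"
        unfolding idot_def \<psi>_def sum_distrib_left sum_distrib_right
        by (subst sum.swap) (auto simp: sum_distrib_left mult_ac intro!: sum.cong)
      moreover have "idot n (T di x) k mod int p = (\<Sum>l<n. (\<Sum>i<n. di l i * x i) * k l) mod int p"
        unfolding idot_def T_def
        by (subst mod_sum_eq[symmetric], subst (2) mod_sum_eq[symmetric]) (simp add: mod_mult_left_eq)
      ultimately show ?thesis by (simp add: dvd_eq_mod_eq_0)
    qed
    have "{k \<in> int_vecs n. int p dvd idot n (T di x) k} = \<phi> ` {k \<in> int_vecs n. int p dvd idot n x k}"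
    proof (intro equalityI subsetI)
      fix k assume "k \<in> {k \<in> int_vecs n. int p dvd idot n (T di x) k}"
      then show "k \<in> \<phi> ` {k \<in> int_vecs n. int p dvd idot n x k}"
        using phipsi(1)[of k] mem(2)[of k] dv by (intro image_eqI[of _ _ "\<psi> k"]) auto
    next
      fix k assume "k \<in> \<phi> ` {k \<in> int_vecs n. int p dvd idot n x k}"
      then show "k \<in> {k \<in> int_vecs n. int p dvd idot n (T di x) k}"
        using phipsi(2) mem(1) dv by auto
    qed
    then show ?thesis
      unfolding hecke_def by (simp add: image_image lvec_int_mult[OF A cc ci] \<phi>_def)
  qed
  then have "(\<Sum>x\<in>nz_residues p n. F (hecke p n x (c * A))) = (\<Sum>x\<in>nz_residues p n. F (hecke p n (T di x) A))"
    by simp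
  also have "\<dots> = (\<Sum>x\<in>nz_residues p n. F (hecke p n x A))"
    by (rule sum.reindex_bij_betw[OF bij])
  finally show ?thesis .
qed


section \<open>Averages over Hecke lattices and their integrals\<close>

definition hecke_mean :: "nat \<Rightarrow> nat \<Rightarrow> (real vec set \<Rightarrow> ennreal) \<Rightarrow> real mat \<Rightarrow> ennreal" where
  "hecke_mean p n F A = (\<Sum>x\<in>nz_residues p n. F (hecke p n x A)) / of_nat (card (nz_residues p n))"

lemma measurable_hecke_mean:
  assumes "prime p" "n > 0" "F \<in> borel_measurable (lattice_borel n)" "f \<in> M \<rightarrow>\<^sub>M SL_borel n"
  shows "(\<lambda>y. hecke_mean p n F (f y)) \<in> borel_measurable M"
  unfolding hecke_mean_def
  by (intro borel_measurable_divide_ennreal borel_measurable_const borel_measurable_sum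
      measurable_compose[OF measurable_hecke[OF assms(1,2) _ assms(4)] assms(3)])

text \<open>Let \<mu>' be the law of a uniformly chosen Hecke lattice of a \<mu>-random lattice.
  Passing to a sublattice commutes with the right action, and the change of representative
  disappears after averaging by \<open>hecke_SLZ\<close>. So \<mu>' is invariant and equals \<mu> by
  uniqueness.\<close>

lemma nn_integral_hecke:
  assumes mu: "invariant_lattice_prob n \<mu>" and p: "prime p" and n: "n > 0"
    and F: "F \<in> borel_measurable (lattice_borel n)"
  shows "(\<integral>\<^sup>+L. F L \<partial>\<mu>) = (\<integral>\<^sup>+L. hecke_mean p n F (lattice_section n L) \<partial>\<mu>)"
proof -
  have sets: "sets \<mu> = sets (lattice_borel n)"
    and inv: "\<And>g. g \<in> SL n \<Longrightarrow> distr \<mu> \<mu> (lattice_act g) = \<mu>"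
    using mu by (auto simp: invariant_lattice_prob_def)
  interpret prob_space \<mu> using mu by (simp add: invariant_lattice_prob_def)
  have space: "space \<mu> = unimodular_lattices n" using sets_eq_imp_space_eq[OF sets] by simp
  define X where "X = nz_residues p n"
  have X: "finite X" "X \<noteq> {}" using nz_residues_nonempty[of p n] p n prime_gt_1_nat by (auto simp: X_def)
  define U where "U = uniform_count_measure X"
  interpret U: prob_space U unfolding U_def by (rule prob_space_uniform_count_measure[OF X])
  have spU: "space U = X" and setsU: "sets U = sets (count_space X)"
    by (auto simp: U_def space_uniform_count_measure sets_uniform_count_measure)
  interpret UM: pair_sigma_finite \<mu> U ..
  have sec: "lattice_section n \<in> \<mu> \<rightarrow>\<^sub>M SL_borel n"
    using measurable_lattice_section measurable_cong_sets[OF sets refl] by blast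
  define T where "T = (\<lambda>w. hecke p n (snd w) (lattice_section n (fst w)))"
  have Tm: "T \<in> \<mu> \<Otimes>\<^sub>M U \<rightarrow>\<^sub>M lattice_borel n"
  proof -
    have "(\<lambda>(x, L). hecke p n x (lattice_section n L)) \<in> count_space X \<Otimes>\<^sub>M \<mu> \<rightarrow>\<^sub>M lattice_borel n"
      by (rule measurable_pair_measure_countable1)
        (use X p n in \<open>auto simp: X_def intro!: measurable_hecke sec countable_finite\<close>)
    then have "(\<lambda>(x, L). hecke p n x (lattice_section n L)) \<in> U \<Otimes>\<^sub>M \<mu> \<rightarrow>\<^sub>M lattice_borel n"
      using measurable_cong_sets[OF sets_pair_measure_cong[OF setsU refl] refl] by blast
    from measurable_compose[OF measurable_pair_swap' this] show ?thesis
      by (simp add: T_def split_beta')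
  qed
  define \<mu>' where "\<mu>' = distr (\<mu> \<Otimes>\<^sub>M U) (lattice_borel n) T"
  have intT: "(\<integral>\<^sup>+L. G L \<partial>\<mu>') = (\<integral>\<^sup>+L. hecke_mean p n G (lattice_section n L) \<partial>\<mu>)"
    if G: "G \<in> borel_measurable (lattice_borel n)" for G
  proof -
    have "(\<integral>\<^sup>+L. G L \<partial>\<mu>') = (\<integral>\<^sup>+w. G (T w) \<partial>(\<mu> \<Otimes>\<^sub>M U))"
      unfolding \<mu>'_def using nn_integral_distr[OF Tm, of G] G by simp
    also have "\<dots> = (\<integral>\<^sup>+L. \<integral>\<^sup>+x. G (T (L, x)) \<partial>U \<partial>\<mu>)"
      using U.nn_integral_fst[OF measurable_compose[OF Tm G]] by simp
    also have "\<dots> = (\<integral>\<^sup>+L. hecke_mean p n G (lattice_section n L) \<partial>\<mu>)"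
    proof (rule nn_integral_cong)
      fix L
      have "(\<integral>\<^sup>+x. G (T (L, x)) \<partial>U) = (\<Sum>x\<in>X. ennreal (1 / real (card X)) * G (T (L, x)))"
        unfolding U_def uniform_count_measure_def by (rule nn_integral_point_measure_finite[OF X(1)])
      also have "ennreal (1 / real (card X)) = inverse (of_nat (card X))"
        using X by (simp add: inverse_eq_divide[symmetric] inverse_ennreal[symmetric] ennreal_of_nat_eq_real_of_nat card_gt_0_iff)
      also have "(\<Sum>x\<in>X. inverse (of_nat (card X)) * G (T (L, x))) = hecke_mean p n G (lattice_section n L)"
        by (simp add: hecke_mean_def X_def T_def sum_distrib_left[symmetric] divide_ennreal_def mult.commute)
      finally show "(\<integral>\<^sup>+x. G (T (L, x)) \<partial>U) = hecke_mean p n G (lattice_section n L)" .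
    qed
    finally show ?thesis .
  qed
  have "prob_space (\<mu> \<Otimes>\<^sub>M U)"
    by (rule prob_space_pair) unfold_locales
  then have prob': "prob_space \<mu>'"
    unfolding \<mu>'_def by (rule prob_space.prob_space_distr[OF _ Tm])
  have sets': "sets \<mu>' = sets (lattice_borel n)" by (simp add: \<mu>'_def)
  have space': "space \<mu>' = unimodular_lattices n" by (simp add: \<mu>'_def)
  have act: "lattice_act g \<in> M \<rightarrow>\<^sub>M M" if "g \<in> SL n" "sets M = sets (lattice_borel n)" for g M
    using measurable_lattice_act_pair[of "\<lambda>x. x" "lattice_borel n" n "\<lambda>_. g"] that
      measurable_cong_sets[OF that(2) that(2)] by auto
  have "invariant_lattice_prob n \<mu>'"
    unfolding invariant_lattice_prob_def
  proof (intro conjI ballI prob' sets')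
    fix g assume g: "g \<in> SL n"
    show "distr \<mu>' \<mu>' (lattice_act g) = \<mu>'"
    proof (rule measure_eqI)
      fix E assume "E \<in> sets (distr \<mu>' \<mu>' (lattice_act g))"
      then have E: "E \<in> sets (lattice_borel n)" by (simp add: sets')
      have indE: "(indicator E :: _ \<Rightarrow> ennreal) \<in> borel_measurable (lattice_borel n)" using E by simp
      define Q where "Q L = hecke_mean p n (indicator E) (lattice_section n L)" for L
      have Q: "Q \<in> borel_measurable \<mu>"
        unfolding Q_def by (rule measurable_hecke_mean[OF p n indE sec])
      have "emeasure (distr \<mu>' \<mu>' (lattice_act g)) E = (\<integral>\<^sup>+L. indicator E L \<partial>distr \<mu>' \<mu>' (lattice_act g))"
        using E by (simp add: sets')
      also have "\<dots> = (\<integral>\<^sup>+L. indicator E (lattice_act g L) \<partial>\<mu>')"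
        using nn_integral_distr[OF act[OF g sets'], of "indicator E"] indE
          measurable_cong_sets[OF sets' refl, of borel] by auto
      also have "\<dots> = (\<integral>\<^sup>+L. hecke_mean p n (\<lambda>L. indicator E (lattice_act g L)) (lattice_section n L) \<partial>\<mu>)"
        by (rule intT, rule measurable_compose[OF act[OF g refl] indE])
      also have "\<dots> = (\<integral>\<^sup>+L. Q (lattice_act g L) \<partial>\<mu>)"
      proof (rule nn_integral_cong)
        fix L assume "L \<in> space \<mu>"
        then have L: "L \<in> unimodular_lattices n" by (simp add: space)
        then obtain c where c: "c \<in> SLZ n"
          "lattice_section n L * g = c * lattice_section n (lattice_act g L)"
          using lattice_act_section g by blast
        have s: "lattice_section n L \<in> SL n" "lattice_section n (lattice_act g L) \<in> SL n"
          using L g by (auto intro: lattice_section_SL lattice_act_SL)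
        have "(\<Sum>x\<in>nz_residues p n. indicator E (lattice_act g (hecke p n x (lattice_section n L))) :: ennreal) =
            (\<Sum>x\<in>nz_residues p n. indicator E (hecke p n x (c * lattice_section n (lattice_act g L))))"
          using hecke_act[OF p n _ s(1) g] c(2) by (intro sum.cong) auto
        also have "\<dots> = (\<Sum>x\<in>nz_residues p n. indicator E (hecke p n x (lattice_section n (lattice_act g L))))"
          by (rule hecke_SLZ[OF prime_gt_0_nat[OF p] c(1) SL_carrier[OF s(2)]])
        finally show "hecke_mean p n (\<lambda>L. indicator E (lattice_act g L)) (lattice_section n L) = Q (lattice_act g L)"
          by (simp add: hecke_mean_def Q_def)
      qed
      also have "\<dots> = (\<integral>\<^sup>+L. Q L \<partial>distr \<mu> \<mu> (lattice_act g))"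
        using nn_integral_distr[OF act[OF g sets], of Q] Q by simp
      also have "\<dots> = (\<integral>\<^sup>+L. indicator E L \<partial>\<mu>')"
        unfolding inv[OF g] intT[OF indE] by (simp add: Q_def)
      also have "\<dots> = emeasure \<mu>' E" using E by (simp add: sets')
      finally show "emeasure (distr \<mu>' \<mu>' (lattice_act g)) E = emeasure \<mu>' E" .
    qed simp
  qed
  then have "\<mu>' = \<mu>" using invariant_lattice_prob_unique mu by blast
  then show ?thesis using intT[OF F] by simp
qed

text \<open>The integral of the mean is the same for every p, whereas the means are controlled only
  pointwise for large p. Fatou's lemma for upper limits, with the constant \<open>K\<close> as
  integrable majorant, brings the pointwise bound under the integral.\<close>

lemma nn_integral_le_hecke_limit:
  assumes mu: "invariant_lattice_prob n \<mu>" and n: "n > 0"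
    and F: "F \<in> borel_measurable (lattice_borel n)" and bound: "\<And>L. F L \<le> ennreal K"
    and lim: "\<And>A e. A \<in> SL n \<Longrightarrow> e > 0 \<Longrightarrow>
      \<exists>p0. \<forall>p\<ge>p0. prime p \<longrightarrow> hecke_mean p n F A \<le> ennreal (\<eta> + e)"
    and eta: "\<eta> \<ge> 0"
  shows "(\<integral>\<^sup>+L. F L \<partial>\<mu>) \<le> ennreal \<eta>"
proof -
  have sets: "sets \<mu> = sets (lattice_borel n)" using mu by (simp add: invariant_lattice_prob_def)
  interpret prob_space \<mu> using mu by (simp add: invariant_lattice_prob_def)
  have space: "space \<mu> = unimodular_lattices n" using sets_eq_imp_space_eq[OF sets] by simp
  have sec: "lattice_section n \<in> \<mu> \<rightarrow>\<^sub>M SL_borel n"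
    using measurable_lattice_section measurable_cong_sets[OF sets refl] by blast
  obtain q :: "nat \<Rightarrow> nat" where q: "\<And>i. prime (q i)" "\<And>i. q i > i"
    using bigger_prime by metis
  define u where "u i L = hecke_mean (q i) n F (lattice_section n L)" for i L
  have um: "u i \<in> borel_measurable \<mu>" for i
    unfolding u_def by (rule measurable_hecke_mean[OF q(1) n F sec])
  have ub: "u i L \<le> ennreal K" for i L
  proof -
    have X: "finite (nz_residues (q i) n)" "nz_residues (q i) n \<noteq> {}"
      using nz_residues_nonempty[of "q i" n] q n prime_gt_1_nat by auto
    have "(\<Sum>x\<in>nz_residues (q i) n. F (hecke (q i) n x (lattice_section n L)))
        \<le> of_nat (card (nz_residues (q i) n)) * ennreal K"
      by (intro sum_bounded_above bound)
    then have "u i L \<le> of_nat (card (nz_residues (q i) n)) * ennreal K / of_nat (card (nz_residues (q i) n))"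
      unfolding u_def hecke_mean_def by (rule divide_right_mono_ennreal)
    also have "\<dots> = ennreal K"
      using X by (subst mult.commute, subst ennreal_mult_divide_eq) (auto simp: ennreal_of_nat_eq_real_of_nat)
    finally show ?thesis .
  qed
  have "(\<integral>\<^sup>+L. F L \<partial>\<mu>) = integral\<^sup>N \<mu> (u i)" for i
    using nn_integral_hecke[OF mu q(1) n F] by (simp add: u_def[abs_def])
  then have "(\<integral>\<^sup>+L. F L \<partial>\<mu>) = limsup (\<lambda>i. integral\<^sup>N \<mu> (u i))" by (simp add: Limsup_const)
  also have "\<dots> \<le> (\<integral>\<^sup>+L. limsup (\<lambda>i. u i L) \<partial>\<mu>)"
    by (rule nn_integral_limsup[where w = "\<lambda>_. ennreal K"])
      (use um ub in \<open>auto simp: emeasure_space_1\<close>)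
  also have "\<dots> \<le> (\<integral>\<^sup>+L. ennreal \<eta> \<partial>\<mu>)"
  proof (rule nn_integral_mono)
    fix L assume "L \<in> space \<mu>"
    then have s: "lattice_section n L \<in> SL n" using lattice_section_SL by (simp add: space)
    show "limsup (\<lambda>i. u i L) \<le> ennreal \<eta>"
    proof (rule ennreal_le_epsilon)
      fix e :: real assume e: "e > 0"
      obtain p0 where p0: "\<And>p. p \<ge> p0 \<Longrightarrow> prime p \<Longrightarrow> hecke_mean p n F (lattice_section n L) \<le> ennreal (\<eta> + e)"
        using lim[OF s e] by blast
      have "\<forall>\<^sub>F i in sequentially. u i L \<le> ennreal (\<eta> + e)"
        using eventually_ge_at_top[of p0]
      proof eventually_elim
        case (elim i)
        then show ?case using p0[of "q i"] q(1,2)[of i] by (simp add: u_def)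
      qed
      then have "limsup (\<lambda>i. u i L) \<le> ennreal (\<eta> + e)" by (rule Limsup_bounded)
      then show "limsup (\<lambda>i. u i L) \<le> ennreal \<eta> + ennreal e" using eta e by (simp add: ennreal_plus)
    qed
  qed
  also have "\<dots> = ennreal \<eta>" by (simp add: emeasure_space_1)
  finally show ?thesis .
qed

section \<open>Primitive integer vectors\<close>

definition zvec :: "nat \<Rightarrow> nat \<Rightarrow> int" where
  "zvec n = (\<lambda>i\<in>{..<n}. 0)"

definition imul :: "nat \<Rightarrow> int \<Rightarrow> (nat \<Rightarrow> int) \<Rightarrow> nat \<Rightarrow> int" where
  "imul n m k = (\<lambda>i\<in>{..<n}. m * k i)"

definition iprim :: "nat \<Rightarrow> (nat \<Rightarrow> int) \<Rightarrow> bool" where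
  "iprim n k \<longleftrightarrow> k \<in> int_vecs n \<and> k \<noteq> zvec n \<and> \<not> (\<exists>m\<ge>2. \<exists>l\<in>int_vecs n. k = imul n m l)"

text \<open>The first nonzero coordinate is positive: a choice of one vector from each pair k,
  -k.\<close>

definition ipos :: "nat \<Rightarrow> (nat \<Rightarrow> int) \<Rightarrow> bool" where
  "ipos n k \<longleftrightarrow> (\<exists>j<n. k j > 0 \<and> (\<forall>i<j. k i = 0))"

lemma zvec_int_vecs [simp]: "zvec n \<in> int_vecs n"
  by (simp add: zvec_def int_vecs_def)

lemma zvec_apply [simp]: "i < n \<Longrightarrow> zvec n i = 0"
  by (simp add: zvec_def)

lemma imul_int_vecs [simp]: "imul n m k \<in> int_vecs n"
  by (simp add: imul_def int_vecs_def)

lemma int_vecs_eqI: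
  assumes "k \<in> int_vecs n" "l \<in> int_vecs n" "\<And>i. i < n \<Longrightarrow> k i = l i"
  shows "k = l"
  using assms by (auto simp: int_vecs_def intro: PiE_ext)

lemma nonzero_coord: "k \<in> int_vecs n \<Longrightarrow> k \<noteq> zvec n \<Longrightarrow> \<exists>i<n. k i \<noteq> 0"
  using int_vecs_eqI[OF _ zvec_int_vecs, of k n] by auto

lemma imul_one: "k \<in> int_vecs n \<Longrightarrow> imul n 1 k = k"
  by (rule int_vecs_eqI[OF imul_int_vecs]) (auto simp: imul_def)

lemma imul_imul: "imul n a (imul n b k) = imul n (a * b) k"
  by (auto simp: imul_def)

lemma imul_zvec_iff:
  assumes "k \<in> int_vecs n" "m \<noteq> 0"
  shows "imul n m k = zvec n \<longleftrightarrow> k = zvec n"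
proof
  assume *: "imul n m k = zvec n"
  have "k i = 0" if "i < n" for i using fun_cong[OF *, of i] that assms(2) by (simp add: imul_def zvec_def)
  then show "k = zvec n" by (intro int_vecs_eqI[OF assms(1) zvec_int_vecs]) simp
qed (auto simp: imul_def zvec_def)

lemma inj_imul: "m \<noteq> 0 \<Longrightarrow> inj_on (imul n m) (int_vecs n)"
proof (rule inj_onI)
  fix k l assume m: "m \<noteq> 0" "k \<in> int_vecs n" "l \<in> int_vecs n" and eq: "imul n m k = imul n m l"
  have "k i = l i" if "i < n" for i using fun_cong[OF eq, of i] that m(1) by (simp add: imul_def)
  then show "k = l" using m by (intro int_vecs_eqI)
qed

lemma ipos_nonzero: "ipos n k \<Longrightarrow> k \<noteq> zvec n"
  by (auto simp: ipos_def zvec_def)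

lemma ipos_imul: "m > 0 \<Longrightarrow> ipos n (imul n m k) \<longleftrightarrow> ipos n k"
  by (auto simp: ipos_def imul_def zero_less_mult_iff)

lemma ipos_neg:
  assumes "k \<in> int_vecs n" "k \<noteq> zvec n"
  shows "ipos n (imul n (-1) k) \<longleftrightarrow> \<not> ipos n k"
proof -
  obtain i where "i < n" "k i \<noteq> 0" using nonzero_coord[OF assms] by blast
  then obtain j where j: "j < n" "k j \<noteq> 0" "\<And>i. i < j \<Longrightarrow> k i = 0"
    using exists_least_iff[of "\<lambda>i. i < n \<and> k i \<noteq> 0"] by (metis less_trans)
  have "ipos n k \<longleftrightarrow> k j > 0"
    unfolding ipos_def using j by (metis less_irrefl linorder_neqE_nat)
  moreover have "ipos n (imul n (-1) k) \<longleftrightarrow> k j < 0"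
  proof
    assume "ipos n (imul n (-1) k)"
    then obtain l where l: "l < n" "k l < 0" "\<And>i. i < l \<Longrightarrow> i < n \<Longrightarrow> k i = 0"
      by (auto simp: ipos_def imul_def split: if_splits)
    then show "k j < 0" using j by (metis less_irrefl linorder_neqE_nat)
  next
    assume "k j < 0"
    then show "ipos n (imul n (-1) k)" using j by (auto simp: ipos_def imul_def intro!: exI[of _ j])
  qed
  ultimately show ?thesis using j(2) by auto
qed

text \<open>Dividing out a factor of at least 2 strictly lowers the sum of the absolute coordinates,
  so repeated division ends at a primitive vector.\<close>

lemma primitive_decomposition:
  assumes "k \<in> int_vecs n" "k \<noteq> zvec n"
  shows "\<exists>m\<ge>1. \<exists>l. iprim n l \<and> k = imul n m l"
  using assms
proof (induction "\<Sum>i<n. nat \<bar>k i\<bar>" arbitrary: k rule: less_induct)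
  case less
  show ?case
  proof (cases "iprim n k")
    case True
    then show ?thesis using imul_one[OF less.prems(1)] by (intro exI[of _ 1]) auto
  next
    case False
    then obtain m l where ml: "m \<ge> 2" "l \<in> int_vecs n" "k = imul n m l"
      using less.prems by (auto simp: iprim_def)
    have l0: "l \<noteq> zvec n" using less.prems(2) ml imul_zvec_iff[of l n m] by auto
    obtain i where i: "i < n" "l i \<noteq> 0" using nonzero_coord[OF ml(2) l0] by blast
    have ab: "\<bar>k j\<bar> = m * \<bar>l j\<bar>" if "j < n" for j
      using that ml by (simp add: imul_def abs_mult)
    have "(\<Sum>i<n. nat \<bar>l i\<bar>) < (\<Sum>i<n. nat \<bar>k i\<bar>)"
    proof (rule sum_strict_mono_ex1)
      show "\<forall>j\<in>{..<n}. nat \<bar>l j\<bar> \<le> nat \<bar>k j\<bar>"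
      proof
        fix j assume "j \<in> {..<n}"
        then show "nat \<bar>l j\<bar> \<le> nat \<bar>k j\<bar>"
          using ab[of j] ml(1) mult_right_mono[of 1 m "\<bar>l j\<bar>"] by simp
      qed
      have "\<bar>l i\<bar> < \<bar>k i\<bar>" using ab[OF i(1)] i(2) ml(1) mult_strict_right_mono[of 1 m "\<bar>l i\<bar>"] by simp
      then show "\<exists>j\<in>{..<n}. nat \<bar>l j\<bar> < nat \<bar>k j\<bar>" using i by (intro bexI[of _ i]) auto
    qed simp
    then obtain m' l' where "m' \<ge> 1" "iprim n l'" "l = imul n m' l'"
      using less.hyps[OF _ ml(2) l0] by blast
    moreover have "m * m' \<ge> 1" using ml(1) \<open>m' \<ge> 1\<close> mult_mono[of 1 m 1 m'] by simp
    ultimately show ?thesis using ml(3) by (auto simp: imul_imul intro!: exI[of _ "m * m'"])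
  qed
qed

section \<open>Coordinates and norms of lattice vectors\<close>

lemma lvec_imul:
  assumes "A \<in> carrier_mat n n"
  shows "lvec A (imul n m k) = real_of_int m \<cdot>\<^sub>v lvec A k"
  using assms by (intro eq_vecI) (auto simp: lvec_def imul_def sum_distrib_left mult.assoc)

lemma vnorm_smult: "vnorm (a \<cdot>\<^sub>v v) = \<bar>a\<bar> * vnorm v"
proof -
  have "(\<Sum>j<dim_vec v. ((a \<cdot>\<^sub>v v) $ j)\<^sup>2) = a\<^sup>2 * (\<Sum>j<dim_vec v. (v $ j)\<^sup>2)"
    unfolding sum_distrib_left by (rule sum.cong) (auto simp: power_mult_distrib)
  then show ?thesis by (simp add: vnorm_eq_L2_set L2_set_def real_sqrt_mult)
qed

lemma lvec_coord:
  assumes A: "A \<in> SL n" and l: "l < n"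
  shows "real_of_int (k l) = (\<Sum>j<n. lvec A k $ j * adj_mat A $$ (j,l))"
proof -
  have cA: "A \<in> carrier_mat n n" and cB: "adj_mat A \<in> carrier_mat n n"
    using A SL_adj(1)[OF A] by (auto simp: SL_def)
  have "(\<Sum>j<n. lvec A k $ j * adj_mat A $$ (j,l)) = (\<Sum>j<n. (\<Sum>i<n. k i * A $$ (i,j)) * adj_mat A $$ (j,l))"
    using A by (intro sum.cong) (auto simp: lvec_def)
  also have "\<dots> = (\<Sum>i<n. k i * (\<Sum>j<n. A $$ (i,j) * adj_mat A $$ (j,l)))"
    unfolding sum_distrib_left sum_distrib_right mult.assoc by (rule sum.swap)
  also have "\<dots> = (\<Sum>i<n. k i * (A * adj_mat A) $$ (i,l))"
    by (intro sum.cong arg_cong2[of _ _ _ _ "(*)"] mat_mult_entry[OF cA cB _ l, symmetric]) auto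
  also have "\<dots> = (\<Sum>i<n. if i = l then real_of_int (k l) else 0)"
    unfolding SL_adj(2)[OF A] using l by (intro sum.cong) auto
  finally show ?thesis using l by simp
qed

lemma vec_index_le_vnorm: "j < dim_vec v \<Longrightarrow> \<bar>v $ j\<bar> \<le> vnorm v"
proof -
  assume j: "j < dim_vec v"
  have "\<bar>v $ j\<bar> = sqrt ((v $ j)\<^sup>2)" by simp
  also have "\<dots> \<le> vnorm v"
    unfolding vnorm_eq_L2_set L2_set_def using j
    by (intro real_sqrt_le_mono member_le_sum[of j "{..<dim_vec v}" "\<lambda>i. (v $ i)\<^sup>2"]) auto
  finally show ?thesis .
qed

text \<open>The inverse matrix recovers the coefficients, so short vectors have small coefficients.
  The summand 1 keeps the factor positive for later division.\<close>

lemma coord_le_vnorm: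
  assumes A: "A \<in> SL n" and l: "l < n"
  shows "\<bar>real_of_int (k l)\<bar> \<le> vnorm (lvec A k) * (mnorm n (adj_mat A) + 1)"
proof -
  have "\<bar>real_of_int (k l)\<bar> \<le> (\<Sum>j<n. \<bar>lvec A k $ j * adj_mat A $$ (j,l)\<bar>)"
    unfolding lvec_coord[OF A l] by (rule sum_abs)
  also have "\<dots> \<le> (\<Sum>j<n. vnorm (lvec A k) * (\<Sum>l<n. \<bar>adj_mat A $$ (j,l)\<bar>))"
  proof (rule sum_mono)
    fix j assume j: "j \<in> {..<n}"
    have "\<bar>lvec A k $ j\<bar> \<le> vnorm (lvec A k)" using A j by (intro vec_index_le_vnorm) auto
    moreover have "\<bar>adj_mat A $$ (j,l)\<bar> \<le> (\<Sum>l<n. \<bar>adj_mat A $$ (j,l)\<bar>)"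
      using l by (intro member_le_sum) auto
    ultimately show "\<bar>lvec A k $ j * adj_mat A $$ (j,l)\<bar> \<le> vnorm (lvec A k) * (\<Sum>l<n. \<bar>adj_mat A $$ (j,l)\<bar>)"
      unfolding abs_mult by (intro mult_mono) (auto simp: vnorm_nonneg)
  qed
  also have "\<dots> = vnorm (lvec A k) * mnorm n (adj_mat A)"
    by (simp add: mnorm_def sum_distrib_left)
  also have "\<dots> \<le> vnorm (lvec A k) * (mnorm n (adj_mat A) + 1)"
    by (intro mult_left_mono) (auto simp: vnorm_nonneg)
  finally show ?thesis .
qed

lemma vnorm_lvec_lower:
  assumes A: "A \<in> SL n" and k: "k \<in> int_vecs n" "k \<noteq> zvec n"
  shows "vnorm (lvec A k) \<ge> 1 / (mnorm n (adj_mat A) + 1)"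
proof -
  obtain l where l: "l < n" "k l \<noteq> 0" using nonzero_coord[OF k] by blast
  then have "1 \<le> \<bar>real_of_int (k l)\<bar>" by simp
  also have "\<dots> \<le> vnorm (lvec A k) * (mnorm n (adj_mat A) + 1)" by (rule coord_le_vnorm[OF A l(1)])
  finally show ?thesis using mnorm_nonneg[of n "adj_mat A"] by (simp add: field_simps)
qed

lemma inj_lvec: "A \<in> SL n \<Longrightarrow> inj_on (lvec A) (int_vecs n)"
proof (rule inj_onI)
  fix k l assume A: "A \<in> SL n" and kl: "k \<in> int_vecs n" "l \<in> int_vecs n" "lvec A k = lvec A l"
  have "k i = l i" if "i < n" for i
    using lvec_coord[OF A that, of k] lvec_coord[OF A that, of l] kl(3) by simp
  then show "k = l" using kl by (intro int_vecs_eqI)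
qed

lemma lvec_zvec: "A \<in> carrier_mat n n \<Longrightarrow> lvec A (zvec n) = 0\<^sub>v n"
  by (intro eq_vecI) (auto simp: lvec_def zvec_def)

lemma lvec_eq_0_iff: "A \<in> SL n \<Longrightarrow> k \<in> int_vecs n \<Longrightarrow> lvec A k = 0\<^sub>v n \<longleftrightarrow> k = zvec n"
  using inj_on_eq_iff[OF inj_lvec, of A n k "zvec n"] lvec_zvec[OF SL_carrier, of A n] by simp

section \<open>Counting lattice vectors and primitive vectors\<close>

definition nz_points :: "nat \<Rightarrow> real mat \<Rightarrow> real \<Rightarrow> (nat \<Rightarrow> int) set" where
  "nz_points n A t = {k \<in> int_vecs n. k \<noteq> zvec n \<and> vnorm (lvec A k) \<le> t}"

definition pos_points :: "nat \<Rightarrow> real mat \<Rightarrow> real \<Rightarrow> (nat \<Rightarrow> int) set" where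
  "pos_points n A t = {k \<in> int_vecs n. ipos n k \<and> vnorm (lvec A k) \<le> t}"

definition prim_points :: "nat \<Rightarrow> real mat \<Rightarrow> real \<Rightarrow> (nat \<Rightarrow> int) set" where
  "prim_points n A t = {k. iprim n k \<and> ipos n k \<and> vnorm (lvec A k) \<le> t}"

lemma nz_points_subset: "nz_points n A t \<subseteq> lattice_points n A t"
  by (auto simp: nz_points_def lattice_points_def)

lemma pos_points_subset: "pos_points n A t \<subseteq> nz_points n A t"
  using ipos_nonzero by (auto simp: pos_points_def nz_points_def)

lemma prim_points_subset: "prim_points n A t \<subseteq> pos_points n A t"
  by (auto simp: prim_points_def pos_points_def iprim_def)

lemma lattice_points_neg: "t < 0 \<Longrightarrow> lattice_points n A t = {}"
  using vnorm_nonneg by (auto simp: lattice_points_def not_le intro: less_le_trans)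

lemma finite_lattice_points: "A \<in> SL n \<Longrightarrow> finite (lattice_points n A t)"
  by (cases "t \<ge> 0") (auto intro: lattice_points_upper(1) simp: lattice_points_neg)

lemma finite_nz_points: "A \<in> SL n \<Longrightarrow> finite (nz_points n A t)"
  using finite_subset[OF nz_points_subset finite_lattice_points] .

lemma finite_pos_points: "A \<in> SL n \<Longrightarrow> finite (pos_points n A t)"
  using finite_subset[OF pos_points_subset finite_nz_points] .

lemma finite_prim_points: "A \<in> SL n \<Longrightarrow> finite (prim_points n A t)"
  using finite_subset[OF prim_points_subset finite_pos_points] .

lemma card_nz_points:
  assumes A: "A \<in> SL n" and t: "t \<ge> 0"
  shows "card (lattice_points n A t) = card (nz_points n A t) + 1"
proof -
  have "vnorm (lvec A (zvec n)) = 0"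
    using lvec_zvec[OF SL_carrier[OF A]] by (simp add: vnorm_eq_L2_set L2_set_def)
  then have "lattice_points n A t = insert (zvec n) (nz_points n A t)"
    using t by (auto simp: lattice_points_def nz_points_def)
  moreover have "zvec n \<notin> nz_points n A t" by (simp add: nz_points_def)
  ultimately show ?thesis using finite_nz_points[OF A] by simp
qed

lemma card_nz_pos:
  assumes A: "A \<in> SL n"
  shows "card (nz_points n A t) = 2 * card (pos_points n A t)"
proof -
  have cA: "A \<in> carrier_mat n n" using A by (rule SL_carrier)
  have neg: "vnorm (lvec A (imul n (-1) k)) = vnorm (lvec A k)" for k
    by (simp add: lvec_imul[OF cA] vnorm_smult)
  define N where "N = imul n (-1) ` pos_points n A t"
  have "nz_points n A t = pos_points n A t \<union> N"
  proof (intro equalityI subsetI)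
    fix k assume k: "k \<in> nz_points n A t"
    show "k \<in> pos_points n A t \<union> N"
    proof (cases "ipos n k")
      case True
      then show ?thesis using k by (auto simp: pos_points_def nz_points_def)
    next
      case False
      then have "imul n (-1) k \<in> pos_points n A t"
        using k ipos_neg[of k n] by (auto simp: pos_points_def nz_points_def neg)
      moreover have "k = imul n (-1) (imul n (-1) k)"
        using k imul_one[of k n] by (simp add: imul_imul nz_points_def)
      ultimately show ?thesis unfolding N_def by blast
    qed
  next
    fix k assume "k \<in> pos_points n A t \<union> N"
    then show "k \<in> nz_points n A t"
      using pos_points_subset[of n A t]
      by (auto simp: N_def nz_points_def pos_points_def neg imul_zvec_iff)
  qed
  moreover have "pos_points n A t \<inter> N = {}"
    using ipos_neg ipos_nonzero by (auto simp: N_def pos_points_def)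
  moreover have "card N = card (pos_points n A t)"
    unfolding N_def by (rule card_image, rule inj_on_subset[OF inj_imul]) (auto simp: pos_points_def)
  ultimately show ?thesis
    using finite_pos_points[OF A, of t] by (simp add: card_Un_disjoint N_def)
qed

lemma nz_points_asymp:
  assumes A: "A \<in> SL n" and n: "n > 0"
  shows "((\<lambda>t. real (card (nz_points n A t)) / t ^ n) \<longlongrightarrow> unit_ball_vol (real n)) at_top"
proof -
  have "((\<lambda>t::real. 1 / t ^ n) \<longlongrightarrow> 0) at_top"
    by (intro real_tendsto_divide_at_top[OF tendsto_const] filterlim_pow_at_top n filterlim_ident)
  from tendsto_diff[OF lattice_points_asymp[OF A] this]
  have "((\<lambda>t. real (card (lattice_points n A t)) / t ^ n - 1 / t ^ n) \<longlongrightarrow> unit_ball_vol (real n)) at_top" by simp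
  moreover have "\<forall>\<^sub>F t in at_top. real (card (lattice_points n A t)) / t ^ n - 1 / t ^ n = real (card (nz_points n A t)) / t ^ n"
    using eventually_ge_at_top[of 0]
    by eventually_elim (simp add: card_nz_points[OF A] add_divide_distrib)
  ultimately show ?thesis by (rule Lim_transform_eventually)
qed

text \<open>In contrast to the asymptotics, one constant serves all t > 0, as is required of a
  majorant for interchanging a limit with an infinite sum. For t below 1 / C there are no nonzero
  vectors, and above it the error radius d is at most C d t.\<close>

lemma nz_points_bound:
  assumes A: "A \<in> SL n"
  obtains K where "K \<ge> 0" "\<And>t. t > 0 \<Longrightarrow> real (card (nz_points n A t)) \<le> K * t ^ n"
proof -
  define d where "d = mnorm n A + 1"
  define C where "C = mnorm n (adj_mat A) + 1"
  have d: "d > 0" and C: "C > 0"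
    using mnorm_nonneg[of n A] mnorm_nonneg[of n "adj_mat A"] by (auto simp: d_def C_def)
  define K where "K = unit_ball_vol (real n) * (1 + C * d) ^ n"
  have "real (card (nz_points n A t)) \<le> K * t ^ n" if t: "t > 0" for t
  proof (cases "t \<ge> 1 / C")
    case True
    have "real (card (nz_points n A t)) \<le> real (card (lattice_points n A t))"
      using card_nz_points[OF A, of t] t by simp
    also have "\<dots> \<le> unit_ball_vol (real n) * (t + d) ^ n"
      using lattice_points_upper(2)[OF A, of t] t by (simp add: d_def)
    also have "t + d \<le> (1 + C * d) * t"
    proof -
      have "1 \<le> C * t" using True C by (simp add: field_simps)
      then have "d * 1 \<le> d * (C * t)" using d by (intro mult_left_mono) auto
      then show ?thesis by (simp add: algebra_simps)
    qed
    then have "unit_ball_vol (real n) * (t + d) ^ n \<le> unit_ball_vol (real n) * ((1 + C * d) * t) ^ n"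
      using t d by (intro mult_left_mono power_mono) auto
    also have "\<dots> = K * t ^ n" by (simp add: K_def power_mult_distrib)
    finally show ?thesis by simp
  next
    case False
    have "nz_points n A t = {}"
      using vnorm_lvec_lower[OF A] False by (force simp: nz_points_def C_def)
    then show ?thesis using t C d by (simp add: K_def)
  qed
  moreover have "K \<ge> 0" using C d by (simp add: K_def)
  ultimately show thesis using that by blast
qed

text \<open>A vector that is not primitive is m times another one with m \<ge> 2, hence comes from
  the ball of radius t / m; the summation index is m - 2. Since nonzero vectors have norm at least 1
  / (mnorm + 1) for the inverse basis, only finitely many m occur, which \<open>M\<close>
  bounds.\<close>

lemma pos_points_le:
  assumes A: "A \<in> SL n" and t: "t > 0"
    and M: "t * (mnorm n (adj_mat A) + 1) \<le> real M"
  shows "card (pos_points n A t) \<le> card (prim_points n A t) + (\<Sum>m<M. card (pos_points n A (t / real (m + 2))))"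
proof -
  have cA: "A \<in> carrier_mat n n" using A by (rule SL_carrier)
  have sub: "pos_points n A t \<subseteq> prim_points n A t \<union> (\<Union>m<M. imul n (int (m + 2)) ` pos_points n A (t / real (m + 2)))"
  proof
    fix k assume k: "k \<in> pos_points n A t"
    then have k': "k \<in> int_vecs n" "ipos n k" "vnorm (lvec A k) \<le> t" "k \<noteq> zvec n"
      using pos_points_subset by (auto simp: pos_points_def nz_points_def)
    obtain m l where ml: "m \<ge> 1" "iprim n l" "k = imul n m l"
      using primitive_decomposition[OF k'(1,4)] by blast
    have l: "l \<in> int_vecs n" "l \<noteq> zvec n" "ipos n l" using ml k'(2) ipos_imul[of m n l] by (auto simp: iprim_def)
    have norm: "vnorm (lvec A k) = real_of_int m * vnorm (lvec A l)"
      using ml by (simp add: lvec_imul[OF cA] vnorm_smult)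
    show "k \<in> prim_points n A t \<union> (\<Union>m<M. imul n (int (m + 2)) ` pos_points n A (t / real (m + 2)))"
    proof (cases "m = 1")
      case True
      then show ?thesis using ml k' imul_one[OF l(1)] by (auto simp: prim_points_def)
    next
      case False
      define j where "j = nat (m - 2)"
      have j: "m = int (j + 2)" using False ml(1) by (simp add: j_def)
      have pos: "mnorm n (adj_mat A) + 1 > 0" using mnorm_nonneg[of n "adj_mat A"] by simp
      have "real_of_int m * (1 / (mnorm n (adj_mat A) + 1)) \<le> real_of_int m * vnorm (lvec A l)"
        using vnorm_lvec_lower[OF A l(1,2)] ml(1) by (intro mult_left_mono) auto
      also have "\<dots> \<le> t" using norm k'(3) by simp
      finally have "real_of_int m \<le> t * (mnorm n (adj_mat A) + 1)" using pos by (simp add: field_simps)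
      then have "j < M" using M j by simp
      moreover have "l \<in> pos_points n A (t / real (j + 2))"
        using l norm k'(3) j by (simp add: pos_points_def field_simps)
      ultimately show ?thesis using ml(3) j by auto
    qed
  qed
  have "card (pos_points n A t) \<le> card (prim_points n A t \<union> (\<Union>m<M. imul n (int (m + 2)) ` pos_points n A (t / real (m + 2))))"
    by (rule card_mono[OF _ sub]) (auto intro: finite_prim_points[OF A] finite_pos_points[OF A])
  also have "\<dots> \<le> card (prim_points n A t) + card (\<Union>m<M. imul n (int (m + 2)) ` pos_points n A (t / real (m + 2)))"
    by (rule card_Un_le)
  also have "card (\<Union>m<M. imul n (int (m + 2)) ` pos_points n A (t / real (m + 2)))
      \<le> (\<Sum>m<M. card (imul n (int (m + 2)) ` pos_points n A (t / real (m + 2))))"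
    by (rule card_UN_le) simp
  also have "\<dots> \<le> (\<Sum>m<M. card (pos_points n A (t / real (m + 2))))"
    by (intro sum_mono card_image_le finite_pos_points[OF A])
  finally show ?thesis by simp
qed

text \<open>For n \<ge> 3 one has (m + 2)^n \<ge> 2 (m + 1) (m + 2), so the terms are at most half
  of those of a telescoping series with sum 1.\<close>

lemma sum_inverse_powers:
  assumes n: "n \<ge> 3"
  shows "summable (\<lambda>m. 1 / real (m + 2) ^ n)" and "(\<Sum>m. 1 / real (m + 2) ^ n) \<le> 1 / 2"
proof -
  have le: "1 / real (m + 2) ^ n \<le> 1 / 2 * (1 / real (m + 1) - 1 / real (Suc m + 1))" for m
  proof -
    have "2 * (real (m + 1) * real (m + 2)) \<le> real (m + 2) * (real (m + 2) * real (m + 2))"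
      by (intro mult_mono) auto
    also have "\<dots> = real (m + 2) ^ 3" by (simp add: power3_eq_cube mult.assoc)
    also have "\<dots> \<le> real (m + 2) ^ n" using n by (intro power_increasing) auto
    finally have "1 / real (m + 2) ^ n \<le> 1 / (2 * (real (m + 1) * real (m + 2)))"
      by (intro divide_left_mono mult_pos_pos) auto
    also have "\<dots> = 1 / 2 * (1 / real (m + 1) - 1 / real (Suc m + 1))"
      by (simp add: field_simps)
    finally show ?thesis .
  qed
  have "(\<lambda>m. 1 / real (m + 1)) \<longlonglongrightarrow> 0"
    using LIMSEQ_inverse_real_of_nat by (simp add: inverse_eq_divide)
  from telescope_sums'[OF this]
  have "(\<lambda>m. 1 / real (m + 1) - 1 / real (Suc m + 1)) sums 1" by simp
  from sums_mult[OF this, of "1/2"]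
  have s: "(\<lambda>m. 1 / 2 * (1 / real (m + 1) - 1 / real (Suc m + 1))) sums (1 / 2)" by simp
  show sm: "summable (\<lambda>m. 1 / real (m + 2) ^ n)"
    by (rule summable_comparison_test'[OF sums_summable[OF s], of 0]) (use le in auto)
  have "(\<Sum>m. 1 / real (m + 2) ^ n) \<le> (\<Sum>m. 1 / 2 * (1 / real (m + 1) - 1 / real (Suc m + 1)))"
    by (rule suminf_le[OF le sm sums_summable[OF s]])
  then show "(\<Sum>m. 1 / real (m + 2) ^ n) \<le> 1 / 2" using sums_unique[OF s] by simp
qed

text \<open>At least the fraction \<open>1 - (\<Sum>m\<ge>2. m^-n) \<ge> 1/2\<close> remains after discarding the
  multiples of shorter vectors.\<close>

lemma prim_points_asymp:
  assumes A: "A \<in> SL n" and n: "n \<ge> 3"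
  shows "\<forall>\<^sub>F t in at_top. unit_ball_vol (real n) / 5 * t ^ n \<le> real (card (prim_points n A t))"
proof -
  define V where "V = unit_ball_vol (real n)"
  have V: "V > 0" by (simp add: V_def)
  define z where "z t = real (card (pos_points n A t))" for t
  have zn: "z t = real (card (nz_points n A t)) / 2" for t
    by (simp add: z_def card_nz_pos[OF A])
  have zlim: "((\<lambda>t. z t / t ^ n) \<longlongrightarrow> V / 2) at_top"
    using tendsto_divide[OF nz_points_asymp[OF A] tendsto_const[of 2]] n by (simp add: zn V_def mult.commute)
  obtain K where K: "K \<ge> 0" "\<And>t. t > 0 \<Longrightarrow> real (card (nz_points n A t)) \<le> K * t ^ n"
    using nz_points_bound[OF A] by blast
  define a where "a m t = z (t / real (m + 2)) / t ^ n" for m t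
  define b where "b m = V / 2 * (1 / real (m + 2) ^ n)" for m
  have lim: "((\<lambda>t. a m t) \<longlongrightarrow> b m) at_top" for m
  proof -
    have "filterlim (\<lambda>t::real. t * (1 / real (m + 2))) at_top at_top"
      by (intro filterlim_at_top_mult_tendsto_pos[OF tendsto_const _ filterlim_ident]) auto
    then have "((\<lambda>t. z (t / real (m + 2)) / (t / real (m + 2)) ^ n) \<longlongrightarrow> V / 2) at_top"
      using filterlim_compose[OF zlim] by simp
    from tendsto_mult[OF this tendsto_const[of "1 / real (m + 2) ^ n"]]
    have "((\<lambda>t. z (t / real (m + 2)) / (t / real (m + 2)) ^ n * (1 / real (m + 2) ^ n)) \<longlongrightarrow> b m) at_top"
      by (simp add: b_def)
    then show ?thesis by (simp add: a_def power_divide)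
  qed
  have bound: "a m t \<le> K / 2 * (1 / real (m + 2) ^ n)" if t: "t > 0" for m t
  proof -
    have "z (t / real (m + 2)) \<le> K / 2 * (t / real (m + 2)) ^ n"
      using K(2)[of "t / real (m + 2)"] t by (simp add: zn)
    then have "a m t \<le> K / 2 * (t / real (m + 2)) ^ n / t ^ n"
      unfolding a_def using t by (intro divide_right_mono) auto
    also have "\<dots> = K / 2 * (1 / real (m + 2) ^ n)" using t by (simp add: power_divide)
    finally show ?thesis .
  qed
  have a0: "a m t \<ge> 0" if "t > 0" for m t using that by (simp add: a_def z_def)
  have smK: "summable (\<lambda>m. K / 2 * (1 / real (m + 2) ^ n))"
    by (intro summable_mult sum_inverse_powers(1)[OF n])
  \<comment> \<open>The majorant does not depend on t, so Tannery's theorem allows the limits of the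
    single terms to be summed.\<close>
  have "eventually (\<lambda>(m,t). norm (a m t) \<le> K / 2 * (1 / real (m + 2) ^ n)) (at_top \<times>\<^sub>F at_top)"
    using eventually_prodI[OF always_eventually[of "\<lambda>_. True"] eventually_gt_at_top[of "0::real"]]
    by (rule eventually_mono) (use bound a0 in auto)
  from tannerys_theorem[OF lim this smK]
  have suminf_lim: "((\<lambda>t. \<Sum>m. a m t) \<longlongrightarrow> (\<Sum>m. b m)) at_top" by simp
  \<comment> \<open>V / 2 for all vectors up to sign, minus at most V / 4 for the multiples, leaves
    V / 4; the smaller constant V / 5 makes the inequality strict and hence valid
    eventually.\<close>
  have sb: "(\<Sum>m. b m) \<le> V / 4"
    using sum_inverse_powers[OF n] V mult_left_mono[of "\<Sum>m. 1 / real (m + 2) ^ n" "1/2" "V / 2"]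
    unfolding b_def by (subst suminf_mult) auto
  have "((\<lambda>t. z t / t ^ n - (\<Sum>m. a m t)) \<longlongrightarrow> V / 2 - (\<Sum>m. b m)) at_top"
    by (intro tendsto_diff zlim suminf_lim)
  moreover have "V / 5 < V / 2 - (\<Sum>m. b m)" using sb V by simp
  ultimately have "\<forall>\<^sub>F t in at_top. V / 5 < z t / t ^ n - (\<Sum>m. a m t)" by (rule order_tendstoD)
  then show ?thesis
    using eventually_gt_at_top[of 0]
  proof eventually_elim
    case (elim t)
    obtain M :: nat where M: "t * (mnorm n (adj_mat A) + 1) \<le> real M" using real_arch_simple by blast
    have sm: "summable (\<lambda>m. a m t)"
      by (rule summable_comparison_test'[OF smK, of 0]) (use a0 bound elim in auto)
    have "real (card (pos_points n A t)) \<le> real (card (prim_points n A t)) + (\<Sum>m<M. z (t / real (m + 2)))"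
      unfolding z_def of_nat_sum[symmetric] of_nat_add[symmetric] of_nat_le_iff
      by (rule pos_points_le[OF A elim(2) M])
    also have "(\<Sum>m<M. z (t / real (m + 2))) = (\<Sum>m<M. a m t) * t ^ n"
      using elim(2) by (simp add: a_def sum_distrib_right)
    also have "(\<Sum>m<M. a m t) \<le> (\<Sum>m. a m t)"
      using sm a0 elim(2) by (intro sum_le_suminf) auto
    finally have "z t \<le> real (card (prim_points n A t)) + (\<Sum>m. a m t) * t ^ n"
      using elim(2) by (simp add: z_def)
    moreover have "V / 5 * t ^ n < (z t / t ^ n - (\<Sum>m. a m t)) * t ^ n"
      using elim by (intro mult_strict_right_mono) auto
    then have "V / 5 * t ^ n < z t - (\<Sum>m. a m t) * t ^ n"
      using elim(2) by (simp add: left_diff_distrib)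
    ultimately show ?case by (simp add: V_def)
  qed
qed

section \<open>Counting modulo a prime\<close>

lemma idot_remove:
  "j < n \<Longrightarrow> idot n x k = x j * k j + (\<Sum>i\<in>{..<n}-{j}. x i * k i)"
  unfolding idot_def by (subst sum.remove[of _ j]) auto

lemma residue_eqI:
  assumes "0 \<le> a" "a < int p" "0 \<le> b" "b < int p" "int p dvd a - b"
  shows "a = b"
proof (rule ccontr)
  assume "a \<noteq> b"
  then have "\<bar>a - b\<bar> > 0" "\<bar>a - b\<bar> < int p" using assms by auto
  moreover have "int p dvd \<bar>a - b\<bar>" using assms by simp
  ultimately show False using zdvd_imp_le[of "int p" "\<bar>a - b\<bar>"] by simp
qed

text \<open>Since \<open>k j\<close> is a unit modulo p, the other coordinates of x are free and
  determine x_j.\<close>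

lemma card_residues_orthogonal:
  assumes p: "prime p" and j: "j < n" "\<not> int p dvd k j"
  shows "card {x \<in> residues p n. int p dvd idot n x k} = p ^ (n - 1)"
proof -
  define J where "J = {..<n} - {j}"
  define R where "R = (J \<rightarrow>\<^sub>E {0..<int p})"
  have pp: "int p > 0" using prime_gt_0_nat[OF p] by simp
  have dot: "idot n x k = x j * k j + (\<Sum>i\<in>J. x i * k i)" for x
    unfolding J_def by (rule idot_remove[OF j(1)])
  obtain u where u: "int p dvd k j * u - 1" using ex_mod_inverse[OF p j(2)] .
  have "bij_betw (\<lambda>x. restrict x J) {x \<in> residues p n. int p dvd idot n x k} R"
    unfolding bij_betw_def
  proof
    show "inj_on (\<lambda>x. restrict x J) {x \<in> residues p n. int p dvd idot n x k}"
    proof (rule inj_onI)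
      fix x y assume x: "x \<in> {x \<in> residues p n. int p dvd idot n x k}"
        and y: "y \<in> {x \<in> residues p n. int p dvd idot n x k}" and eq: "restrict x J = restrict y J"
      have J: "x i = y i" if "i \<in> J" for i using fun_cong[OF eq, of i] that by simp
      have "(\<Sum>i\<in>J. x i * k i) = (\<Sum>i\<in>J. y i * k i)" using J by (intro sum.cong) auto
      then have "idot n x k - idot n y k = (x j - y j) * k j" by (simp add: dot algebra_simps)
      moreover have "int p dvd idot n x k - idot n y k" using x y by auto
      ultimately have "int p dvd (x j - y j) * k j" by simp
      then have "int p dvd x j - y j" using p j(2) prime_dvd_mult_iff[of "int p"] by auto
      then have "x j = y j" using x y j(1) by (intro residue_eqI[of _ p]) (auto simp: residues_def PiE_iff)
      then have "\<And>i. i \<in> {..<n} \<Longrightarrow> x i = y i" using J by (auto simp: J_def)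
      then show "x = y" using x y by (intro PiE_ext[of x "{..<n}" "\<lambda>_. {0..<int p}" y]) (auto simp: residues_def)
    qed
    show "(\<lambda>x. restrict x J) ` {x \<in> residues p n. int p dvd idot n x k} = R"
    proof (intro equalityI subsetI)
      fix y assume "y \<in> (\<lambda>x. restrict x J) ` {x \<in> residues p n. int p dvd idot n x k}"
      then obtain x where "x \<in> residues p n" "y = restrict x J" by blast
      then show "y \<in> R" unfolding R_def residues_def J_def by (simp add: PiE_iff)
    next
      fix y assume y: "y \<in> R"
      define S where "S = (\<Sum>i\<in>J. y i * k i)"
      define x where "x = y(j := (- u * S) mod int p)"
      have "x \<in> residues p n"
        using y pp j(1) by (auto simp: x_def R_def J_def residues_def PiE_iff extensional_def)
      moreover have "int p dvd idot n x k"
      proof -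
        have "(\<Sum>i\<in>J. x i * k i) = S" unfolding S_def by (rule sum.cong) (auto simp: x_def J_def)
        then have e: "idot n x k = ((- u * S) mod int p) * k j + S" by (simp add: dot x_def)
        have "int p dvd (- u * S) * k j + S"
        proof -
          have e: "(- u * S) * k j + S = (k j * u - 1) * (- S)" by (simp add: algebra_simps)
          show ?thesis unfolding e using u by (rule dvd_mult2)
        qed
        moreover have "(((- u * S) mod int p) * k j + S) mod int p = ((- u * S) * k j + S) mod int p"
          by (metis mod_add_left_eq mod_mult_left_eq)
        ultimately show ?thesis unfolding e by (simp add: dvd_eq_mod_eq_0)
      qed
      moreover have "restrict x J = y"
        using y by (auto simp: x_def R_def J_def PiE_iff extensional_def fun_eq_iff)
      ultimately show "y \<in> (\<lambda>x. restrict x J) ` {x \<in> residues p n. int p dvd idot n x k}" by blast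
    qed
  qed
  then have "card {x \<in> residues p n. int p dvd idot n x k} = card R" by (rule bij_betw_same_card)
  also have "\<dots> = p ^ (n - 1)" unfolding R_def using j(1) by (subst card_PiE) (auto simp: J_def)
  finally show ?thesis .
qed

text \<open>As in Cramer's rule, a minor that is a unit modulo p makes the two congruences determine
  coordinates \<open>i\<close> and \<open>j\<close> from the others. Injectivity of forgetting these
  two coordinates gives the upper bound.\<close>

lemma card_residues_orthogonal2:
  assumes p: "prime p" and ij: "i < n" "j < n" "\<not> int p dvd k i * l j - k j * l i"
  shows "card {x \<in> residues p n. int p dvd idot n x k \<and> int p dvd idot n x l} \<le> p ^ (n - 2)"
proof -
  have ne: "i \<noteq> j" using ij(3) by (auto simp: mult.commute)
  define J where "J = {..<n} - {i} - {j}"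
  define S where "S = {x \<in> residues p n. int p dvd idot n x k \<and> int p dvd idot n x l}"
  have dot: "idot n x m = x i * m i + (x j * m j + (\<Sum>i\<in>J. x i * m i))" for x m
    unfolding idot_remove[OF ij(1)] J_def using ij ne by (subst sum.remove[of _ j]) auto
  have inj: "inj_on (\<lambda>x. restrict x J) S"
  proof (rule inj_onI)
    fix x y assume x: "x \<in> S" and y: "y \<in> S" and eq: "restrict x J = restrict y J"
    have J: "x q = y q" if "q \<in> J" for q using fun_cong[OF eq, of q] that by simp
    define a b where "a = x i - y i" and "b = x j - y j"
    have d: "idot n x m - idot n y m = a * m i + b * m j" for m
    proof -
      have "(\<Sum>i\<in>J. x i * m i) = (\<Sum>i\<in>J. y i * m i)" using J by (intro sum.cong) auto
      then show ?thesis by (simp add: dot a_def b_def algebra_simps)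
    qed
    have k: "int p dvd a * k i + b * k j" and l: "int p dvd a * l i + b * l j"
      unfolding d[symmetric] using x y by (auto simp: S_def)
    have "a * (k i * l j - k j * l i) = (a * k i + b * k j) * l j - (a * l i + b * l j) * k j"
      by (simp add: algebra_simps)
    then have "int p dvd a * (k i * l j - k j * l i)" using k l by simp
    then have "int p dvd a" using p ij(3) prime_dvd_mult_iff[of "int p"] by auto
    moreover have "b * (k i * l j - k j * l i) = (a * l i + b * l j) * k i - (a * k i + b * k j) * l i"
      by (simp add: algebra_simps)
    then have "int p dvd b * (k i * l j - k j * l i)" using k l by simp
    then have "int p dvd b" using p ij(3) prime_dvd_mult_iff[of "int p"] by auto
    ultimately have "x i = y i" "x j = y j"
      using x y ij unfolding a_def b_def
      by (auto intro!: residue_eqI[of _ p] simp: S_def residues_def PiE_iff)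
    then have "\<And>q. q \<in> {..<n} \<Longrightarrow> x q = y q" using J by (auto simp: J_def)
    then show "x = y" using x y by (intro PiE_ext[of x "{..<n}" "\<lambda>_. {0..<int p}" y]) (auto simp: residues_def S_def)
  qed
  have "card S \<le> card (J \<rightarrow>\<^sub>E {0..<int p})"
  proof (rule card_inj_on_le[OF inj])
    show "(\<lambda>x. restrict x J) ` S \<subseteq> J \<rightarrow>\<^sub>E {0..<int p}"
      unfolding S_def residues_def J_def by (rule image_subsetI) (simp add: PiE_iff)
    show "finite (J \<rightarrow>\<^sub>E {0..<int p})" by (intro finite_PiE) (auto simp: J_def)
  qed
  also have "\<dots> = p ^ (n - 2)"
    using ij ne by (subst card_PiE) (auto simp: J_def card_Diff_singleton numeral_2_eq_2)
  finally show ?thesis by (simp add: S_def)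
qed

lemma nz_residues_Collect:
  assumes "p > 0" "P (\<lambda>i\<in>{..<n}. 0)"
  shows "card {x \<in> nz_residues p n. P x} = card {x \<in> residues p n. P x} - 1"
proof -
  have z: "(\<lambda>i\<in>{..<n}. 0) \<in> residues p n" using assms by (auto simp: residues_def)
  have "{x \<in> nz_residues p n. P x} = {x \<in> residues p n. P x} - {\<lambda>i\<in>{..<n}. 0}"
    by (auto simp: nz_residues_def)
  then show ?thesis using z assms(2) by (simp add: card_Diff_singleton)
qed

lemma idot_zero: "idot n (\<lambda>i\<in>{..<n}. 0) k = 0"
  by (simp add: idot_def)

lemma card_nz_residues_orthogonal:
  assumes p: "prime p" and k: "\<not> (\<forall>i<n. int p dvd k i)"
  shows "real (card {x \<in> nz_residues p n. int p dvd idot n x k}) = real p ^ (n - 1) - 1"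
proof -
  obtain j where j: "j < n" "\<not> int p dvd k j" using k by blast
  have "card {x \<in> nz_residues p n. int p dvd idot n x k} = p ^ (n - 1) - 1"
    using nz_residues_Collect[of p "\<lambda>x. int p dvd idot n x k" n] prime_gt_0_nat[OF p]
      card_residues_orthogonal[where k = k, OF p j] by (simp add: idot_zero)
  moreover have "p ^ (n - 1) \<ge> 1" using prime_gt_0_nat[OF p] by simp
  ultimately show ?thesis by (simp add: of_nat_diff)
qed

lemma card_nz_residues_orthogonal2:
  assumes p: "prime p" and ij: "i < n" "j < n" "\<not> int p dvd k i * l j - k j * l i"
  shows "real (card {x \<in> nz_residues p n. int p dvd idot n x k \<and> int p dvd idot n x l}) \<le> real p ^ (n - 2) - 1"
proof -
  have "card {x \<in> nz_residues p n. int p dvd idot n x k \<and> int p dvd idot n x l} \<le> p ^ (n - 2) - 1"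
    using nz_residues_Collect[of p "\<lambda>x. int p dvd idot n x k \<and> int p dvd idot n x l" n] prime_gt_0_nat[OF p]
      card_residues_orthogonal2[where k = k and l = l, OF p ij] by (simp add: idot_zero)
  moreover have "p ^ (n - 2) \<ge> 1" using prime_gt_0_nat[OF p] by simp
  ultimately have "real (card {x \<in> nz_residues p n. int p dvd idot n x k \<and> int p dvd idot n x l}) \<le> real (p ^ (n - 2) - 1)"
    by (simp only: of_nat_le_iff)
  then show ?thesis using \<open>p ^ (n - 2) \<ge> 1\<close> by (simp add: of_nat_diff)
qed

definition orth_count :: "nat \<Rightarrow> nat \<Rightarrow> (nat \<Rightarrow> int) set \<Rightarrow> (nat \<Rightarrow> int) \<Rightarrow> nat" where
  "orth_count p n D x = card {k \<in> D. int p dvd idot n x k}"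

text \<open>Double counting: every vector of \<open>D\<close> is orthogonal to the same number of
  nonzero residue vectors.\<close>

lemma sum_orth_count:
  assumes p: "prime p" and D: "finite D" and nd: "\<And>k. k \<in> D \<Longrightarrow> \<not> (\<forall>i<n. int p dvd k i)"
  shows "(\<Sum>x\<in>nz_residues p n. real (orth_count p n D x)) = real (card D) * (real p ^ (n - 1) - 1)"
proof -
  have "(\<Sum>x\<in>nz_residues p n. real (orth_count p n D x)) =
      (\<Sum>x\<in>nz_residues p n. \<Sum>k\<in>D. of_bool (int p dvd idot n x k))"
    unfolding orth_count_def using D by (intro sum.cong) (auto simp: sum_of_bool_eq Int_def)
  also have "\<dots> = (\<Sum>k\<in>D. \<Sum>x\<in>nz_residues p n. of_bool (int p dvd idot n x k))" by (rule sum.swap)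
  also have "\<dots> = (\<Sum>k\<in>D. real p ^ (n - 1) - 1)"
    using card_nz_residues_orthogonal[OF p nd] by (intro sum.cong) (auto simp: sum_of_bool_eq Int_def)
  finally show ?thesis by simp
qed

text \<open>The square expands over pairs: equal pairs give the first moment, distinct ones are
  independent modulo p. In the bound the diagonal is also included among the independent pairs,
  which only enlarges it.\<close>

lemma sum_orth_count_square:
  assumes p: "prime p" and D: "finite D" and nd: "\<And>k. k \<in> D \<Longrightarrow> \<not> (\<forall>i<n. int p dvd k i)"
    and pair: "\<And>k l. k \<in> D \<Longrightarrow> l \<in> D \<Longrightarrow> k \<noteq> l \<Longrightarrow> \<exists>i<n. \<exists>j<n. \<not> int p dvd k i * l j - k j * l i"
  shows "(\<Sum>x\<in>nz_residues p n. (real (orth_count p n D x))\<^sup>2) \<le>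
    real (card D) * (real p ^ (n - 1) - 1) + (real (card D))\<^sup>2 * (real p ^ (n - 2) - 1)"
proof -
  have p1: "real p ^ q - 1 \<ge> 0" for q using prime_gt_0_nat[OF p] by (simp add: one_le_power)
  have "(\<Sum>x\<in>nz_residues p n. (real (orth_count p n D x))\<^sup>2) =
      (\<Sum>x\<in>nz_residues p n. \<Sum>k\<in>D. \<Sum>l\<in>D. of_bool (int p dvd idot n x k \<and> int p dvd idot n x l))"
  proof (rule sum.cong[OF refl])
    fix x
    have "real (orth_count p n D x) = (\<Sum>k\<in>D. of_bool (int p dvd idot n x k))"
      unfolding orth_count_def using D by (auto simp: sum_of_bool_eq Int_def)
    then show "(real (orth_count p n D x))\<^sup>2 = (\<Sum>k\<in>D. \<Sum>l\<in>D. of_bool (int p dvd idot n x k \<and> int p dvd idot n x l))"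
      by (simp only: power2_eq_square sum_product of_bool_conj)
  qed
  also have "\<dots> = (\<Sum>k\<in>D. \<Sum>l\<in>D. \<Sum>x\<in>nz_residues p n. of_bool (int p dvd idot n x k \<and> int p dvd idot n x l))"
    by (subst sum.swap, rule sum.cong[OF refl], rule sum.swap)
  also have "\<dots> \<le> (\<Sum>k\<in>D. \<Sum>l\<in>D. (if l = k then real p ^ (n - 1) - 1 else 0) + (real p ^ (n - 2) - 1))"
  proof (intro sum_mono)
    fix k l assume kl: "k \<in> D" "l \<in> D"
    have e: "(\<Sum>x\<in>nz_residues p n. of_bool (int p dvd idot n x k \<and> int p dvd idot n x l)) =
        real (card {x \<in> nz_residues p n. int p dvd idot n x k \<and> int p dvd idot n x l})"
      by (simp add: sum_of_bool_eq Int_def)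
    show "(\<Sum>x\<in>nz_residues p n. of_bool (int p dvd idot n x k \<and> int p dvd idot n x l)) \<le>
        (if l = k then real p ^ (n - 1) - 1 else 0) + (real p ^ (n - 2) - 1)"
    proof (cases "l = k")
      case True
      then show ?thesis unfolding e using card_nz_residues_orthogonal[OF p nd[OF kl(1)]] p1[of "n - 2"] by simp
    next
      case False
      then obtain i j where "i < n" "j < n" "\<not> int p dvd k i * l j - k j * l i"
        using pair[OF kl] by auto
      from card_nz_residues_orthogonal2[where k = k and l = l, OF p this] False
      show ?thesis unfolding e by simp
    qed
  qed
  also have "\<dots> = (\<Sum>k\<in>D. (real p ^ (n - 1) - 1) + real (card D) * (real p ^ (n - 2) - 1))"
    using D by (intro sum.cong[OF refl]) (simp add: sum.distrib)
  also have "\<dots> = real (card D) * (real p ^ (n - 1) - 1) + (real (card D))\<^sup>2 * (real p ^ (n - 2) - 1)"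
    by (simp add: sum.distrib power2_eq_square algebra_simps)
  finally show ?thesis .
qed

text \<open>For uniform x the count has mean \<open>m\<close> at least \<open>E\<close> and variance
  at most \<open>m\<close>, because the indicators are pairwise uncorrelated up to a favourable
  sign. Falling below E / 2 \<le> m / 2 thus has probability at most m / (m / 2)^2 = 4 / m.\<close>

lemma orth_count_chebyshev:
  assumes p: "prime p" and n: "n \<ge> 2" and D: "finite D" "D \<noteq> {}"
    and nd: "\<And>k. k \<in> D \<Longrightarrow> \<not> (\<forall>i<n. int p dvd k i)"
    and pair: "\<And>k l. k \<in> D \<Longrightarrow> l \<in> D \<Longrightarrow> k \<noteq> l \<Longrightarrow> \<exists>i<n. \<exists>j<n. \<not> int p dvd k i * l j - k j * l i"
    and E: "E = real (card D) / (2 * real p)"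
  shows "real (card {x \<in> nz_residues p n. real (orth_count p n D x) < E / 2}) \<le> 4 / E * real (card (nz_residues p n))"
proof -
  have p2: "real p \<ge> 2" using prime_ge_2_nat[OF p] by simp
  define N where "N = real p ^ n - 1"
  define c1 where "c1 = real p ^ (n - 1) - 1"
  define c2 where "c2 = real p ^ (n - 2) - 1"
  define q where "q = real p ^ (n - 2)"
  have q: "q \<ge> 1" using p2 by (simp add: q_def one_le_power)
  have pn: "real p ^ (n - 1) = real p * q" "real p ^ n = real p * (real p * q)"
  proof -
    define r where "r = n - 2"
    have "n = Suc (Suc r)" using n by (simp add: r_def)
    then show "real p ^ (n - 1) = real p * q" "real p ^ n = real p * (real p * q)"
      by (simp_all add: q_def)
  qed
  have Ncard: "real (card (nz_residues p n)) = N"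
    using card_nz_residues[of p n] prime_gt_0_nat[OF p] by (simp add: N_def of_nat_diff)
  \<comment> \<open>Without the exclusion of x = 0 the mean would be card D / p; the factor 2 in
    \<open>E\<close> covers the difference.\<close>
  have c1N: "N \<le> 2 * real p * c1"
  proof -
    have "2 * real p - 1 \<le> real p * (real p * 1)" using sum_squares_ge_zero[of "real p - 1" 0]
      by (simp add: algebra_simps)
    also have "\<dots> \<le> real p * (real p * q)" using q p2 by (intro mult_left_mono) auto
    finally show ?thesis unfolding N_def c1_def pn by (simp add: algebra_simps)
  qed
  \<comment> \<open>Removing x = 0 makes the indicators of two independent vectors negatively
    correlated: c2 / N \<le> (c1 / N)^2. So the off-diagonal terms do not increase the
    variance.\<close>
  have c2N: "N * c2 \<le> c1\<^sup>2"
  proof -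
    have "c1\<^sup>2 - N * c2 = q * (real p - 1)\<^sup>2"
      unfolding N_def c1_def c2_def pn q_def[symmetric] by (simp add: power2_eq_square algebra_simps)
    moreover have "\<dots> \<ge> 0" using q by simp
    ultimately show ?thesis by linarith
  qed
  have "real p * (real p * q) \<ge> 2 * (2 * 1)" using p2 q by (intro mult_mono) auto
  then have N0: "N > 0" by (simp add: N_def pn)
  define m where "m = real (card D) * c1 / N"
  have cD: "real (card D) > 0" using D by (simp add: card_gt_0_iff)
  have mE: "m \<ge> E"
  proof -
    have "real (card D) * N \<le> real (card D) * (2 * real p * c1)" using c1N by (intro mult_left_mono) auto
    then show ?thesis unfolding m_def E using p2 N0 by (simp add: field_simps)
  qed
  have E0: "E > 0" using cD p2 by (simp add: E)
  define C where "C x = real (orth_count p n D x)" for x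
  have S1: "(\<Sum>x\<in>nz_residues p n. C x) = m * N"
  proof -
    have "(\<Sum>x\<in>nz_residues p n. C x) = real (card D) * c1"
      unfolding C_def c1_def by (rule sum_orth_count[OF p D(1) nd])
    then show ?thesis using N0 by (simp add: m_def)
  qed
  have S2: "(\<Sum>x\<in>nz_residues p n. (C x)\<^sup>2) \<le> m * N + m\<^sup>2 * N"
  proof -
    have "(\<Sum>x\<in>nz_residues p n. (C x)\<^sup>2) \<le> real (card D) * c1 + (real (card D))\<^sup>2 * c2"
      unfolding C_def c1_def c2_def by (rule sum_orth_count_square[OF p D(1) nd pair])
    also have "(real (card D))\<^sup>2 * c2 \<le> (real (card D))\<^sup>2 * (c1\<^sup>2 / N)"
      using c2N N0 by (intro mult_left_mono) (auto simp: field_simps)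
    also have "(real (card D))\<^sup>2 * (c1\<^sup>2 / N) = m\<^sup>2 * N"
      using N0 by (simp add: m_def power2_eq_square)
    also have "real (card D) * c1 = m * N" using N0 by (simp add: m_def)
    finally show ?thesis by simp
  qed
  have var: "(\<Sum>x\<in>nz_residues p n. (C x - m)\<^sup>2) \<le> m * N"
  proof -
    have "(\<Sum>x\<in>nz_residues p n. (C x - m)\<^sup>2) = (\<Sum>x\<in>nz_residues p n. (C x)\<^sup>2 - 2 * m * C x + m\<^sup>2)"
      by (intro sum.cong) (auto simp: power2_diff)
    also have "\<dots> = (\<Sum>x\<in>nz_residues p n. (C x)\<^sup>2) - 2 * m * (\<Sum>x\<in>nz_residues p n. C x) + N * m\<^sup>2"
      by (simp add: sum.distrib sum_subtractf sum_distrib_left Ncard)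
    also have "\<dots> \<le> m * N"
      using S2 by (simp add: S1 power2_eq_square algebra_simps)
    finally show ?thesis .
  qed
  define B where "B = {x \<in> nz_residues p n. C x < E / 2}"
  have m0: "m > 0" using mE E0 by simp
  have "real (card B) * (m / 2)\<^sup>2 = (\<Sum>x\<in>B. (m / 2)\<^sup>2)" by simp
  also have "\<dots> \<le> (\<Sum>x\<in>B. (C x - m)\<^sup>2)"
  proof (rule sum_mono)
    fix x assume "x \<in> B"
    then have "m / 2 \<le> m - C x" using mE by (simp add: B_def)
    then have "(m / 2)\<^sup>2 \<le> (m - C x)\<^sup>2" using m0 by (intro power_mono) auto
    then show "(m / 2)\<^sup>2 \<le> (C x - m)\<^sup>2" by (simp add: power2_commute)
  qed
  also have "\<dots> \<le> (\<Sum>x\<in>nz_residues p n. (C x - m)\<^sup>2)"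
    by (intro sum_mono2) (auto simp: B_def)
  also have "\<dots> \<le> m * N" by (rule var)
  finally have "real (card B) * m \<le> 4 * N" using m0 by (simp add: power2_eq_square field_simps)
  then have "real (card B) * E \<le> 4 * N" using mult_left_mono[OF mE, of "real (card B)"] by linarith
  then have "real (card B) \<le> 4 / E * N" using E0 by (simp add: field_simps)
  then show ?thesis by (simp add: B_def C_def Ncard)
qed

text \<open>At a coordinate with k_i and l_i nonzero write k_i / l_i = a / b in lowest terms. Then
  \<open>a\<close> divides all of k and \<open>b\<close> all of l, so primitivity makes both units
  and k = l or k = -l; the sign normalisation excludes the second.\<close>

lemma iprim_proportional:
  assumes k: "iprim n k" "ipos n k" and l: "iprim n l" "ipos n l"
    and prp: "\<And>i j. i < n \<Longrightarrow> j < n \<Longrightarrow> k i * l j = k j * l i"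
  shows "k = l"
proof -
  have unit: "\<bar>a\<bar> = 1"
    if x: "iprim n x" and dv: "\<And>j. j < n \<Longrightarrow> a dvd x j" and a0: "a \<noteq> 0" for a and x :: "nat \<Rightarrow> int"
  proof (rule ccontr)
    assume "\<bar>a\<bar> \<noteq> 1"
    then have a2: "\<bar>a\<bar> \<ge> 2" using a0 by linarith
    define y where "y = (\<lambda>j\<in>{..<n}. x j div \<bar>a\<bar>)"
    have "y \<in> int_vecs n" by (auto simp: y_def int_vecs_def)
    moreover have "x = imul n \<bar>a\<bar> y"
      using x dv by (intro int_vecs_eqI[OF _ imul_int_vecs]) (auto simp: iprim_def imul_def y_def)
    ultimately show False using x a2 by (auto simp: iprim_def)
  qed
  have kl: "k \<in> int_vecs n" "k \<noteq> zvec n" "l \<in> int_vecs n" "l \<noteq> zvec n" using k l by (auto simp: iprim_def)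
  obtain i where i: "i < n" "k i \<noteq> 0" using nonzero_coord[OF kl(1,2)] by blast
  have li: "l i \<noteq> 0"
  proof
    assume "l i = 0"
    then have "l j = 0" if "j < n" for j using prp[OF i(1) that] i(2) by simp
    then show False using nonzero_coord[OF kl(3,4)] by blast
  qed
  define g where "g = gcd (k i) (l i)"
  have g0: "g \<noteq> 0" using i by (simp add: g_def)
  define a b where "a = k i div g" and "b = l i div g"
  have ab: "k i = g * a" "l i = g * b" by (simp_all add: a_def b_def g_def)
  have cop: "coprime a b" unfolding a_def b_def g_def using i(2) by (intro div_gcd_coprime) auto
  have e: "a * l j = b * k j" if "j < n" for j
    using prp[OF i(1) that] g0 by (simp add: ab algebra_simps)
  have "a dvd k j" if "j < n" for j
    using e[OF that] cop by (metis coprime_dvd_mult_right_iff dvd_triv_left)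
  then have a1: "\<bar>a\<bar> = 1" using unit[OF k(1), of a] i(2) ab by auto
  have "b dvd l j" if "j < n" for j
    using e[OF that] cop by (metis coprime_commute coprime_dvd_mult_right_iff dvd_triv_left)
  then have b1: "\<bar>b\<bar> = 1" using unit[OF l(1), of b] li ab by auto
  have b0: "b \<noteq> 0" using b1 by auto
  have "a = b \<or> a = - b" using a1 b1 by linarith
  then have "(\<forall>j<n. l j = k j) \<or> (\<forall>j<n. l j = - k j)"
  proof
    assume "a = b"
    then show ?thesis using e b0 by auto
  next
    assume ab': "a = - b"
    have "l j = - k j" if "j < n" for j
    proof -
      have "b * (l j + k j) = 0" using e[OF that] ab' by (simp add: algebra_simps)
      then show ?thesis using b0 by simp
    qed
    then show ?thesis by blast
  qed
  then show ?thesis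
  proof
    assume "\<forall>j<n. l j = k j"
    then show ?thesis using kl by (intro int_vecs_eqI) auto
  next
    assume "\<forall>j<n. l j = - k j"
    then have "l = imul n (-1) k" using kl by (intro int_vecs_eqI[OF _ imul_int_vecs]) (auto simp: imul_def)
    then show ?thesis using ipos_neg[OF kl(1,2)] k l by simp
  qed
qed

section \<open>Moments of lattice point counts under Hecke averages\<close>

definition nz_count :: "real vec set \<Rightarrow> real \<Rightarrow> nat" where
  "nz_count L t = card {v \<in> L. v \<noteq> 0\<^sub>v (dim_vec v) \<and> vnorm v \<le> t}"

definition prim_count :: "real vec set \<Rightarrow> real \<Rightarrow> nat" where
  "prim_count L t = card {v \<in> primitive_vectors L. vnorm v \<le> t}"

lemma dim_lvec_SL: "A \<in> SL n \<Longrightarrow> dim_vec (lvec A k) = n"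
  by simp

lemma nz_set_lattice_of:
  assumes A: "A \<in> SL n"
  shows "{v \<in> lattice_of A. v \<noteq> 0\<^sub>v (dim_vec v) \<and> vnorm v \<le> t} = lvec A ` nz_points n A t"
  unfolding lattice_of_eq_lvec[OF SL_carrier[OF A]] nz_points_def
  using lvec_eq_0_iff[OF A] dim_lvec_SL[OF A] by auto

lemma nz_count_lattice_of:
  assumes A: "A \<in> SL n"
  shows "nz_count (lattice_of A) t = card (nz_points n A t)"
  unfolding nz_count_def nz_set_lattice_of[OF A]
  by (rule card_image, rule inj_on_subset[OF inj_lvec[OF A]]) (auto simp: nz_points_def)

text \<open>A basis identifies integer multiples of lattice vectors with integer multiples of
  coefficient vectors, so primitivity can be tested on coefficients.\<close>

lemma primitive_vectors_lattice_of:
  assumes A: "A \<in> SL n"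
  shows "primitive_vectors (lattice_of A) = lvec A ` {k. iprim n k}"
proof -
  have cA: "A \<in> carrier_mat n n" using A by (rule SL_carrier)
  have eq: "(\<exists>m :: int. \<exists>w \<in> lvec A ` int_vecs n. m \<ge> 2 \<and> lvec A k = real_of_int m \<cdot>\<^sub>v w) \<longleftrightarrow>
      (\<exists>m\<ge>2. \<exists>l\<in>int_vecs n. k = imul n m l)" if k: "k \<in> int_vecs n" for k
  proof -
    have "lvec A k = real_of_int m \<cdot>\<^sub>v lvec A l \<longleftrightarrow> k = imul n m l" for m l
      using inj_on_eq_iff[OF inj_lvec[OF A] k imul_int_vecs] by (simp add: lvec_imul[OF cA])
    then show ?thesis by auto
  qed
  show ?thesis
  proof (intro equalityI subsetI)
    fix v assume "v \<in> primitive_vectors (lattice_of A)"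
    then obtain k where k: "k \<in> int_vecs n" "v = lvec A k" "lvec A k \<noteq> 0\<^sub>v n"
      "\<not> (\<exists>m :: int. \<exists>w \<in> lvec A ` int_vecs n. m \<ge> 2 \<and> lvec A k = real_of_int m \<cdot>\<^sub>v w)"
      unfolding primitive_vectors_def lattice_of_eq_lvec[OF cA] using dim_lvec_SL[OF A] by auto
    have "\<not> (\<exists>m\<ge>2. \<exists>l\<in>int_vecs n. k = imul n m l)" using k(4) unfolding eq[OF k(1)] .
    then have "iprim n k" using k(1,3) lvec_eq_0_iff[OF A k(1)] by (simp add: iprim_def)
    then show "v \<in> lvec A ` {k. iprim n k}" using k(2) by blast
  next
    fix v assume "v \<in> lvec A ` {k. iprim n k}"
    then obtain k where k: "iprim n k" "v = lvec A k" by auto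
    have ki: "k \<in> int_vecs n" using k(1) by (simp add: iprim_def)
    have "lvec A k \<noteq> 0\<^sub>v n" using k(1) lvec_eq_0_iff[OF A ki] by (simp add: iprim_def)
    moreover have "\<not> (\<exists>m :: int. \<exists>w \<in> lvec A ` int_vecs n. m \<ge> 2 \<and> lvec A k = real_of_int m \<cdot>\<^sub>v w)"
      unfolding eq[OF ki] using k(1) by (simp add: iprim_def)
    ultimately show "v \<in> primitive_vectors (lattice_of A)"
      unfolding primitive_vectors_def lattice_of_eq_lvec[OF cA] k(2) using ki dim_lvec_SL[OF A] by auto
  qed
qed

lemma iprim_neg: "iprim n k \<Longrightarrow> iprim n (imul n (-1) k)"
proof -
  assume k: "iprim n k"
  then have ki: "k \<in> int_vecs n" "k \<noteq> zvec n" by (auto simp: iprim_def)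
  have "False" if "m \<ge> 2" "l \<in> int_vecs n" "imul n (-1) k = imul n m l" for m l
  proof -
    have "k = imul n (-1) (imul n (-1) k)" using imul_one[OF ki(1)] by (simp add: imul_imul)
    also have "\<dots> = imul n m (imul n (-1) l)" unfolding that(3) by (simp add: imul_imul)
    finally show False using k that(1) imul_int_vecs unfolding iprim_def by blast
  qed
  moreover have "imul n (-1) k \<noteq> zvec n" using imul_zvec_iff[OF ki(1), of "-1"] ki(2) by simp
  ultimately show ?thesis unfolding iprim_def by auto
qed

lemma card_pm:
  assumes D: "finite D" "\<And>k. k \<in> D \<Longrightarrow> k \<in> int_vecs n \<and> ipos n k"
  shows "card (D \<union> imul n (-1) ` D) = 2 * card D"
proof -
  have "D \<inter> imul n (-1) ` D = {}"
  proof (rule equals0I)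
    fix k assume "k \<in> D \<inter> imul n (-1) ` D"
    then obtain l where "l \<in> D" "k = imul n (-1) l" "k \<in> D" by auto
    then show False using D(2)[of k] D(2)[of l] ipos_neg[of l n] ipos_nonzero by blast
  qed
  moreover have "card (imul n (-1) ` D) = card D"
    by (rule card_image, rule inj_on_subset[OF inj_imul]) (use D in auto)
  ultimately show ?thesis using D(1) by (simp add: card_Un_disjoint)
qed

lemma vnorm_lvec_neg: "A \<in> carrier_mat n n \<Longrightarrow> vnorm (lvec A (imul n (-1) k)) = vnorm (lvec A k)"
  by (simp add: lvec_imul vnorm_smult)

lemma prim_count_lattice_of:
  assumes A: "A \<in> SL n"
  shows "prim_count (lattice_of A) t = 2 * card (prim_points n A t)"
proof -
  define D where "D = prim_points n A t"
  have D: "finite D" "\<And>k. k \<in> D \<Longrightarrow> k \<in> int_vecs n \<and> ipos n k"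
    using finite_prim_points[OF A] by (auto simp: D_def prim_points_def iprim_def)
  have "{k. iprim n k \<and> vnorm (lvec A k) \<le> t} = D \<union> imul n (-1) ` D"
  proof (intro equalityI subsetI)
    fix k assume "k \<in> {k. iprim n k \<and> vnorm (lvec A k) \<le> t}"
    then have k: "iprim n k" "vnorm (lvec A k) \<le> t" by auto
    show "k \<in> D \<union> imul n (-1) ` D"
    proof (cases "ipos n k")
      case True
      then show ?thesis using k by (simp add: D_def prim_points_def)
    next
      case False
      have ki: "k \<in> int_vecs n" "k \<noteq> zvec n" using k(1) by (auto simp: iprim_def)
      have "imul n (-1) k \<in> D"
        using k False iprim_neg[OF k(1)] ipos_neg[OF ki] vnorm_lvec_neg[OF SL_carrier[OF A]]
        by (simp add: D_def prim_points_def)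
      moreover have "k = imul n (-1) (imul n (-1) k)" using imul_one[OF ki(1)] by (simp add: imul_imul)
      ultimately show ?thesis by blast
    qed
  next
    fix k assume "k \<in> D \<union> imul n (-1) ` D"
    then show "k \<in> {k. iprim n k \<and> vnorm (lvec A k) \<le> t}"
      using iprim_neg vnorm_lvec_neg[OF SL_carrier[OF A]] by (auto simp: D_def prim_points_def)
  qed
  moreover have "{v \<in> primitive_vectors (lattice_of A). vnorm v \<le> t} = lvec A ` {k. iprim n k \<and> vnorm (lvec A k) \<le> t}"
    unfolding primitive_vectors_lattice_of[OF A] by auto
  moreover have "inj_on (lvec A) {k. iprim n k \<and> vnorm (lvec A k) \<le> t}"
    by (rule inj_on_subset[OF inj_lvec[OF A]]) (auto simp: iprim_def)
  ultimately show ?thesis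
    unfolding prim_count_def using card_pm[OF D] by (simp add: card_image D_def)
qed

section \<open>From a lattice to its Hecke lattices\<close>

lemma hecke_scale:
  assumes p: "p > 0"
  shows "real p powr (- 1 / real n) > 0"
    and "real p powr (- 1 / real n) * a \<le> s \<longleftrightarrow> a \<le> s * real p powr (1 / real n)"
proof -
  show "real p powr (- 1 / real n) > 0" using p by simp
  have "real p powr (- (1 / real n)) = inverse (real p powr (1 / real n))" by (rule powr_minus)
  then have eq: "real p powr (- 1 / real n) = inverse (real p powr (1 / real n))" by simp
  have "real p powr (1 / real n) > 0" using p by simp
  then show "real p powr (- 1 / real n) * a \<le> s \<longleftrightarrow> a \<le> s * real p powr (1 / real n)"
    unfolding eq by (simp add: inverse_eq_divide pos_divide_le_eq)
qed

text \<open>Undoing the rescaling turns norm at most s into norm at most s p^(1/n), and membership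
  in the sublattice into the congruence counted by \<open>orth_count\<close>.\<close>

lemma nz_count_hecke_le:
  assumes A: "A \<in> SL n" and p: "p > 0" and n: "n > 0"
  shows "nz_count (hecke p n x A) s \<le> orth_count p n (nz_points n A (s * real p powr (1 / real n))) x"
proof -
  define D where "D = {k \<in> nz_points n A (s * real p powr (1 / real n)). int p dvd idot n x k}"
  have fin: "finite D" using finite_nz_points[OF A] by (simp add: D_def)
  have "{v \<in> hecke p n x A. v \<noteq> 0\<^sub>v (dim_vec v) \<and> vnorm v \<le> s}
      \<subseteq> (\<lambda>k. (real p powr (- 1 / real n)) \<cdot>\<^sub>v lvec A k) ` D"
  proof
    fix v assume v: "v \<in> {v \<in> hecke p n x A. v \<noteq> 0\<^sub>v (dim_vec v) \<and> vnorm v \<le> s}"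
    then obtain k where k: "k \<in> int_vecs n" "int p dvd idot n x k"
      "v = (real p powr (- 1 / real n)) \<cdot>\<^sub>v lvec A k" by (auto simp: hecke_def)
    have "k \<noteq> zvec n"
    proof
      assume "k = zvec n"
      then have "v = 0\<^sub>v (dim_vec v)" using k(3) lvec_zvec[OF SL_carrier[OF A]] by (auto intro!: eq_vecI)
      then show False using v by simp
    qed
    moreover have "vnorm (lvec A k) \<le> s * real p powr (1 / real n)"
      using v k(3) hecke_scale[OF p] by (simp add: vnorm_smult)
    ultimately show "v \<in> (\<lambda>k. (real p powr (- 1 / real n)) \<cdot>\<^sub>v lvec A k) ` D"
      using k by (auto simp: D_def nz_points_def)
  qed
  then have "nz_count (hecke p n x A) s \<le> card ((\<lambda>k. (real p powr (- 1 / real n)) \<cdot>\<^sub>v lvec A k) ` D)"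
    unfolding nz_count_def by (intro card_mono finite_imageI fin)
  also have "\<dots> \<le> card D" by (rule card_image_le[OF fin])
  finally show ?thesis by (simp add: D_def orth_count_def)
qed

text \<open>A vector that is primitive in the full lattice stays primitive in any sublattice
  containing it. The sublattice may gain further primitive vectors, such as p times an omitted one,
  hence an inequality. The factor 2 counts both signs.\<close>

lemma prim_count_hecke_ge:
  assumes A: "A \<in> SL n" and p: "p > 0" and n: "n > 0"
  shows "2 * orth_count p n (prim_points n A (s * real p powr (1 / real n))) x \<le> prim_count (hecke p n x A) s"
proof -
  define \<theta> where "\<theta> = real p powr (- 1 / real n)"
  have th: "\<theta> > 0" using hecke_scale(1)[OF p] by (simp add: \<theta>_def)
  define T where "T = s * real p powr (1 / real n)"
  have scale: "vnorm (\<theta> \<cdot>\<^sub>v w) \<le> s \<longleftrightarrow> vnorm w \<le> T" for w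
    using hecke_scale(2)[OF p, of n "vnorm w" s] th by (simp add: vnorm_smult T_def \<theta>_def)
  define D where "D = {k \<in> prim_points n A T. int p dvd idot n x k}"
  have "finite D" by (rule finite_subset[OF _ finite_prim_points[OF A]]) (auto simp: D_def)
  moreover have "\<And>k. k \<in> D \<Longrightarrow> k \<in> int_vecs n \<and> ipos n k"
    by (auto simp: D_def prim_points_def iprim_def)
  ultimately have D: "finite D" "\<And>k. k \<in> D \<Longrightarrow> k \<in> int_vecs n \<and> ipos n k" by blast+
  define D2 where "D2 = D \<union> imul n (-1) ` D"
  have cA: "A \<in> carrier_mat n n" using A by (rule SL_carrier)
  have D2: "iprim n k" "int p dvd idot n x k" "vnorm (lvec A k) \<le> T" if "k \<in> D2" for k
  proof -
    have "idot n x (imul n (-1) l) = - idot n x l" for l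
      by (simp add: idot_def imul_def sum_negf)
    then show "iprim n k" "int p dvd idot n x k" "vnorm (lvec A k) \<le> T"
      using that iprim_neg vnorm_lvec_neg[OF cA] by (auto simp: D2_def D_def prim_points_def)
  qed
  define f where "f k = \<theta> \<cdot>\<^sub>v lvec A k" for k
  have f_eq: "f k = real_of_int m \<cdot>\<^sub>v f l \<longleftrightarrow> k = imul n m l" if k: "k \<in> int_vecs n" for k l m
  proof -
    have "f k = real_of_int m \<cdot>\<^sub>v f l \<longleftrightarrow> \<theta> \<cdot>\<^sub>v lvec A k = \<theta> \<cdot>\<^sub>v lvec A (imul n m l)"
      by (simp add: f_def lvec_imul[OF cA] smult_smult_assoc mult.commute)
    also have "\<dots> \<longleftrightarrow> lvec A k = lvec A (imul n m l)"
    proof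
      assume e: "\<theta> \<cdot>\<^sub>v lvec A k = \<theta> \<cdot>\<^sub>v lvec A (imul n m l)"
      have "(1 / \<theta>) \<cdot>\<^sub>v (\<theta> \<cdot>\<^sub>v lvec A k) = (1 / \<theta>) \<cdot>\<^sub>v (\<theta> \<cdot>\<^sub>v lvec A (imul n m l))"
        by (simp only: e)
      then show "lvec A k = lvec A (imul n m l)" using th by (simp add: smult_smult_assoc)
    qed simp
    also have "\<dots> \<longleftrightarrow> k = imul n m l" by (rule inj_on_eq_iff[OF inj_lvec[OF A] k imul_int_vecs])
    finally show ?thesis .
  qed
  have "f ` D2 \<subseteq> {v \<in> primitive_vectors (hecke p n x A). vnorm v \<le> s}"
  proof (rule image_subsetI)
    fix k assume k: "k \<in> D2"
    have ki: "k \<in> int_vecs n" "k \<noteq> zvec n" using D2(1)[OF k] by (auto simp: iprim_def)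
    have "f k \<in> hecke p n x A" using ki D2(2)[OF k] by (auto simp: hecke_def f_def \<theta>_def)
    moreover have "f k \<noteq> 0\<^sub>v (dim_vec (f k))"
    proof
      assume e: "f k = 0\<^sub>v (dim_vec (f k))"
      have "f k = real_of_int 0 \<cdot>\<^sub>v f k"
      proof (rule eq_vecI)
        fix i assume "i < dim_vec (real_of_int 0 \<cdot>\<^sub>v f k)"
        then have i: "i < dim_vec (f k)" by simp
        then have "f k $ i = 0" using arg_cong[OF e, of "\<lambda>v. v $ i"] by simp
        then show "f k $ i = (real_of_int 0 \<cdot>\<^sub>v f k) $ i" using i by simp
      qed simp
      then have "k = imul n 0 k" using f_eq[OF ki(1)] by blast
      moreover have "imul n 0 k = zvec n" by (auto simp: imul_def zvec_def)
      ultimately show False using ki(2) by simp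
    qed
    moreover have "\<not> (\<exists>m :: int. \<exists>w \<in> hecke p n x A. m \<ge> 2 \<and> f k = real_of_int m \<cdot>\<^sub>v w)"
    proof
      assume "\<exists>m :: int. \<exists>w \<in> hecke p n x A. m \<ge> 2 \<and> f k = real_of_int m \<cdot>\<^sub>v w"
      then obtain m :: int and l where "m \<ge> 2" "l \<in> int_vecs n" "f k = real_of_int m \<cdot>\<^sub>v f l"
        by (auto simp: hecke_def f_def \<theta>_def)
      then show False using f_eq[OF ki(1)] D2(1)[OF k] by (auto simp: iprim_def)
    qed
    moreover have "vnorm (f k) \<le> s" using D2(3)[OF k] by (simp add: f_def scale)
    ultimately show "f k \<in> {v \<in> primitive_vectors (hecke p n x A). vnorm v \<le> s}"
      by (simp add: primitive_vectors_def)
  qed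
  \<comment> \<open>Monotonicity of \<open>card\<close> requires this: the cardinality of an
    infinite set is 0 and would spoil a lower bound.\<close>
  moreover have "finite {v \<in> primitive_vectors (hecke p n x A). vnorm v \<le> s}"
  proof (rule finite_subset)
    show "{v \<in> primitive_vectors (hecke p n x A). vnorm v \<le> s} \<subseteq> f ` lattice_points n A T"
    proof
      fix v assume "v \<in> {v \<in> primitive_vectors (hecke p n x A). vnorm v \<le> s}"
      then have v: "v \<in> hecke p n x A" "vnorm v \<le> s" by (simp_all add: primitive_vectors_def)
      obtain k where k: "k \<in> int_vecs n" "v = f k"
        using v(1) unfolding hecke_def f_def \<theta>_def by blast
      have "vnorm (lvec A k) \<le> T" using v(2) unfolding k(2) f_def scale .
      then show "v \<in> f ` lattice_points n A T" using k by (auto simp: lattice_points_def)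
    qed
    show "finite (f ` lattice_points n A T)" using finite_lattice_points[OF A] by simp
  qed
  ultimately have "card (f ` D2) \<le> prim_count (hecke p n x A) s"
    unfolding prim_count_def by (rule card_mono[rotated])
  moreover have "inj_on f D2"
  proof (rule inj_onI)
    fix k l assume kl: "k \<in> D2" "l \<in> D2" "f k = f l"
    have i: "k \<in> int_vecs n" "l \<in> int_vecs n" using D2(1) kl by (auto simp: iprim_def)
    have "f k = real_of_int 1 \<cdot>\<^sub>v f l" using kl(3) by simp
    then show "k = l" using f_eq[OF i(1)] imul_one[OF i(2)] by metis
  qed
  ultimately show ?thesis
    using card_pm[OF D] by (simp add: card_image D2_def D_def orth_count_def T_def)
qed

section \<open>First and second moments for large primes\<close>

lemma eventually_prime_scale:
  assumes n: "n > 0"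
  shows "filterlim (\<lambda>p::nat. real p powr (1 / real n)) at_top sequentially"
proof -
  have "filterlim (\<lambda>x::real. x powr (1 / real n)) at_top at_top"
    using n by (intro real_powr_at_top) simp
  then show ?thesis by (rule filterlim_compose[OF _ filterlim_real_sequentially])
qed

lemma eventually_powr_less:
  assumes a: "a < 1"
  shows "\<forall>\<^sub>F p::nat in sequentially. c * real p powr a < real p"
proof -
  have "filterlim (\<lambda>x::real. x powr (1 - a)) at_top at_top"
    using a by (intro real_powr_at_top) simp
  then have "filterlim (\<lambda>p::nat. real p powr (1 - a)) at_top sequentially"
    by (rule filterlim_compose[OF _ filterlim_real_sequentially])
  then have "\<forall>\<^sub>F p::nat in sequentially. c < real p powr (1 - a)"
    by (simp add: filterlim_at_top_dense)
  then show ?thesis using eventually_gt_at_top[of 0]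
  proof eventually_elim
    case (elim p)
    then have "c * real p powr a < real p powr (1 - a) * real p powr a"
      by (intro mult_strict_right_mono) auto
    also have "\<dots> = real p" using elim by (simp add: powr_add[symmetric])
    finally show ?case .
  qed
qed

text \<open>If p divided every coordinate, k would be p times a nonzero lattice vector and therefore
  too long. In the applications T grows only like p^(1/n).\<close>

lemma not_all_dvd:
  assumes A: "A \<in> SL n" and k: "k \<in> nz_points n A T"
    and T: "T * (mnorm n (adj_mat A) + 1) < real p"
  shows "\<not> (\<forall>i<n. int p dvd k i)"
proof
  assume dv: "\<forall>i<n. int p dvd k i"
  have ki: "k \<in> int_vecs n" "k \<noteq> zvec n" "vnorm (lvec A k) \<le> T" using k by (auto simp: nz_points_def)
  define l where "l = (\<lambda>i\<in>{..<n}. k i div int p)"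
  have li: "l \<in> int_vecs n" by (simp add: l_def int_vecs_def)
  have kl: "k = imul n (int p) l"
    using dv by (intro int_vecs_eqI[OF ki(1) imul_int_vecs]) (auto simp: imul_def l_def)
  have "l \<noteq> zvec n"
  proof
    assume "l = zvec n"
    then have "k = zvec n" unfolding kl by (auto simp: imul_def zvec_def)
    then show False using ki by simp
  qed
  from vnorm_lvec_lower[OF A li this]
  have "real p * (1 / (mnorm n (adj_mat A) + 1)) \<le> real p * vnorm (lvec A l)" by (intro mult_left_mono) auto
  also have "\<dots> = vnorm (lvec A k)" unfolding kl by (simp add: lvec_imul[OF SL_carrier[OF A]] vnorm_smult)
  also have "\<dots> \<le> T" by (rule ki(3))
  finally show False using T mnorm_nonneg[of n "adj_mat A"] by (simp add: field_simps)
qed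

lemma hecke_mean_ennreal:
  assumes "prime p" "n > 0" "\<And>L. f L \<ge> 0"
  shows "hecke_mean p n (\<lambda>L. ennreal (f L)) A = ennreal ((\<Sum>x\<in>nz_residues p n. f (hecke p n x A)) / real (card (nz_residues p n)))"
proof -
  have "card (nz_residues p n) > 0"
    using nz_residues_nonempty[of p n] assms prime_gt_1_nat by (simp add: card_gt_0_iff)
  then show ?thesis
    unfolding hecke_mean_def using assms(3)
    by (simp add: sum_ennreal ennreal_of_nat_eq_real_of_nat divide_ennreal sum_nonneg)
qed

text \<open>A vector lies in the random sublattice with probability about 1 / p, while the ball of
  radius s p^(1/n) holds about p times the volume of the ball of radius s, so p cancels. The minimum
  with \<open>K\<close> anticipates the passage to the limit under the integral.\<close>

lemma hecke_first_moment:
  assumes A: "A \<in> SL n" and n: "n \<ge> 2" and s: "s > 0" and e: "e > 0"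
  shows "\<exists>p0. \<forall>p\<ge>p0. prime p \<longrightarrow>
    hecke_mean p n (\<lambda>L. ennreal (min (real (nz_count L s)) K)) A \<le> ennreal (unit_ball_vol (real n) * s ^ n + e)"
proof -
  have n0: "n > 0" using n by simp
  define V where "V = unit_ball_vol (real n)"
  define T where "T p = s * real p powr (1 / real n)" for p :: nat
  have Tn: "T p ^ n = s ^ n * real p" if "p > 0" for p
    using that n by (simp add: T_def power_mult_distrib powr_power)
  have Tlim: "filterlim T at_top sequentially"
    unfolding T_def by (rule filterlim_tendsto_pos_mult_at_top[OF tendsto_const s eventually_prime_scale[OF n0]])
  have lim: "(\<lambda>p. real (card (nz_points n A (T p))) / T p ^ n) \<longlonglongrightarrow> V"
    unfolding V_def by (rule filterlim_compose[OF nz_points_asymp[OF A n0] Tlim])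
  have "V < V + e / s ^ n" using s e by simp
  from order_tendstoD(2)[OF lim this]
  have ev1: "\<forall>\<^sub>F p in sequentially. real (card (nz_points n A (T p))) / T p ^ n < V + e / s ^ n" .
  have ev2: "\<forall>\<^sub>F p in sequentially. (s * (mnorm n (adj_mat A) + 1)) * real p powr (1 / real n) < real p"
    by (rule eventually_powr_less) (use n in auto)
  have "\<forall>\<^sub>F p in sequentially. prime p \<longrightarrow>
    hecke_mean p n (\<lambda>L. ennreal (min (real (nz_count L s)) K)) A \<le> ennreal (V * s ^ n + e)"
    using ev1 ev2
  proof eventually_elim
    case (elim p)
    show ?case
    proof
      assume p: "prime p"
      have p0: "p > 0" using prime_gt_0_nat[OF p] .
      define D where "D = nz_points n A (T p)"
      have nd: "\<not> (\<forall>i<n. int p dvd k i)" if "k \<in> D" for k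
        by (rule not_all_dvd[OF A that[unfolded D_def]]) (use elim(2) in \<open>simp add: T_def mult_ac\<close>)
      define N where "N = real (card (nz_residues p n))"
      have N: "N = real p ^ n - 1" using card_nz_residues[OF p0, of n] p0 by (simp add: N_def of_nat_diff)
      have N0: "N > 0"
        using nz_residues_nonempty[of p n] n0 prime_gt_1_nat[OF p] by (simp add: N_def card_gt_0_iff)
      \<comment> \<open>The exact probability (p^(n-1) - 1) / (p^n - 1) is at most 1 / p, so
        excluding x = 0 helps the upper bound.\<close>
      have c1: "(real p ^ (n - 1) - 1) * real p \<le> N"
      proof -
        have "real p ^ (n - 1) * real p = real p ^ n" by (rule power_minus_mult[OF n0])
        then have "(real p ^ (n - 1) - 1) * real p = real p ^ n - real p"
          by (simp only: left_diff_distrib mult_1_left)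
        then show ?thesis using p0 unfolding N by simp
      qed
      have "hecke_mean p n (\<lambda>L. ennreal (min (real (nz_count L s)) K)) A
          \<le> hecke_mean p n (\<lambda>L. ennreal (real (nz_count L s))) A"
        unfolding hecke_mean_def by (intro divide_right_mono_ennreal sum_mono ennreal_leI) simp
      also have "\<dots> = ennreal ((\<Sum>x\<in>nz_residues p n. real (nz_count (hecke p n x A) s)) / N)"
        unfolding N_def by (rule hecke_mean_ennreal[OF p n0]) simp
      also have "\<dots> \<le> ennreal (V * s ^ n + e)"
      proof (rule ennreal_leI)
        have "(\<Sum>x\<in>nz_residues p n. real (nz_count (hecke p n x A) s)) \<le> (\<Sum>x\<in>nz_residues p n. real (orth_count p n D x))"
          using nz_count_hecke_le[OF A p0 n0] by (intro sum_mono) (simp add: D_def T_def)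
        also have "\<dots> = real (card D) * (real p ^ (n - 1) - 1)"
          by (rule sum_orth_count[OF p _ nd]) (simp add: D_def finite_nz_points[OF A])
        finally have "(\<Sum>x\<in>nz_residues p n. real (nz_count (hecke p n x A) s)) / N
            \<le> real (card D) * (real p ^ (n - 1) - 1) / N"
          using N0 by (intro divide_right_mono) auto
        also have "\<dots> \<le> real (card D) / real p"
          using mult_left_mono[OF c1, of "real (card D)"] N0 p0 by (simp add: field_simps)
        also have "\<dots> \<le> V * s ^ n + e"
        proof -
          have "T p ^ n > 0" using Tn[OF p0] s p0 by simp
          then have "real (card D) < (V + e / s ^ n) * T p ^ n" using elim(1) by (simp add: D_def field_simps)
          also have "\<dots> = (V * s ^ n + e) * real p" using s by (simp add: Tn[OF p0] field_simps)
          finally show ?thesis using p0 by (simp add: field_simps)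
        qed
        finally show "(\<Sum>x\<in>nz_residues p n. real (nz_count (hecke p n x A) s)) / N \<le> V * s ^ n + e" .
      qed
      finally show "hecke_mean p n (\<lambda>L. ennreal (min (real (nz_count L s)) K)) A \<le> ennreal (V * s ^ n + e)" .
    qed
  qed
  then show ?thesis by (simp add: eventually_at_top_linorder V_def)
qed

text \<open>Write V for the volume of the ball of radius s. The enlarged ball has at least V p / 5
  primitive classes, so \<open>E\<close> is at least V / 10. As each class gives two vectors, fewer
  than V / 10 primitive vectors force \<open>orth_count\<close> below E / 2, and Chebyshev's 4 / E
  is at most 40 / V.\<close>

lemma hecke_second_moment:
  assumes A: "A \<in> SL n" and n: "n \<ge> 3" and s: "s > 0"
  shows "\<exists>p0. \<forall>p\<ge>p0. prime p \<longrightarrow>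
    hecke_mean p n (\<lambda>L. ennreal (of_bool (real (prim_count L s) < unit_ball_vol (real n) * s ^ n / 10))) A
      \<le> ennreal (40 / (unit_ball_vol (real n) * s ^ n))"
proof -
  have n0: "n > 0" and n2: "n \<ge> 2" using n by simp_all
  define V where "V = unit_ball_vol (real n) * s ^ n"
  have V: "V > 0" using s by (simp add: V_def)
  define C where "C = mnorm n (adj_mat A) + 1"
  have C: "C > 0" using mnorm_nonneg[of n "adj_mat A"] by (simp add: C_def)
  define T where "T p = s * real p powr (1 / real n)" for p :: nat
  have Tn: "T p ^ n = s ^ n * real p" if "p > 0" for p
    using that n by (simp add: T_def power_mult_distrib powr_power)
  have Tlim: "filterlim T at_top sequentially"
    unfolding T_def by (rule filterlim_tendsto_pos_mult_at_top[OF tendsto_const s eventually_prime_scale[OF n0]])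
  have ev1: "\<forall>\<^sub>F p in sequentially. unit_ball_vol (real n) / 5 * T p ^ n \<le> real (card (prim_points n A (T p)))"
    using eventually_compose_filterlim[OF prim_points_asymp[OF A n] Tlim] .
  have ev2: "\<forall>\<^sub>F p in sequentially. (s * C) * real p powr (1 / real n) < real p"
    by (rule eventually_powr_less) (use n in auto)
  \<comment> \<open>Coordinates in the ball are at most s C p^(1/n), so a minor is at most 2 (s C)^2
    p^(2/n). As 2 / n < 1 this is eventually below p, and a minor divisible by p must then
    vanish.\<close>
  have ev3: "\<forall>\<^sub>F p in sequentially. (2 * (s * C)\<^sup>2) * real p powr (2 / real n) < real p"
    by (rule eventually_powr_less) (use n in auto)
  have "\<forall>\<^sub>F p in sequentially. prime p \<longrightarrow>
    hecke_mean p n (\<lambda>L. ennreal (of_bool (real (prim_count L s) < V / 10))) A \<le> ennreal (40 / V)"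
    using ev1 ev2 ev3
  proof eventually_elim
    case (elim p)
    show ?case
    proof
      assume p: "prime p"
      have p0: "p > 0" using prime_gt_0_nat[OF p] .
      define D where "D = prim_points n A (T p)"
      have Dnz: "D \<subseteq> nz_points n A (T p)"
        unfolding D_def using prim_points_subset pos_points_subset by blast
      have D5: "V * real p / 5 \<le> real (card D)" using elim(1) by (simp add: D_def Tn[OF p0] V_def mult_ac)
      have Dpos: "real (card D) > 0" using D5 V p0 by (intro less_le_trans[OF _ D5]) auto
      then have D: "finite D" "D \<noteq> {}" by (auto simp: card_gt_0_iff)
      have nd: "\<not> (\<forall>i<n. int p dvd k i)" if "k \<in> D" for k
        by (rule not_all_dvd[OF A, of k "T p"]) (use that Dnz elim(2) in \<open>auto simp: T_def C_def mult_ac\<close>)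
      have pair: "\<exists>i<n. \<exists>j<n. \<not> int p dvd k i * l j - k j * l i"
        if kl: "k \<in> D" "l \<in> D" "k \<noteq> l" for k l
      proof (rule ccontr)
        assume no: "\<not> ?thesis"
        have small: "\<bar>real_of_int (m i)\<bar> \<le> T p * C" if "m \<in> D" "i < n" for m i
        proof -
          have "\<bar>real_of_int (m i)\<bar> \<le> vnorm (lvec A m) * C"
            unfolding C_def by (rule coord_le_vnorm[OF A that(2)])
          also have "\<dots> \<le> T p * C"
            using that(1) C by (intro mult_right_mono) (auto simp: D_def prim_points_def)
          finally show ?thesis .
        qed
        have "k i * l j = k j * l i" if ij: "i < n" "j < n" for i j
        proof (rule ccontr)
          assume ne: "k i * l j \<noteq> k j * l i"
          have TC: "T p * C \<ge> 0" using s C by (simp add: T_def)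
          have "real_of_int \<bar>k i * l j - k j * l i\<bar> \<le> \<bar>real_of_int (k i)\<bar> * \<bar>real_of_int (l j)\<bar> + \<bar>real_of_int (k j)\<bar> * \<bar>real_of_int (l i)\<bar>"
            by (simp add: abs_mult[symmetric])
          also have "\<dots> \<le> (T p * C) * (T p * C) + (T p * C) * (T p * C)"
            using kl ij TC by (intro add_mono mult_mono small) auto
          also have "\<dots> = (2 * (s * C)\<^sup>2) * (real p powr (1 / real n) * real p powr (1 / real n))"
            by (simp add: T_def power2_eq_square mult_ac)
          also have "real p powr (1 / real n) * real p powr (1 / real n) = real p powr (2 / real n)"
            by (simp add: powr_add[symmetric] add_divide_distrib[symmetric])
          also have "(2 * (s * C)\<^sup>2) * real p powr (2 / real n) < real p" by (rule elim(3))
          finally have "\<bar>k i * l j - k j * l i\<bar> < int p" by linarith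
          moreover have "int p dvd \<bar>k i * l j - k j * l i\<bar>" using no ij by simp
          moreover have "\<bar>k i * l j - k j * l i\<bar> > 0" using ne by simp
          ultimately show False using zdvd_imp_le by fastforce
        qed
        then have "k = l" using kl by (intro iprim_proportional[of n]) (auto simp: D_def prim_points_def)
        then show False using kl by simp
      qed
      define E where "E = real (card D) / (2 * real p)"
      have E: "V / 10 \<le> E" using D5 p0 by (simp add: E_def field_simps)
      have E0: "E > 0" using E V by simp
      define N where "N = real (card (nz_residues p n))"
      have N0: "N > 0"
        using nz_residues_nonempty[of p n] n0 prime_gt_1_nat[OF p] by (simp add: N_def card_gt_0_iff)
      have "hecke_mean p n (\<lambda>L. ennreal (of_bool (real (prim_count L s) < V / 10))) A
          = ennreal ((\<Sum>x\<in>nz_residues p n. of_bool (real (prim_count (hecke p n x A) s) < V / 10)) / N)"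
        unfolding N_def by (rule hecke_mean_ennreal[OF p n0]) simp
      also have "\<dots> \<le> ennreal (40 / V)"
      proof (rule ennreal_leI)
        have "(\<Sum>x\<in>nz_residues p n. of_bool (real (prim_count (hecke p n x A) s) < V / 10))
            \<le> (\<Sum>x\<in>nz_residues p n. of_bool (real (orth_count p n D x) < E / 2) :: real)"
        proof (rule sum_mono)
          fix x
          have "2 * real (orth_count p n D x) \<le> real (prim_count (hecke p n x A) s)"
            using prim_count_hecke_ge[OF A p0 n0, of s x] unfolding D_def T_def by linarith
          then show "of_bool (real (prim_count (hecke p n x A) s) < V / 10) \<le> (of_bool (real (orth_count p n D x) < E / 2) :: real)"
            using E by simp
        qed
        also have "\<dots> = real (card {x \<in> nz_residues p n. real (orth_count p n D x) < E / 2})"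
          by (simp add: sum_of_bool_eq Int_def)
        also have "\<dots> \<le> 4 / E * N"
          unfolding N_def by (rule orth_count_chebyshev[OF p n2 D nd pair E_def])
        finally have "(\<Sum>x\<in>nz_residues p n. of_bool (real (prim_count (hecke p n x A) s) < V / 10)) / N \<le> 4 / E"
          using N0 by (simp add: field_simps)
        also have "4 / E \<le> 4 / (V / 10)" using E E0 V by (intro divide_left_mono) auto
        finally show "(\<Sum>x\<in>nz_residues p n. of_bool (real (prim_count (hecke p n x A) s) < V / 10)) / N \<le> 40 / V" by simp
      qed
      finally show "hecke_mean p n (\<lambda>L. ennreal (of_bool (real (prim_count L s) < V / 10))) A \<le> ennreal (40 / V)" .
    qed
  qed
  then show ?thesis by (simp add: eventually_at_top_linorder V_def)
qed

section \<open>Moments and measurability on the space of lattices\<close>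

lemma measurable_nn_integral_countable:
  fixes f :: "'k \<Rightarrow> 'a \<Rightarrow> ennreal"
  assumes K: "countable K" and f: "\<And>k. k \<in> K \<Longrightarrow> f k \<in> borel_measurable M"
  shows "(\<lambda>x. \<integral>\<^sup>+k. f k x \<partial>count_space K) \<in> borel_measurable M"
proof -
  interpret sigma_finite_measure "count_space K"
    by (rule sigma_finite_measure_count_space_countable[OF K])
  have "(\<lambda>(k, x). f k x) \<in> borel_measurable (count_space K \<Otimes>\<^sub>M M)"
    by (rule measurable_pair_measure_countable1[OF K]) (use f in auto)
  from measurable_compose[OF measurable_pair_swap' this]
  have "(\<lambda>(x, k). f k x) \<in> borel_measurable (M \<Otimes>\<^sub>M count_space K)" by (simp add: split_beta')
  from borel_measurable_nn_integral_fst[OF this] show ?thesis by simp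
qed

text \<open>Counting is integration over the fixed countable index set \<open>K\<close>, so the
  dependence on x sits in the integrand alone.\<close>

lemma measurable_card_countable:
  assumes K: "countable K" and g: "\<And>k. k \<in> K \<Longrightarrow> g k \<in> borel_measurable M"
    and fin: "\<And>x. x \<in> space M \<Longrightarrow> finite {k \<in> K. g k x \<le> (s::real)}"
  shows "(\<lambda>x. real (card {k \<in> K. g k x \<le> s})) \<in> borel_measurable M"
proof -
  have "(\<lambda>x. enn2real (\<integral>\<^sup>+k. indicator {..s} (g k x) \<partial>count_space K)) \<in> borel_measurable M"
    by (intro measurable_compose[OF measurable_nn_integral_countable[OF K]] measurable_compose[OF g]) auto
  also have "?this \<longleftrightarrow> ?thesis"
  proof (rule measurable_cong)
    fix x assume "x \<in> space M"
    then have fx: "finite {k \<in> K. g k x \<le> s}" by (rule fin)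
    have "(\<integral>\<^sup>+k. indicator {..s} (g k x) \<partial>count_space K) = (\<integral>\<^sup>+k. indicator {k \<in> K. g k x \<le> s} k \<partial>count_space K)"
      by (intro nn_integral_cong) (auto simp: indicator_def)
    also have "\<dots> = emeasure (count_space K) {k \<in> K. g k x \<le> s}"
      by (rule nn_integral_indicator) auto
    also have "\<dots> = of_nat (card {k \<in> K. g k x \<le> s})" using fx by (subst emeasure_count_space_finite) auto
    finally show "enn2real (\<integral>\<^sup>+k. indicator {..s} (g k x) \<partial>count_space K) = real (card {k \<in> K. g k x \<le> s})"
      by (simp add: ennreal_of_nat_eq_real_of_nat)
  qed
  finally show ?thesis .
qed

lemma countable_int_vecs: "countable (int_vecs n)"
  unfolding int_vecs_def by (intro countable_PiE) auto

lemma measurable_vnorm_lvec: "(\<lambda>A. vnorm (lvec A k)) \<in> borel_measurable (SL_borel n)"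
proof -
  have "(\<lambda>A. sqrt (\<Sum>j<n. (\<Sum>i<n. real_of_int (k i) * A $$ (i,j))\<^sup>2)) \<in> borel_measurable (SL_borel n)"
  proof -
    have [measurable]: "(\<lambda>A. \<Sum>j<n. (\<Sum>i<n. real_of_int (k i) * A $$ (i,j))\<^sup>2) \<in> borel_measurable (SL_borel n)"
      by (intro borel_measurable_sum borel_measurable_power borel_measurable_times
          borel_measurable_const measurable_SL_entry) auto
    show ?thesis by measurable
  qed
  also have "?this \<longleftrightarrow> ?thesis"
    by (rule measurable_cong) (simp add: vnorm_lvec[OF SL_carrier] qnorm_def L2_set_def)
  finally show ?thesis .
qed

lemma measurable_nz_count: "(\<lambda>L. real (nz_count L s)) \<in> borel_measurable (lattice_borel n)"
proof (rule measurable_lattice_descent)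
  have "(\<lambda>A. real (card {k \<in> int_vecs n - {zvec n}. vnorm (lvec A k) \<le> s})) \<in> borel_measurable (SL_borel n)"
  proof (rule measurable_card_countable)
    fix A assume "A \<in> space (SL_borel n)"
    then show "finite {k \<in> int_vecs n - {zvec n}. vnorm (lvec A k) \<le> s}"
      using finite_nz_points[of A n s] by (simp add: nz_points_def)
  qed (auto intro: countable_int_vecs measurable_vnorm_lvec)
  also have "?this \<longleftrightarrow> (\<lambda>A. real (nz_count (lattice_of A) s)) \<in> borel_measurable (SL_borel n)"
    by (rule measurable_cong) (simp add: nz_count_lattice_of nz_points_def)
  finally show "(\<lambda>A. real (nz_count (lattice_of A) s)) \<in> borel_measurable (SL_borel n)" .
qed

definition prim_half :: "nat \<Rightarrow> (nat \<Rightarrow> int) set" where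
  "prim_half n = {k. iprim n k \<and> ipos n k}"

lemma prim_half_int_vecs: "k \<in> prim_half n \<Longrightarrow> k \<in> int_vecs n"
  by (simp add: prim_half_def iprim_def)

lemma countable_prim_half: "countable (prim_half n)"
  using countable_int_vecs by (rule countable_subset[rotated]) (auto intro: prim_half_int_vecs)

lemma prim_points_eq: "prim_points n A t = {k \<in> prim_half n. vnorm (lvec A k) \<le> t}"
  by (auto simp: prim_points_def prim_half_def)

lemma measurable_prim_count: "(\<lambda>L. real (prim_count L s)) \<in> borel_measurable (lattice_borel n)"
proof (rule measurable_lattice_descent)
  have "(\<lambda>A. real (card {k \<in> prim_half n. vnorm (lvec A k) \<le> s})) \<in> borel_measurable (SL_borel n)"
  proof (rule measurable_card_countable)
    fix A assume "A \<in> space (SL_borel n)"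
    then show "finite {k \<in> prim_half n. vnorm (lvec A k) \<le> s}"
      using finite_prim_points[of A n s] by (simp add: prim_points_eq)
  qed (auto intro: countable_prim_half measurable_vnorm_lvec)
  then have "(\<lambda>A. 2 * real (card {k \<in> prim_half n. vnorm (lvec A k) \<le> s})) \<in> borel_measurable (SL_borel n)"
    by (intro borel_measurable_times borel_measurable_const)
  also have "?this \<longleftrightarrow> (\<lambda>A. real (prim_count (lattice_of A) s)) \<in> borel_measurable (SL_borel n)"
    by (rule measurable_cong) (simp add: prim_count_lattice_of prim_points_eq)
  finally show "(\<lambda>A. real (prim_count (lattice_of A) s)) \<in> borel_measurable (SL_borel n)" .
qed

text \<open>The Hecke limit is available for truncated counts; the bound is the same for every
  truncation, so monotone convergence removes it.\<close>

lemma expected_nz_count: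
  assumes mu: "invariant_lattice_prob n \<mu>" and n: "n \<ge> 2" and s: "s > 0"
  shows "(\<integral>\<^sup>+L. ennreal (real (nz_count L s)) \<partial>\<mu>) \<le> ennreal (unit_ball_vol (real n) * s ^ n)"
proof -
  have sets: "sets \<mu> = sets (lattice_borel n)" using mu by (simp add: invariant_lattice_prob_def)
  define f where "f K L = ennreal (min (real (nz_count L s)) (real K))" for K :: nat and L
  have fm: "f K \<in> borel_measurable (lattice_borel n)" for K
    unfolding f_def by (intro measurable_compose[OF _ measurable_ennreal] borel_measurable_min
        measurable_nz_count borel_measurable_const)
  have le: "(\<integral>\<^sup>+L. f K L \<partial>\<mu>) \<le> ennreal (unit_ball_vol (real n) * s ^ n)" for K
  proof (rule nn_integral_le_hecke_limit[OF mu _ fm])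
    show "f K L \<le> ennreal (real K)" for L by (simp add: f_def ennreal_leI)
    show "\<exists>p0. \<forall>p\<ge>p0. prime p \<longrightarrow> hecke_mean p n (f K) A \<le> ennreal (unit_ball_vol (real n) * s ^ n + e)"
      if "A \<in> SL n" "e > 0" for A e
      using hecke_first_moment[OF that(1) n s that(2), of "real K"] by (simp add: f_def[abs_def])
  qed (use n s in auto)
  have "(\<integral>\<^sup>+L. ennreal (real (nz_count L s)) \<partial>\<mu>) = (\<integral>\<^sup>+L. (SUP K. f K L) \<partial>\<mu>)"
  proof (rule nn_integral_cong)
    fix L
    show "ennreal (real (nz_count L s)) = (SUP K. f K L)"
    proof (rule antisym)
      have "ennreal (real (nz_count L s)) = f (nz_count L s) L" by (simp add: f_def)
      also have "\<dots> \<le> (SUP K. f K L)" by (rule SUP_upper) simp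
      finally show "ennreal (real (nz_count L s)) \<le> (SUP K. f K L)" .
      show "(SUP K. f K L) \<le> ennreal (real (nz_count L s))"
        by (rule SUP_least) (auto simp: f_def intro!: ennreal_leI)
    qed
  qed
  also have "\<dots> = (SUP K. \<integral>\<^sup>+L. f K L \<partial>\<mu>)"
  proof (rule nn_integral_monotone_convergence_SUP)
    show "incseq f" by (auto simp: incseq_def le_fun_def f_def intro!: ennreal_leI)
    show "f K \<in> borel_measurable \<mu>" for K using fm measurable_cong_sets[OF sets refl] by blast
  qed
  also have "\<dots> \<le> ennreal (unit_ball_vol (real n) * s ^ n)" by (rule SUP_least) (rule le)
  finally show ?thesis .
qed

text \<open>The indicator of the event is bounded by one, so the Hecke limit applies
  directly.\<close>

lemma prim_count_tail:
  assumes mu: "invariant_lattice_prob n \<mu>" and n: "n \<ge> 3" and s: "s > 0"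
  shows "emeasure \<mu> {L \<in> space \<mu>. real (prim_count L s) < unit_ball_vol (real n) * s ^ n / 10}
    \<le> ennreal (40 / (unit_ball_vol (real n) * s ^ n))"
proof -
  have sets: "sets \<mu> = sets (lattice_borel n)" using mu by (simp add: invariant_lattice_prob_def)
  define V where "V = unit_ball_vol (real n) * s ^ n"
  have V: "V > 0" using s by (simp add: V_def)
  define F where "F L = ennreal (of_bool (real (prim_count L s) < V / 10))" for L
  have pm: "{L \<in> space (lattice_borel n). real (prim_count L s) < V / 10} \<in> sets (lattice_borel n)"
    using measurable_prim_count[of s n] by measurable
  have Fm: "F \<in> borel_measurable (lattice_borel n)"
  proof -
    have "(\<lambda>L. indicator {L \<in> space (lattice_borel n). real (prim_count L s) < V / 10} L :: ennreal) \<in> borel_measurable (lattice_borel n)"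
      using pm by simp
    also have "?this \<longleftrightarrow> ?thesis" by (rule measurable_cong) (auto simp: F_def indicator_def)
    finally show ?thesis .
  qed
  have "(\<integral>\<^sup>+L. F L \<partial>\<mu>) \<le> ennreal (40 / V)"
  proof (rule nn_integral_le_hecke_limit[OF mu _ Fm])
    show "F L \<le> ennreal 1" for L by (simp add: F_def)
    show "\<exists>p0. \<forall>p\<ge>p0. prime p \<longrightarrow> hecke_mean p n F A \<le> ennreal (40 / V + e)"
      if "A \<in> SL n" "e > 0" for A e
    proof -
      have "ennreal (40 / V) \<le> ennreal (40 / V + e)" using that(2) by (intro ennreal_leI) simp
      then show ?thesis using hecke_second_moment[OF that(1) n s] unfolding V_def[symmetric] F_def[abs_def]
        by (meson order_trans)
    qed
  qed (use n V in auto)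
  also have "(\<integral>\<^sup>+L. F L \<partial>\<mu>) = (\<integral>\<^sup>+L. indicator {L \<in> space \<mu>. real (prim_count L s) < V / 10} L \<partial>\<mu>)"
    by (intro nn_integral_cong) (auto simp: F_def indicator_def)
  also have "\<dots> = emeasure \<mu> {L \<in> space \<mu>. real (prim_count L s) < V / 10}"
    using pm sets sets_eq_imp_space_eq[OF sets] by (intro nn_integral_indicator) simp
  finally show ?thesis by (simp add: V_def)
qed

text \<open>\<open>LEAST\<close> over the reals has a meaning only when the minimum is attained. It
  is, because the nonzero vectors no longer than a fixed one form a finite nonempty set.\<close>

lemma lambda1_lattice_of:
  assumes A: "A \<in> SL n" and n: "n > 0"
  shows "\<exists>k\<in>int_vecs n. k \<noteq> zvec n \<and> lambda1 (lattice_of A) = vnorm (lvec A k)"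
    and "k \<in> int_vecs n \<Longrightarrow> k \<noteq> zvec n \<Longrightarrow> lambda1 (lattice_of A) \<le> vnorm (lvec A k)"
proof -
  have cA: "A \<in> carrier_mat n n" using A by (rule SL_carrier)
  have ex: "(\<exists>v \<in> lattice_of A. v \<noteq> 0\<^sub>v (dim_vec v) \<and> r = vnorm v) \<longleftrightarrow>
      (\<exists>k\<in>int_vecs n. k \<noteq> zvec n \<and> r = vnorm (lvec A k))" for r
    unfolding lattice_of_eq_lvec[OF cA] using lvec_eq_0_iff[OF A] dim_lvec_SL[OF A] by auto
  define e where "e = (\<lambda>i\<in>{..<n}. 1::int)"
  have e: "e \<in> int_vecs n" "e \<noteq> zvec n"
    using n by (auto simp: e_def int_vecs_def zvec_def fun_eq_iff)
  define P where "P = nz_points n A (vnorm (lvec A e))"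
  have P: "finite P" "P \<noteq> {}" using finite_nz_points[OF A] e by (auto simp: P_def nz_points_def)
  define m where "m = Min ((\<lambda>k. vnorm (lvec A k)) ` P)"
  have "m \<in> (\<lambda>k. vnorm (lvec A k)) ` P" unfolding m_def using P by (intro Min_in) auto
  then obtain k0 where k0: "k0 \<in> P" "m = vnorm (lvec A k0)" by auto
  have k0': "k0 \<in> int_vecs n" "k0 \<noteq> zvec n" using k0 by (auto simp: P_def nz_points_def)
  have mle: "m \<le> vnorm (lvec A k)" if "k \<in> int_vecs n" "k \<noteq> zvec n" for k
  proof (cases "k \<in> P")
    case True
    then show ?thesis unfolding m_def using P by (intro Min_le) auto
  next
    case False
    then have "vnorm (lvec A e) \<le> vnorm (lvec A k)" using that by (simp add: P_def nz_points_def)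
    moreover have "m \<le> vnorm (lvec A e)" unfolding m_def using P e
      by (intro Min_le) (auto simp: P_def nz_points_def)
    ultimately show ?thesis by simp
  qed
  have "lambda1 (lattice_of A) = m"
    unfolding lambda1_def ex using k0 k0' mle by (intro Least_equality) auto
  then show "\<exists>k\<in>int_vecs n. k \<noteq> zvec n \<and> lambda1 (lattice_of A) = vnorm (lvec A k)"
    "k \<in> int_vecs n \<Longrightarrow> k \<noteq> zvec n \<Longrightarrow> lambda1 (lattice_of A) \<le> vnorm (lvec A k)"
    using k0 k0' mle by auto
qed

lemma measurable_lambda1:
  assumes n: "n > 0"
  shows "(\<lambda>A. lambda1 (lattice_of A)) \<in> borel_measurable (SL_borel n)"
  unfolding borel_measurable_iff_less
proof
  fix a :: real
  have "{A \<in> space (SL_borel n). lambda1 (lattice_of A) < a} =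
      (\<Union>k\<in>int_vecs n - {zvec n}. {A \<in> space (SL_borel n). vnorm (lvec A k) < a})"
    using lambda1_lattice_of[OF _ n] by (fastforce intro: le_less_trans)
  also have "\<dots> \<in> sets (SL_borel n)"
  proof (rule sets.countable_UN'')
    show "countable (int_vecs n - {zvec n})" using countable_int_vecs by (rule countable_Diff)
    show "{A \<in> space (SL_borel n). vnorm (lvec A k) < a} \<in> sets (SL_borel n)" for k
      using measurable_vnorm_lvec[of k n] by measurable
  qed
  finally show "{A \<in> space (SL_borel n). lambda1 (lattice_of A) < a} \<in> sets (SL_borel n)" .
qed

text \<open>Divergence is covered by matching defaults: \<open>infsum\<close> is then 0, and the
  infinite integral is sent to 0 by \<open>enn2real\<close>. Measurability of sums can thus be taken
  from integrals in every case.\<close>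

lemma infsum_eq_enn2real:
  fixes f :: "'a \<Rightarrow> real"
  assumes nn: "\<And>x. x \<in> S \<Longrightarrow> f x \<ge> 0"
  shows "infsum f S = enn2real (\<integral>\<^sup>+x. ennreal (f x) \<partial>count_space S)"
proof (cases "f summable_on S")
  case True
  then have "(\<lambda>x. norm (f x)) summable_on S"
    using nn summable_on_cong[of S "\<lambda>x. norm (f x)" f] by simp
  then have abs: "Infinite_Set_Sum.abs_summable_on f S" by (rule abs_summable_equivalent[THEN iffD1])
  then have int: "integrable (count_space S) f" by (simp add: Infinite_Set_Sum.abs_summable_on_def)
  have "infsum f S = infsetsum f S" using infsetsum_infsum[OF abs] by simp
  also have "\<dots> = integral\<^sup>L (count_space S) f" by (simp add: infsetsum_def)
  finally have "infsum f S = integral\<^sup>L (count_space S) f" .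
  moreover have "(\<integral>\<^sup>+x. ennreal (f x) \<partial>count_space S) = ennreal (integral\<^sup>L (count_space S) f)"
    using nn by (intro nn_integral_eq_integral int) (auto simp: AE_count_space)
  moreover have "integral\<^sup>L (count_space S) f \<ge> 0" using nn by (intro integral_nonneg_AE) (auto simp: AE_count_space)
  ultimately show ?thesis by simp
next
  case False
  have "(\<integral>\<^sup>+x. ennreal (f x) \<partial>count_space S) = \<infinity>"
  proof (rule ccontr)
    assume "(\<integral>\<^sup>+x. ennreal (f x) \<partial>count_space S) \<noteq> \<infinity>"
    then have "integrable (count_space S) f"
      using nn by (intro integrableI_nonneg) (auto simp: AE_count_space less_top)
    then have "Infinite_Set_Sum.abs_summable_on f S" by (simp add: Infinite_Set_Sum.abs_summable_on_def)
    then have "Infinite_Sum.abs_summable_on f S" by (rule abs_summable_equivalent[THEN iffD2])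
    then have "f summable_on S" by (rule abs_summable_summable)
    then show False using False by simp
  qed
  then show ?thesis using infsum_not_exists[OF False] by simp
qed

text \<open>\<open>prim_half\<close> contains one coefficient vector for each class, so sums over
  classes become sums over an index set that does not vary with the lattice.\<close>

lemma prim_sharp_bij:
  assumes A: "A \<in> SL n"
  shows "bij_betw (\<lambda>k. {lvec A k, - lvec A k}) (prim_half n) (prim_sharp (lattice_of A))"
    and "class_norm {lvec A k, - lvec A k} = vnorm (lvec A k)"
proof -
  have cA: "A \<in> carrier_mat n n" using A by (rule SL_carrier)
  have neg: "lvec A (imul n (-1) k) = - lvec A k" for k
    unfolding lvec_imul[OF cA] by (rule eq_vecI) auto
  have vneg: "vnorm (- lvec A k) = vnorm (lvec A k)" for k
    using vnorm_lvec_neg[OF cA, of k] by (simp add: neg)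
  show "class_norm {lvec A k, - lvec A k} = vnorm (lvec A k)"
    by (simp add: class_norm_def vneg)
  define P where "P = primitive_vectors (lattice_of A)"
  have P: "P = lvec A ` {k. iprim n k}" unfolding P_def by (rule primitive_vectors_lattice_of[OF A])
  define R where "R = {(v, w). v \<in> P \<and> w \<in> P \<and> (w = v \<or> w = - v)}"
  have cls: "R `` {lvec A k} = {lvec A k, - lvec A k}" if k: "iprim n k" for k
    using k iprim_neg[OF k] neg[of k, symmetric] unfolding R_def P by auto
  have sharp: "prim_sharp (lattice_of A) = (\<lambda>k. {lvec A k, - lvec A k}) ` {k. iprim n k}"
  proof -
    have "prim_sharp (lattice_of A) = (\<Union>k\<in>{k. iprim n k}. {R `` {lvec A k}})"
      unfolding prim_sharp_def quotient_def P_def[symmetric] R_def[symmetric] by (auto simp: P)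
    also have "\<dots> = (\<lambda>k. {lvec A k, - lvec A k}) ` {k. iprim n k}" using cls by auto
    finally show ?thesis .
  qed
  have inj: "inj_on (lvec A) (int_vecs n)" by (rule inj_lvec[OF A])
  have ineg: "- lvec A (imul n (-1) k) = lvec A k" if "k \<in> int_vecs n" for k
    unfolding neg[symmetric] using imul_one[OF that] by (simp add: imul_imul)
  show "bij_betw (\<lambda>k. {lvec A k, - lvec A k}) (prim_half n) (prim_sharp (lattice_of A))"
    unfolding bij_betw_def
  proof
    show "inj_on (\<lambda>k. {lvec A k, - lvec A k}) (prim_half n)"
    proof (rule inj_onI)
      fix k l assume k: "k \<in> prim_half n" and l: "l \<in> prim_half n"
        and eq: "{lvec A k, - lvec A k} = {lvec A l, - lvec A l}"
      have ki: "k \<in> int_vecs n" "l \<in> int_vecs n" using k l by (auto intro: prim_half_int_vecs)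
      have "lvec A k = lvec A l \<or> lvec A k = lvec A (imul n (-1) l)" using eq unfolding neg by blast
      then have "k = l \<or> k = imul n (-1) l"
        using inj_onD[OF inj _ ki] inj_onD[OF inj _ ki(1) imul_int_vecs] by blast
      moreover have "k \<noteq> imul n (-1) l"
      proof
        assume "k = imul n (-1) l"
        then have "ipos n (imul n (-1) l)" using k by (simp add: prim_half_def)
        moreover have "ipos n l" using l by (simp add: prim_half_def)
        ultimately show False using ipos_neg[OF ki(2) ipos_nonzero] by blast
      qed
      ultimately show "k = l" by blast
    qed
    show "(\<lambda>k. {lvec A k, - lvec A k}) ` prim_half n = prim_sharp (lattice_of A)"
      unfolding sharp
    proof (intro equalityI subsetI)
      fix u assume "u \<in> (\<lambda>k. {lvec A k, - lvec A k}) ` {k. iprim n k}"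
      then obtain k where k: "iprim n k" "u = {lvec A k, - lvec A k}" by blast
      have ki: "k \<in> int_vecs n" "k \<noteq> zvec n" using k by (auto simp: iprim_def)
      show "u \<in> (\<lambda>k. {lvec A k, - lvec A k}) ` prim_half n"
      proof (cases "ipos n k")
        case True
        then show ?thesis using k by (auto simp: prim_half_def)
      next
        case False
        then have "imul n (-1) k \<in> prim_half n"
          using ipos_neg[OF ki] iprim_neg[OF k(1)] by (simp add: prim_half_def)
        moreover have "u = {lvec A (imul n (-1) k), - lvec A (imul n (-1) k)}"
          unfolding ineg[OF ki(1)] unfolding neg k(2) by blast
        ultimately show ?thesis by blast
      qed
    qed (auto simp: prim_half_def)
  qed
qed

section \<open>The ratio in coordinates and its measurability\<close>

definition weight :: "nat \<Rightarrow> real \<Rightarrow> real mat \<Rightarrow> (nat \<Rightarrow> int) \<Rightarrow> real" where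
  "weight n c A k = g_weight n c (unit_ball_vol (real n) * vnorm (lvec A k) ^ n)"

lemma weight_pos: "weight n c A k > 0"
  by (simp add: weight_def g_weight_def)

lemma Pi_lambda_lattice_of:
  assumes A: "A \<in> SL n"
  shows "Pi_lambda n c \<gamma> (lattice_of A) =
    infsum (weight n c A) {k \<in> prim_half n. vnorm (lvec A k) \<le> \<gamma> * lambda1 (lattice_of A)} /
    infsum (weight n c A) (prim_half n)"
proof -
  define u where "u k = {lvec A k, - lvec A k}" for k
  have bij: "bij_betw u (prim_half n) (prim_sharp (lattice_of A))"
    unfolding u_def by (rule prim_sharp_bij(1)[OF A])
  have cn: "class_norm (u k) = vnorm (lvec A k)" for k unfolding u_def by (rule prim_sharp_bij(2)[OF A])
  define r where "r = \<gamma> * lambda1 (lattice_of A)"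
  have bij_r: "bij_betw u {k \<in> prim_half n. vnorm (lvec A k) \<le> r} {u \<in> prim_sharp (lattice_of A). class_norm u \<le> r}"
  proof (rule bij_betw_subset[OF bij])
    show "u ` {k \<in> prim_half n. vnorm (lvec A k) \<le> r} = {u \<in> prim_sharp (lattice_of A). class_norm u \<le> r}"
      unfolding bij_betw_imp_surj_on[OF bij, symmetric] by (auto simp: cn)
  qed auto
  have w: "weight n c A k = g_weight n c (tau n (u k))" for k
    by (simp add: weight_def tau_def cn)
  show ?thesis
    unfolding Pi_lambda_def r_def[symmetric] w
      infsum_reindex_bij_betw[OF bij_r, symmetric] infsum_reindex_bij_betw[OF bij, symmetric]
    by (simp add: w)
qed

text \<open>The range of summation in the numerator varies with the lattice; an indicator factor
  moves this dependence into the integrand over a fixed index set.\<close>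

lemma measurable_Pi_lambda:
  assumes n: "n > 0"
  shows "Pi_lambda n c \<gamma> \<in> borel_measurable (lattice_borel n)"
proof (rule measurable_lattice_descent)
  have wm: "(\<lambda>A. ennreal (weight n c A k)) \<in> borel_measurable (SL_borel n)" for k
  proof -
    have [measurable]: "(\<lambda>A. vnorm (lvec A k)) \<in> borel_measurable (SL_borel n)" by (rule measurable_vnorm_lvec)
    show ?thesis unfolding weight_def g_weight_def by measurable
  qed
  define N where "N A = (\<integral>\<^sup>+k. ennreal (weight n c A k) * indicator {A. vnorm (lvec A k) \<le> \<gamma> * lambda1 (lattice_of A)} A \<partial>count_space (prim_half n))" for A
  define D where "D A = (\<integral>\<^sup>+k. ennreal (weight n c A k) \<partial>count_space (prim_half n))" for A
  have "D \<in> borel_measurable (SL_borel n)"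
    unfolding D_def by (intro measurable_nn_integral_countable countable_prim_half wm)
  moreover have "N \<in> borel_measurable (SL_borel n)"
    unfolding N_def
  proof (intro measurable_nn_integral_countable countable_prim_half borel_measurable_times_ennreal wm)
    fix k
    have [measurable]: "(\<lambda>A. vnorm (lvec A k)) \<in> borel_measurable (SL_borel n)"
      "(\<lambda>A. lambda1 (lattice_of A)) \<in> borel_measurable (SL_borel n)"
      using measurable_vnorm_lvec measurable_lambda1[OF n] by auto
    have "{A \<in> space (SL_borel n). vnorm (lvec A k) \<le> \<gamma> * lambda1 (lattice_of A)} \<in> sets (SL_borel n)"
      by measurable
    then have "(indicator {A \<in> space (SL_borel n). vnorm (lvec A k) \<le> \<gamma> * lambda1 (lattice_of A)} :: _ \<Rightarrow> ennreal) \<in> borel_measurable (SL_borel n)"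
      by (rule borel_measurable_indicator)
    also have "?this \<longleftrightarrow> (indicator {A. vnorm (lvec A k) \<le> \<gamma> * lambda1 (lattice_of A)} :: _ \<Rightarrow> ennreal) \<in> borel_measurable (SL_borel n)"
      by (rule measurable_cong) (auto simp: indicator_def)
    finally show "(\<lambda>A. indicator {A. vnorm (lvec A k) \<le> \<gamma> * lambda1 (lattice_of A)} A :: ennreal) \<in> borel_measurable (SL_borel n)" .
  qed
  ultimately have "(\<lambda>A. enn2real (N A) / enn2real (D A)) \<in> borel_measurable (SL_borel n)" by measurable
  also have "?this \<longleftrightarrow> (\<lambda>A. Pi_lambda n c \<gamma> (lattice_of A)) \<in> borel_measurable (SL_borel n)"
  proof (rule measurable_cong)
    fix A assume "A \<in> space (SL_borel n)"
    then have A: "A \<in> SL n" by simp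
    have "infsum (weight n c A) {k \<in> prim_half n. vnorm (lvec A k) \<le> \<gamma> * lambda1 (lattice_of A)} =
        infsum (\<lambda>k. weight n c A k * indicator {A. vnorm (lvec A k) \<le> \<gamma> * lambda1 (lattice_of A)} A) (prim_half n)"
      by (rule infsum_cong_neutral) auto
    also have "\<dots> = enn2real (N A)"
      unfolding N_def
      by (subst infsum_eq_enn2real)
        (auto simp: less_imp_le[OF weight_pos] ennreal_mult' ennreal_indicator intro!: arg_cong[where f = enn2real] nn_integral_cong)
    finally show "enn2real (N A) / enn2real (D A) = Pi_lambda n c \<gamma> (lattice_of A)"
      unfolding Pi_lambda_lattice_of[OF A] D_def
      by (subst infsum_eq_enn2real[of "prim_half n"]) (auto simp: less_imp_le[OF weight_pos])
  qed
  finally show "(\<lambda>A. Pi_lambda n c \<gamma> (lattice_of A)) \<in> borel_measurable (SL_borel n)" .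
qed

section \<open>Asymptotics of the weights\<close>

definition unit_radius :: "nat \<Rightarrow> real" where
  "unit_radius n = unit_ball_vol (real n) powr (- 1 / real n)"

definition phi :: "real \<Rightarrow> real \<Rightarrow> real" where
  "phi c r = r * exp (- (c / 2) * (r\<^sup>2 - 1))"

definition rho :: "nat \<Rightarrow> real mat \<Rightarrow> (nat \<Rightarrow> int) \<Rightarrow> real" where
  "rho n A k = vnorm (lvec A k) / unit_radius n"

lemma unit_radius_pos: "unit_radius n > 0"
proof -
  have "unit_ball_vol (real n) > 0" by (rule unit_ball_vol_pos) simp
  then have "unit_ball_vol (real n) \<noteq> 0" by linarith
  then show ?thesis unfolding unit_radius_def powr_gt_zero .
qed

lemma unit_radius_power: "n > 0 \<Longrightarrow> unit_ball_vol (real n) * (unit_radius n * r) ^ n = r ^ n"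
proof -
  assume n: "n > 0"
  have v: "unit_ball_vol (real n) > 0" by (rule unit_ball_vol_pos) simp
  have "unit_radius n ^ n = unit_ball_vol (real n) powr (real n * (- 1 / real n))"
  proof -
    have "unit_ball_vol (real n) \<noteq> 0" using v by linarith
    then show ?thesis unfolding unit_radius_def by (subst powr_power) (simp_all add: mult.commute)
  qed
  also have "real n * (- 1 / real n) = - 1" using n by simp
  finally have "unit_radius n ^ n = inverse (unit_ball_vol (real n))" by (simp add: powr_minus)
  moreover have "unit_ball_vol (real n) * inverse (unit_ball_vol (real n)) = 1"
    by (rule right_inverse) (use v in linarith)
  ultimately have "unit_ball_vol (real n) * unit_radius n ^ n = 1" by simp
  then show ?thesis by (simp add: power_mult_distrib mult.assoc[symmetric])
qed

lemma rho_le_iff: "rho n A k \<le> r \<longleftrightarrow> vnorm (lvec A k) \<le> unit_radius n * r"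
  using unit_radius_pos[of n] by (simp add: rho_def pos_divide_le_eq mult.commute)

lemma rho_pos:
  assumes "A \<in> SL n" "k \<in> prim_half n"
  shows "rho n A k > 0"
proof -
  have "k \<in> int_vecs n" "k \<noteq> zvec n" using assms(2) by (auto simp: prim_half_def iprim_def)
  from vnorm_lvec_lower[OF assms(1) this] have "vnorm (lvec A k) > 0"
    using mnorm_nonneg[of n "adj_mat A"] by (auto intro: less_le_trans[rotated])
  then show ?thesis using unit_radius_pos by (simp add: rho_def)
qed

text \<open>The exponent 2 / n undoes the n-th power in the volume, so the weight is Gaussian in the
  normalised length.\<close>

lemma weight_eq_exp:
  assumes n: "n > 0"
  shows "weight n c A k = exp (- (c * real n / 2) * ((rho n A k)\<^sup>2 - 1))"
proof -
  have r0: "rho n A k \<ge> 0" using unit_radius_pos[of n] by (simp add: rho_def vnorm_nonneg)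
  have "unit_ball_vol (real n) * vnorm (lvec A k) ^ n = rho n A k ^ n"
    using unit_radius_power[OF n, of "rho n A k"] unit_radius_pos[of n] by (simp add: rho_def)
  moreover have "(rho n A k ^ n) powr (2 / real n) = (rho n A k)\<^sup>2"
  proof (cases "rho n A k = 0")
    case False
    then have "rho n A k > 0" using r0 by simp
    then have "(rho n A k ^ n) powr (2 / real n) = rho n A k powr (real n * (2 / real n))"
      by (simp add: powr_powr powr_realpow[symmetric])
    also have "\<dots> = rho n A k powr (real 2)" using n by simp
    also have "\<dots> = (rho n A k)\<^sup>2" using \<open>rho n A k > 0\<close> by (subst powr_realpow) auto
    finally show ?thesis .
  qed (use n in simp)
  ultimately show ?thesis by (simp add: weight_def g_weight_def)
qed

lemma phi_power: "phi c r ^ n = r ^ n * exp (- (c * real n / 2) * (r\<^sup>2 - 1))"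
proof -
  have "exp (- (c / 2) * (r\<^sup>2 - 1)) ^ n = exp (real n * (- (c / 2) * (r\<^sup>2 - 1)))"
    by (rule exp_of_nat_mult[symmetric])
  also have "real n * (- (c / 2) * (r\<^sup>2 - 1)) = - (c * real n / 2) * (r\<^sup>2 - 1)" by simp
  finally show ?thesis by (simp only: phi_def power_mult_distrib)
qed

lemma phi_pos: "r > 0 \<Longrightarrow> phi c r > 0"
  by (simp add: phi_def)

text \<open>Squaring 1 + x / 2 \<le> exp (x / 2) produces the strict gap x^2 / 4; where the squaring
  is not allowed, 1 + x is negative.\<close>

lemma exp_greater_add_one: "x \<noteq> 0 \<Longrightarrow> 1 + x < exp (x::real)"
proof (cases "1 + x / 2 \<ge> 0")
  case True
  assume x: "x \<noteq> 0"
  have "x\<^sup>2 > 0" using x by simp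
  then have "1 + x < (1 + x / 2)\<^sup>2" by (simp add: power2_eq_square algebra_simps)
  also have "\<dots> \<le> (exp (x / 2))\<^sup>2" using True by (intro power_mono exp_ge_add_one_self)
  also have "\<dots> = exp x" by (simp add: power2_eq_square exp_add[symmetric])
  finally show ?thesis .
next
  case False
  then have "1 + x < 0" by simp
  then show ?thesis using exp_gt_zero[of x] by linarith
qed

lemma phi_square: "(phi c r)\<^sup>2 = r\<^sup>2 * exp (- c * (r\<^sup>2 - 1))"
  using phi_power[of c r 2] by simp

text \<open>With d = t^2 / r^2 the claim becomes d \<le> exp (c r^2 (d - 1)). It follows from d
  \<le> exp (d - 1) as soon as (d - 1) (c r^2 - 1) \<ge> 0, so a single sign condition covers both
  sides of the maximum.\<close>

lemma phi_le:
  assumes t: "t > 0" and r: "r > 0" and sgn: "(t\<^sup>2 - r\<^sup>2) * (c * r\<^sup>2 - 1) \<ge> 0"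
  shows "phi c t \<le> phi c r"
proof -
  define d where "d = t\<^sup>2 / r\<^sup>2"
  have d: "t\<^sup>2 = d * r\<^sup>2" using r by (simp add: d_def)
  have "(d - 1) * (c * r\<^sup>2 - 1) * r\<^sup>2 \<ge> 0" using sgn unfolding d by (simp add: algebra_simps)
  then have s: "(d - 1) * (c * r\<^sup>2 - 1) \<ge> 0" using r by (simp add: zero_le_mult_iff)
  have "d \<le> exp (d - 1)" using exp_ge_add_one_self[of "d - 1"] by simp
  also have "\<dots> \<le> exp (c * r\<^sup>2 * (d - 1))" using s by (simp add: algebra_simps)
  finally have "d * (r\<^sup>2 * exp (- c * (d * r\<^sup>2 - 1))) \<le> exp (c * r\<^sup>2 * (d - 1)) * (r\<^sup>2 * exp (- c * (d * r\<^sup>2 - 1)))"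
    using r by (intro mult_right_mono) auto
  also have "\<dots> = r\<^sup>2 * (exp (c * r\<^sup>2 * (d - 1)) * exp (- c * (d * r\<^sup>2 - 1)))" by simp
  also have "exp (c * r\<^sup>2 * (d - 1)) * exp (- c * (d * r\<^sup>2 - 1)) = exp (- c * (r\<^sup>2 - 1))"
    by (simp add: exp_add[symmetric] algebra_simps)
  finally have "(phi c t)\<^sup>2 \<le> (phi c r)\<^sup>2"
    unfolding phi_square d by (simp add: mult_ac)
  then show ?thesis by (rule power2_le_imp_le) (use phi_pos[OF r] in \<open>simp add: less_imp_le\<close>)
qed

lemma phi_less_max:
  assumes t: "t > 0" and r: "r > 0" and cr: "c * r\<^sup>2 = 1" and ne: "t \<noteq> r"
  shows "phi c t < phi c r"
proof -
  define d where "d = t\<^sup>2 / r\<^sup>2"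
  have d: "t\<^sup>2 = d * r\<^sup>2" using r by (simp add: d_def)
  have "d \<noteq> 1" using d ne t r by auto
  then have "d < exp (d - 1)" using exp_greater_add_one[of "d - 1"] by simp
  then have "d * (r\<^sup>2 * exp (- c * (d * r\<^sup>2 - 1))) < exp (d - 1) * (r\<^sup>2 * exp (- c * (d * r\<^sup>2 - 1)))"
    using r by (intro mult_strict_right_mono) auto
  also have "\<dots> = r\<^sup>2 * (exp (d - 1) * exp (- c * (d * r\<^sup>2 - 1)))" by simp
  also have "exp (d - 1) * exp (- c * (d * r\<^sup>2 - 1)) = exp (- c * (r\<^sup>2 - 1))"
  proof -
    have "c * (d * r\<^sup>2) = d" using cr by (simp add: algebra_simps)
    then show ?thesis using cr by (simp add: exp_add[symmetric] algebra_simps)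
  qed
  finally have "(phi c t)\<^sup>2 < (phi c r)\<^sup>2"
    unfolding phi_square d by (simp add: mult_ac)
  then show ?thesis by (rule power2_less_imp_less) (use phi_pos[OF r] in \<open>simp add: less_imp_le\<close>)
qed

text \<open>The majorant of the weights of all lattice vectors with norm in one of the shells
  \<open>[t j, q * t j]\<close>, in units of \<open>unit_radius n\<close>.\<close>

definition shell_sum :: "nat \<Rightarrow> real \<Rightarrow> real \<Rightarrow> (nat \<Rightarrow> real) \<Rightarrow> real vec set \<Rightarrow> ennreal" where
  "shell_sum n c q t L = (\<Sum>j. ennreal (exp (- (c * real n / 2) * ((t j)\<^sup>2 - 1))) *
     ennreal (real (nz_count L (unit_radius n * (q * t j)))))"

text \<open>Weights decrease with length: on a shell each is at most the value at the inner radius,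
  and the vectors number at most the count up to the outer radius. Stating this for finite
  \<open>F\<close> presupposes no summability.\<close>

lemma weights_le_shell_sum:
  assumes A: "A \<in> SL n" and n: "n > 0" and c: "c > 0"
    and F: "finite F" "F \<subseteq> prim_half n" and t: "\<And>j. t j > 0"
    and shell: "\<And>k. k \<in> F \<Longrightarrow> \<exists>j. t j \<le> rho n A k \<and> rho n A k \<le> q * t j"
  shows "ennreal (\<Sum>k\<in>F. weight n c A k) \<le> shell_sum n c q t (lattice_of A)"
proof -
  define w where "w j = exp (- (c * real n / 2) * ((t j)\<^sup>2 - 1))" for j
  define I where "I j k = (of_bool (rho n A k \<le> q * t j) :: real)" for j k
  have "ennreal (\<Sum>k\<in>F. weight n c A k) = (\<Sum>k\<in>F. ennreal (weight n c A k))"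
    by (rule sum_ennreal[symmetric]) (simp add: less_imp_le[OF weight_pos])
  also have "\<dots> \<le> (\<Sum>k\<in>F. \<Sum>j. ennreal (w j) * ennreal (I j k))"
  proof (rule sum_mono)
    fix k assume "k \<in> F"
    then obtain j where j: "t j \<le> rho n A k" "rho n A k \<le> q * t j" using shell by blast
    have "(t j)\<^sup>2 \<le> (rho n A k)\<^sup>2" using j(1) t[of j] by (intro power_mono) auto
    then have "weight n c A k \<le> w j"
      unfolding weight_eq_exp[OF n] w_def using c by (simp add: mult_left_mono)
    then have "ennreal (weight n c A k) \<le> ennreal (w j) * ennreal (I j k)"
      using j(2) by (simp add: I_def ennreal_leI)
    also have "\<dots> \<le> (\<Sum>j. ennreal (w j) * ennreal (I j k))"
      using sum_le_suminf[of "\<lambda>j. ennreal (w j) * ennreal (I j k)" "{j}"] by simp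
    finally show "ennreal (weight n c A k) \<le> (\<Sum>j. ennreal (w j) * ennreal (I j k))" .
  qed
  also have "\<dots> = (\<Sum>j. \<Sum>k\<in>F. ennreal (w j) * ennreal (I j k))"
    by (rule suminf_sum[symmetric]) simp
  also have "\<dots> \<le> shell_sum n c q t (lattice_of A)"
    unfolding shell_sum_def w_def[symmetric]
  proof (rule suminf_le)
    fix j
    have "(\<Sum>k\<in>F. ennreal (w j) * ennreal (I j k)) = ennreal (w j) * ennreal (\<Sum>k\<in>F. I j k)"
      by (simp add: sum_distrib_left[symmetric] sum_ennreal I_def)
    also have "(\<Sum>k\<in>F. I j k) = real (card {k \<in> F. rho n A k \<le> q * t j})"
      unfolding I_def using F(1) by (simp add: sum_of_bool_eq Int_def)
    also have "card {k \<in> F. rho n A k \<le> q * t j} \<le> card (nz_points n A (unit_radius n * (q * t j)))"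
    proof (rule card_mono[OF finite_nz_points[OF A]])
      show "{k \<in> F. rho n A k \<le> q * t j} \<subseteq> nz_points n A (unit_radius n * (q * t j))"
        using F(2) by (auto simp: nz_points_def rho_le_iff prim_half_def iprim_def)
    qed
    then have "ennreal (w j) * ennreal (real (card {k \<in> F. rho n A k \<le> q * t j})) \<le>
        ennreal (w j) * ennreal (real (nz_count (lattice_of A) (unit_radius n * (q * t j))))"
      by (intro mult_left_mono ennreal_leI) (auto simp: nz_count_lattice_of[OF A])
    finally show "(\<Sum>k\<in>F. ennreal (w j) * ennreal (I j k)) \<le>
        ennreal (w j) * ennreal (real (nz_count (lattice_of A) (unit_radius n * (q * t j))))" .
  qed auto
  finally show ?thesis .
qed

lemma measurable_shell_sum: "shell_sum n c q t \<in> borel_measurable (lattice_borel n)"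
  unfolding shell_sum_def
  by (intro borel_measurable_suminf_order borel_measurable_times_ennreal borel_measurable_const
      measurable_compose[OF measurable_nz_count measurable_ennreal])

text \<open>The expected contribution of shell j is at most q^n phi(t_j)^n. One factor phi(t_j) is
  kept for summability in j and the others are bounded by x, which separates the exponential rate
  from a series independent of n. Markov's inequality concludes.\<close>

lemma shell_sum_tail:
  assumes mu: "invariant_lattice_prob n \<mu>" and n: "n \<ge> 3" and q: "q > 0"
    and t: "\<And>j. t j > 0" "\<And>j. phi c (t j) \<le> x" and S: "summable (\<lambda>j. phi c (t j))" and a: "a > 0"
  shows "emeasure \<mu> {L \<in> space \<mu>. ennreal a \<le> shell_sum n c q t L}
    \<le> ennreal (q ^ n * x ^ (n - 1) * (\<Sum>j. phi c (t j)) / a)"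
proof -
  have sets: "sets \<mu> = sets (lattice_borel n)" using mu by (simp add: invariant_lattice_prob_def)
  have meas: "f \<in> borel_measurable \<mu>" if "f \<in> borel_measurable (lattice_borel n)" for f :: "_ \<Rightarrow> ennreal"
    using that measurable_cong_sets[OF sets refl] by blast
  have n0: "n > 0" and n2: "n \<ge> 2" using n by auto
  have x: "x > 0" using t(2)[of 0] phi_pos[OF t(1)[of 0], of c] by simp
  define w where "w j = exp (- (c * real n / 2) * ((t j)\<^sup>2 - 1))" for j
  define B where "B = q ^ n * x ^ (n - 1) * (\<Sum>j. phi c (t j))"
  have "(\<integral>\<^sup>+L. shell_sum n c q t L \<partial>\<mu>) =
      (\<Sum>j. \<integral>\<^sup>+L. ennreal (w j) * ennreal (real (nz_count L (unit_radius n * (q * t j)))) \<partial>\<mu>)"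
    unfolding shell_sum_def w_def[symmetric]
    by (intro nn_integral_suminf meas borel_measurable_times_ennreal borel_measurable_const
        measurable_compose[OF measurable_nz_count measurable_ennreal])
  also have "\<dots> \<le> (\<Sum>j. ennreal (q ^ n * x ^ (n - 1) * phi c (t j)))"
  proof (rule suminf_le)
    fix j
    have "(\<integral>\<^sup>+L. ennreal (w j) * ennreal (real (nz_count L (unit_radius n * (q * t j)))) \<partial>\<mu>)
        = ennreal (w j) * (\<integral>\<^sup>+L. ennreal (real (nz_count L (unit_radius n * (q * t j)))) \<partial>\<mu>)"
      by (intro nn_integral_cmult meas measurable_compose[OF measurable_nz_count measurable_ennreal])
    also have "\<dots> \<le> ennreal (w j) * ennreal (unit_ball_vol (real n) * (unit_radius n * (q * t j)) ^ n)"
      using q t(1) unit_radius_pos by (intro mult_left_mono expected_nz_count[OF mu n2]) auto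
    also have "\<dots> = ennreal (w j * (q * t j) ^ n)"
      unfolding unit_radius_power[OF n0] by (rule ennreal_mult[symmetric]) (use q t(1) in \<open>auto simp: w_def less_imp_le\<close>)
    also have "w j * (q * t j) ^ n = q ^ n * phi c (t j) ^ n"
      by (simp add: phi_power w_def power_mult_distrib)
    also have "phi c (t j) ^ n = phi c (t j) ^ (n - 1) * phi c (t j)"
      by (rule power_minus_mult[OF n0, symmetric])
    also have "ennreal (q ^ n * (phi c (t j) ^ (n - 1) * phi c (t j))) \<le> ennreal (q ^ n * x ^ (n - 1) * phi c (t j))"
      using q t phi_pos[OF t(1), of c j] unfolding mult.assoc
      by (intro ennreal_leI mult_left_mono mult_right_mono power_mono) (auto simp: less_imp_le)
    finally show "(\<integral>\<^sup>+L. ennreal (w j) * ennreal (real (nz_count L (unit_radius n * (q * t j)))) \<partial>\<mu>)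
        \<le> ennreal (q ^ n * x ^ (n - 1) * phi c (t j))" .
  qed auto
  also have "\<dots> = ennreal B"
  proof -
    have "(\<Sum>j. ennreal (q ^ n * x ^ (n - 1) * phi c (t j))) = ennreal (\<Sum>j. q ^ n * x ^ (n - 1) * phi c (t j))"
      by (rule suminf_ennreal2) (use q x S phi_pos[OF t(1)] in \<open>auto simp: less_imp_le intro!: summable_mult\<close>)
    then show ?thesis unfolding B_def using S by (simp add: suminf_mult)
  qed
  finally have EU: "(\<integral>\<^sup>+L. shell_sum n c q t L \<partial>\<mu>) \<le> ennreal B" .
  define E where "E = {L \<in> space \<mu>. ennreal a \<le> shell_sum n c q t L}"
  have Um: "shell_sum n c q t \<in> borel_measurable \<mu>" by (rule meas[OF measurable_shell_sum])
  then have Em: "E \<in> sets \<mu>" unfolding E_def by measurable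
  have "ennreal a * emeasure \<mu> E = (\<integral>\<^sup>+L. ennreal a * indicator E L \<partial>\<mu>)"
    using Em by (simp add: nn_integral_cmult_indicator)
  also have "\<dots> \<le> (\<integral>\<^sup>+L. shell_sum n c q t L \<partial>\<mu>)"
    by (intro nn_integral_mono) (auto simp: E_def indicator_def)
  finally have le: "ennreal a * emeasure \<mu> E \<le> ennreal B" using EU by (rule order_trans)
  have "emeasure \<mu> E = ennreal (1 / a) * (ennreal a * emeasure \<mu> E)"
    using a by (simp add: mult.assoc[symmetric] ennreal_mult'[symmetric])
  also have "\<dots> \<le> ennreal (1 / a) * ennreal B" by (intro mult_left_mono le) simp
  also have "\<dots> = ennreal (B / a)" using a by (simp add: ennreal_mult'[symmetric])
  finally show ?thesis by (simp add: E_def B_def)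
qed

text \<open>The count provides at least r^n / 20 classes of normalised length at most r, each
  weighing at least as much as a vector of length r. Summability is a hypothesis because
  \<open>infsum\<close> of a divergent family is 0.\<close>

lemma denominator_lower:
  assumes A: "A \<in> SL n" and n: "n > 0" and c: "c > 0" and r: "r > 0"
    and cnt: "r ^ n / 10 \<le> real (prim_count (lattice_of A) (unit_radius n * r))"
    and sm: "weight n c A summable_on prim_half n"
  shows "phi c r ^ n / 20 \<le> infsum (weight n c A) (prim_half n)"
proof -
  define D where "D = prim_points n A (unit_radius n * r)"
  have D: "finite D" "D \<subseteq> prim_half n" using finite_prim_points[OF A] by (auto simp: D_def prim_points_eq)
  define e where "e = exp (- (c * real n / 2) * (r\<^sup>2 - 1))"
  have "r ^ n / 20 \<le> real (card D)"
    using cnt by (simp add: prim_count_lattice_of[OF A] D_def)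
  then have "phi c r ^ n / 20 \<le> real (card D) * e"
    using mult_right_mono[of "r ^ n / 20" "real (card D)" e] by (simp add: phi_power e_def)
  also have "\<dots> = (\<Sum>k\<in>D. e)" by simp
  also have "\<dots> \<le> (\<Sum>k\<in>D. weight n c A k)"
  proof (rule sum_mono)
    fix k assume k: "k \<in> D"
    then have "rho n A k \<le> r" by (simp add: D_def prim_points_def rho_le_iff)
    moreover have "rho n A k > 0" using rho_pos[OF A] k D(2) by blast
    ultimately have "(rho n A k)\<^sup>2 \<le> r\<^sup>2" by (intro power_mono) auto
    then show "e \<le> weight n c A k"
      unfolding weight_eq_exp[OF n] e_def using c by (simp add: mult_left_mono)
  qed
  also have "\<dots> \<le> infsum (weight n c A) (prim_half n)"
    by (rule finite_sum_le_infsum[OF sm D]) (simp add: less_imp_le[OF weight_pos])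
  finally show ?thesis .
qed

lemma Pi_lambda_near_0:
  assumes A: "A \<in> SL n" and n: "n > 0" and c: "c > 0" and r: "r > 0" and a: "a > 0" and t: "\<And>j. t j > 0"
    and cnt: "r ^ n / 10 \<le> real (prim_count (lattice_of A) (unit_radius n * r))"
    and lam: "\<gamma> * lambda1 (lattice_of A) \<le> unit_radius n * r1"
    and shell: "\<And>s. 0 < s \<Longrightarrow> s \<le> r1 \<Longrightarrow> \<exists>j. t j \<le> s \<and> s \<le> q * t j"
    and U: "shell_sum n c q t (lattice_of A) < ennreal a"
  shows "\<bar>Pi_lambda n c \<gamma> (lattice_of A)\<bar> \<le> 20 * a / phi c r ^ n"
proof (cases "weight n c A summable_on prim_half n")
  \<comment> \<open>Without summability the denominator is 0 by default, hence so is the quotient,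
    and the bound holds.\<close>
  case False
  then have "infsum (weight n c A) (prim_half n) = 0" by (rule infsum_not_exists)
  then show ?thesis using a phi_pos[OF r, of c] unfolding Pi_lambda_lattice_of[OF A] by simp
next
  case True
  define K where "K = {k \<in> prim_half n. vnorm (lvec A k) \<le> \<gamma> * lambda1 (lattice_of A)}"
  have w0: "weight n c A k \<ge> 0" for k using weight_pos by (simp add: less_imp_le)
  have den: "phi c r ^ n / 20 \<le> infsum (weight n c A) (prim_half n)"
    by (rule denominator_lower[OF A n c r cnt True])
  have ph: "phi c r ^ n / 20 > 0" using phi_pos[OF r] by simp
  have "infsum (weight n c A) K \<le> a"
  proof (rule infsum_le_finite_sums)
    show "weight n c A summable_on K" by (rule summable_on_subset_banach[OF True]) (auto simp: K_def)
    fix F assume F: "finite F" "F \<subseteq> K"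
    have "ennreal (\<Sum>k\<in>F. weight n c A k) \<le> shell_sum n c q t (lattice_of A)"
    proof (rule weights_le_shell_sum[OF A n c F(1) _ t])
      show "F \<subseteq> prim_half n" using F(2) by (auto simp: K_def)
      fix k assume "k \<in> F"
      then have k: "k \<in> prim_half n" "vnorm (lvec A k) \<le> unit_radius n * r1" using F(2) lam by (auto simp: K_def)
      then show "\<exists>j. t j \<le> rho n A k \<and> rho n A k \<le> q * t j"
        using rho_pos[OF A k(1)] by (intro shell) (auto simp: rho_le_iff)
    qed
    also have "\<dots> \<le> ennreal a" using U by simp
    finally show "(\<Sum>k\<in>F. weight n c A k) \<le> a" using a by (simp add: ennreal_le_iff)
  qed
  moreover have "infsum (weight n c A) K \<ge> 0" by (rule infsum_nonneg) (rule w0)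
  ultimately have "infsum (weight n c A) K / infsum (weight n c A) (prim_half n) \<le> a / (phi c r ^ n / 20)"
    "infsum (weight n c A) K / infsum (weight n c A) (prim_half n) \<ge> 0"
    using den ph a by (intro frac_le divide_nonneg_pos; linarith)+
  then show ?thesis unfolding Pi_lambda_lattice_of[OF A] K_def[symmetric] by (simp add: mult.commute)
qed

text \<open>The omitted weights are bounded by the shell sum and the numerator is a finite sum,
  which makes the denominator converge. One minus the ratio is then the omitted part divided by the
  denominator.\<close>

lemma Pi_lambda_near_1:
  assumes A: "A \<in> SL n" and n: "n > 0" and c: "c > 0" and r: "r > 0" and a: "a > 0" and t: "\<And>j. t j > 0"
    and cnt: "r ^ n / 10 \<le> real (prim_count (lattice_of A) (unit_radius n * r))"
    and lam: "unit_radius n * r1 \<le> \<gamma> * lambda1 (lattice_of A)"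
    and shell: "\<And>s. r1 < s \<Longrightarrow> \<exists>j. t j \<le> s \<and> s \<le> q * t j"
    and U: "shell_sum n c q t (lattice_of A) < ennreal a"
  shows "\<bar>Pi_lambda n c \<gamma> (lattice_of A) - 1\<bar> \<le> 20 * a / phi c r ^ n"
proof -
  define K where "K = {k \<in> prim_half n. vnorm (lvec A k) \<le> \<gamma> * lambda1 (lattice_of A)}"
  define T where "T = prim_half n - K"
  have w0: "weight n c A k \<ge> 0" for k using weight_pos by (simp add: less_imp_le)
  have Tsum: "(\<Sum>k\<in>F. weight n c A k) \<le> a" if F: "finite F" "F \<subseteq> T" for F
  proof -
    have "ennreal (\<Sum>k\<in>F. weight n c A k) \<le> shell_sum n c q t (lattice_of A)"
    proof (rule weights_le_shell_sum[OF A n c F(1) _ t])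
      show "F \<subseteq> prim_half n" using F(2) by (auto simp: T_def)
      fix k assume "k \<in> F"
      then have "\<not> vnorm (lvec A k) \<le> unit_radius n * r1" using F(2) lam by (auto simp: T_def K_def)
      then have "r1 < rho n A k" unfolding rho_le_iff[symmetric] by simp
      then show "\<exists>j. t j \<le> rho n A k \<and> rho n A k \<le> q * t j" by (rule shell)
    qed
    also have "\<dots> \<le> ennreal a" using U by simp
    finally show ?thesis using a by (simp add: ennreal_le_iff)
  qed
  have smT: "weight n c A summable_on T"
    by (rule nonneg_bdd_above_summable_on) (use w0 Tsum in \<open>auto intro!: bdd_aboveI[of _ a]\<close>)
  have "finite K"
    using finite_prim_points[OF A, of "\<gamma> * lambda1 (lattice_of A)"] by (simp add: K_def prim_points_eq)
  then have smK: "weight n c A summable_on K" by simp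
  have un: "prim_half n = K \<union> T" and dis: "K \<inter> T = {}" by (auto simp: T_def K_def)
  have sm: "weight n c A summable_on prim_half n"
    unfolding un by (rule summable_on_Un_disjoint[OF smK smT dis])
  have split: "infsum (weight n c A) (prim_half n) = infsum (weight n c A) K + infsum (weight n c A) T"
    unfolding un by (rule infsum_Un_disjoint[OF smK smT dis])
  have T0: "infsum (weight n c A) T \<ge> 0" by (rule infsum_nonneg) (rule w0)
  have Ta: "infsum (weight n c A) T \<le> a" by (rule infsum_le_finite_sums[OF smT Tsum])
  have den: "phi c r ^ n / 20 \<le> infsum (weight n c A) (prim_half n)"
    by (rule denominator_lower[OF A n c r cnt sm])
  have ph: "phi c r ^ n / 20 > 0" using phi_pos[OF r] by simp
  then have D0: "infsum (weight n c A) (prim_half n) > 0" using den by linarith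
  have "Pi_lambda n c \<gamma> (lattice_of A) - 1 = - (infsum (weight n c A) T / infsum (weight n c A) (prim_half n))"
    unfolding Pi_lambda_lattice_of[OF A] K_def[symmetric] using D0 by (simp add: split field_simps)
  then have "\<bar>Pi_lambda n c \<gamma> (lattice_of A) - 1\<bar> = infsum (weight n c A) T / infsum (weight n c A) (prim_half n)"
    using T0 D0 by simp
  also have "\<dots> \<le> a / (phi c r ^ n / 20)" using T0 Ta den ph by (intro frac_le) auto
  finally show ?thesis by (simp add: mult.commute)
qed

lemma lambda1_le_of_prim_count:
  assumes A: "A \<in> SL n" and n: "n > 0" and cnt: "real (prim_count (lattice_of A) s) > 0"
  shows "lambda1 (lattice_of A) \<le> s"
proof -
  have "card (prim_points n A s) > 0" using cnt by (simp add: prim_count_lattice_of[OF A])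
  then obtain k where "k \<in> prim_points n A s" by (auto simp: card_gt_0_iff)
  then have k: "k \<in> int_vecs n" "k \<noteq> zvec n" "vnorm (lvec A k) \<le> s"
    by (auto simp: prim_points_def iprim_def)
  from lambda1_lattice_of(2)[OF A n k(1,2)] k(3) show ?thesis by simp
qed

lemma lambda1_ge_of_nz_count:
  assumes A: "A \<in> SL n" and n: "n > 0" and cnt: "nz_count (lattice_of A) s = 0"
  shows "s \<le> lambda1 (lattice_of A)"
proof -
  have "nz_points n A s = {}" using cnt finite_nz_points[OF A] by (simp add: nz_count_lattice_of[OF A])
  moreover obtain k where "k \<in> int_vecs n" "k \<noteq> zvec n" "lambda1 (lattice_of A) = vnorm (lvec A k)"
    using lambda1_lattice_of(1)[OF A n] by blast
  ultimately show ?thesis by (force simp: nz_points_def)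
qed

text \<open>Markov's inequality for an integer count: if nonzero, it is at least one.\<close>

lemma nz_count_nonzero_prob:
  assumes mu: "invariant_lattice_prob n \<mu>" and n: "n \<ge> 2" and s: "s > 0"
  shows "emeasure \<mu> {L \<in> space \<mu>. nz_count L (unit_radius n * s) \<noteq> 0} \<le> ennreal (s ^ n)"
proof -
  have sets: "sets \<mu> = sets (lattice_borel n)" using mu by (simp add: invariant_lattice_prob_def)
  define E where "E = {L \<in> space \<mu>. nz_count L (unit_radius n * s) \<noteq> 0}"
  have [measurable]: "(\<lambda>L. real (nz_count L (unit_radius n * s))) \<in> borel_measurable \<mu>"
    using measurable_nz_count measurable_cong_sets[OF sets refl] by blast
  have "E = {L \<in> space \<mu>. real (nz_count L (unit_radius n * s)) \<noteq> 0}" by (simp add: E_def)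
  also have "\<dots> \<in> sets \<mu>" by measurable
  finally have "emeasure \<mu> E = (\<integral>\<^sup>+L. indicator E L \<partial>\<mu>)" by simp
  also have "\<dots> \<le> (\<integral>\<^sup>+L. ennreal (real (nz_count L (unit_radius n * s))) \<partial>\<mu>)"
  proof (rule nn_integral_mono)
    fix L
    show "indicator E L \<le> ennreal (real (nz_count L (unit_radius n * s)))"
    proof (cases "L \<in> E")
      case True
      then have "1 \<le> real (nz_count L (unit_radius n * s))" by (simp add: E_def)
      then have "ennreal 1 \<le> ennreal (real (nz_count L (unit_radius n * s)))" by (rule ennreal_leI)
      then show ?thesis using True by simp
    qed simp
  qed
  also have "\<dots> \<le> ennreal (unit_ball_vol (real n) * (unit_radius n * s) ^ n)"
    using s unit_radius_pos by (intro expected_nz_count[OF mu n]) simp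
  also have "\<dots> = ennreal (s ^ n)" using n by (simp add: unit_radius_power)
  finally show ?thesis by (simp add: E_def)
qed

lemma prim_count_small_prob:
  assumes mu: "invariant_lattice_prob n \<mu>" and n: "n \<ge> 3" and s: "s > 0"
  shows "emeasure \<mu> {L \<in> space \<mu>. real (prim_count L (unit_radius n * s)) < s ^ n / 10} \<le> ennreal (40 / s ^ n)"
  using prim_count_tail[OF mu n, of "unit_radius n * s"] s unit_radius_pos[of n] n
  by (simp add: unit_radius_power)

section \<open>Convergence in probability\<close>

text \<open>Union bound over three events: \<open>E1\<close>, which will control the shortest
  length, too few primitive vectors within radius r, and a large shell sum.\<close>

lemma bad_prob_bound:
  assumes mu: "invariant_lattice_prob n \<mu>" and n: "n \<ge> 3" and r: "r > 0" and q: "q > 0"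
    and t: "\<And>j. t j > 0" "\<And>j. phi c (t j) \<le> x" and S: "summable (\<lambda>j. phi c (t j))" and a: "a > 0"
    and E1: "E1 \<in> sets \<mu>" "emeasure \<mu> E1 \<le> ennreal e1" "e1 \<ge> 0"
    and good: "\<And>L. L \<in> space \<mu> \<Longrightarrow> L \<notin> E1 \<Longrightarrow> r ^ n / 10 \<le> real (prim_count L (unit_radius n * r)) \<Longrightarrow>
      shell_sum n c q t L < ennreal a \<Longrightarrow> \<bar>Pi_lambda n c \<gamma> L - l\<bar> \<le> \<epsilon>"
  shows "measure \<mu> {L \<in> space \<mu>. \<bar>Pi_lambda n c \<gamma> L - l\<bar> > \<epsilon>}
    \<le> e1 + 40 / r ^ n + q ^ n * x ^ (n - 1) * (\<Sum>j. phi c (t j)) / a"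
proof -
  have sets: "sets \<mu> = sets (lattice_borel n)" using mu by (simp add: invariant_lattice_prob_def)
  interpret prob_space \<mu> using mu by (simp add: invariant_lattice_prob_def)
  have x: "x > 0" using t(2)[of 0] phi_pos[OF t(1)[of 0], of c] by simp
  have S0: "(\<Sum>j. phi c (t j)) \<ge> 0" by (rule suminf_nonneg[OF S]) (simp add: less_imp_le phi_pos t)
  define E2 where "E2 = {L \<in> space \<mu>. real (prim_count L (unit_radius n * r)) < r ^ n / 10}"
  define E3 where "E3 = {L \<in> space \<mu>. ennreal a \<le> shell_sum n c q t L}"
  have [measurable]: "(\<lambda>L. real (prim_count L (unit_radius n * r))) \<in> borel_measurable \<mu>"
    "shell_sum n c q t \<in> borel_measurable \<mu>"
    using measurable_prim_count measurable_shell_sum measurable_cong_sets[OF sets refl] by blast+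
  have E2: "E2 \<in> sets \<mu>" "emeasure \<mu> E2 \<le> ennreal (40 / r ^ n)"
    unfolding E2_def by measurable (rule prim_count_small_prob[OF mu n r])
  have E3: "E3 \<in> sets \<mu>" "emeasure \<mu> E3 \<le> ennreal (q ^ n * x ^ (n - 1) * (\<Sum>j. phi c (t j)) / a)"
    unfolding E3_def by measurable (rule shell_sum_tail[OF mu n q t S a])
  have "{L \<in> space \<mu>. \<bar>Pi_lambda n c \<gamma> L - l\<bar> > \<epsilon>} \<subseteq> E1 \<union> E2 \<union> E3"
    using good by (fastforce simp: E2_def E3_def not_less not_le)
  then have "emeasure \<mu> {L \<in> space \<mu>. \<bar>Pi_lambda n c \<gamma> L - l\<bar> > \<epsilon>} \<le> emeasure \<mu> (E1 \<union> E2 \<union> E3)"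
    using E1 E2 E3 by (intro emeasure_mono) auto
  also have "\<dots> \<le> emeasure \<mu> E1 + emeasure \<mu> E2 + emeasure \<mu> E3"
    using E1(1) E2(1) E3(1)
    by (intro order_trans[OF emeasure_subadditive] add_mono emeasure_subadditive) auto
  also have "\<dots> \<le> ennreal e1 + ennreal (40 / r ^ n) + ennreal (q ^ n * x ^ (n - 1) * (\<Sum>j. phi c (t j)) / a)"
    by (intro add_mono E1 E2 E3)
  also have "\<dots> = ennreal (e1 + 40 / r ^ n + q ^ n * x ^ (n - 1) * (\<Sum>j. phi c (t j)) / a)"
    using E1(3) r q x S0 a by (simp add: ennreal_plus)
  finally show ?thesis
    unfolding emeasure_eq_measure using E1(3) r q x S0 a by (subst (asm) ennreal_le_iff) auto
qed

text \<open>The threshold for the shell sum is \<open>m ^ n\<close> with m strictly between the rate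
  y = q x of its expectation and the rate z of the denominator. Then the probability of exceeding
  it, of order (y / m)^n, and the remaining error 20 (m / z)^n both tend to 0.\<close>

lemma bad_prob_limit:
  fixes \<mu> :: "nat \<Rightarrow> real vec set measure"
  assumes mu: "\<And>n. n \<ge> 1 \<Longrightarrow> invariant_lattice_prob n (\<mu> n)"
    and r: "r > 1" and x: "0 < x" "x < phi c r" and q: "q = (x + phi c r) / (2 * x)"
    and t: "\<And>j. t j > 0" "\<And>j. phi c (t j) \<le> x" and S: "summable (\<lambda>j. phi c (t j))"
    and E1: "\<And>n. n \<ge> 3 \<Longrightarrow> Ev n \<in> sets (\<mu> n)" "\<And>n. n \<ge> 3 \<Longrightarrow> emeasure (\<mu> n) (Ev n) \<le> ennreal (err n)"
      "\<And>n. err n \<ge> 0" "err \<longlonglongrightarrow> 0"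
    and good: "\<And>n a L. n \<ge> 3 \<Longrightarrow> a > 0 \<Longrightarrow> L \<in> space (\<mu> n) \<Longrightarrow> L \<notin> Ev n \<Longrightarrow>
      r ^ n / 10 \<le> real (prim_count L (unit_radius n * r)) \<Longrightarrow>
      shell_sum n c q t L < ennreal a \<Longrightarrow> \<bar>Pi_lambda n c \<gamma> L - l\<bar> \<le> 20 * a / phi c r ^ n"
    and eps: "\<epsilon> > 0"
  shows "(\<lambda>n. measure (\<mu> n) {L \<in> space (\<mu> n). \<bar>Pi_lambda n c \<gamma> L - l\<bar> > \<epsilon>}) \<longlonglongrightarrow> 0"
proof -
  define z where "z = phi c r"
  define y where "y = q * x"
  define m where "m = (y + z) / 2"
  \<comment> \<open>The shell ratio \<open>q\<close> is chosen so that q x lies halfway between x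
    and z: the loss of q^n in the shells still leaves an exponential gap.\<close>
  have y: "y = (x + z) / 2" using x by (simp add: y_def q z_def)
  have "x < z" using x(2) by (simp add: z_def)
  then have yz: "0 < y" "y < m" "m < z" "0 < m" using x(1) by (simp_all add: m_def y add_pos_pos)
  have q0: "q > 0" using x by (simp add: q)
  define Sm where "Sm = (\<Sum>j. phi c (t j))"
  define h where "h n = err n + 40 * (1 / r) ^ n + Sm / x * (y / m) ^ n" for n
  have "h \<longlonglongrightarrow> 0 + 40 * 0 + Sm / x * 0"
    unfolding h_def using r yz by (intro tendsto_intros E1(4) LIMSEQ_realpow_zero) auto
  then have h: "h \<longlonglongrightarrow> 0" by simp
  have "(\<lambda>n. 20 * (m / z) ^ n) \<longlonglongrightarrow> 20 * 0"
    using yz by (intro tendsto_intros LIMSEQ_realpow_zero) auto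
  then have "\<forall>\<^sub>F n in sequentially. 20 * (m / z) ^ n < \<epsilon>"
    using eps by (intro order_tendstoD(2)[of _ "20 * 0"]) auto
  then have ev: "\<forall>\<^sub>F n in sequentially. measure (\<mu> n) {L \<in> space (\<mu> n). \<bar>Pi_lambda n c \<gamma> L - l\<bar> > \<epsilon>} \<le> h n"
    using eventually_ge_at_top[of 3]
  proof eventually_elim
    case (elim n)
    have "measure (\<mu> n) {L \<in> space (\<mu> n). \<bar>Pi_lambda n c \<gamma> L - l\<bar> > \<epsilon>}
        \<le> err n + 40 / r ^ n + q ^ n * x ^ (n - 1) * (\<Sum>j. phi c (t j)) / m ^ n"
    proof (rule bad_prob_bound[where t = t])
      show "invariant_lattice_prob n (\<mu> n)" using elim by (intro mu) simp
      fix L assume L: "L \<in> space (\<mu> n)" "L \<notin> Ev n" "r ^ n / 10 \<le> real (prim_count L (unit_radius n * r))"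
        "shell_sum n c q t L < ennreal (m ^ n)"
      have "\<bar>Pi_lambda n c \<gamma> L - l\<bar> \<le> 20 * m ^ n / phi c r ^ n"
        by (rule good[OF elim(2) _ L]) (use yz in simp)
      also have "\<dots> = 20 * (m / z) ^ n" by (simp add: z_def power_divide)
      finally show "\<bar>Pi_lambda n c \<gamma> L - l\<bar> \<le> \<epsilon>" using elim(1) by simp
    qed (use elim r q0 t S E1 yz in auto)
    also have "q ^ n * x ^ (n - 1) * (\<Sum>j. phi c (t j)) / m ^ n = Sm / x * (y / m) ^ n"
    proof -
      have "x ^ (n - 1) = x ^ n / x" using power_minus_mult[of n x] elim(2) x by (simp add: field_simps)
      then show ?thesis by (simp add: y_def power_mult_distrib power_divide Sm_def)
    qed
    finally show ?case using r by (simp add: h_def power_divide)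
  qed
  show ?thesis
    by (rule tendsto_sandwich[OF always_eventually ev tendsto_const h]) simp
qed

text \<open>Geometric shells descending from r1 to 0; minimality of the exponent gives the outer
  inequality. Exponent 0 arises only for s = r1, which belongs to the first shell.\<close>

lemma lower_shells:
  assumes q: "q > 1" and s: "0 < s" "s \<le> (r1::real)"
  shows "\<exists>j. r1 / q ^ (j + 1) \<le> s \<and> s \<le> q * (r1 / q ^ (j + 1))"
proof -
  obtain N where "r1 / s < q ^ N" using real_arch_pow[OF q] by blast
  then have ex: "r1 / q ^ N \<le> s" using s q by (simp add: field_simps)
  define k where "k = (LEAST k. r1 / q ^ k \<le> s)"
  have k: "r1 / q ^ k \<le> s" unfolding k_def using ex by (rule LeastI)
  show ?thesis
  proof (cases k)
    case 0
    then have "s = r1" using k s by simp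
    then show ?thesis using q s by (intro exI[of _ 0]) (auto simp: field_simps)
  next
    case (Suc j)
    have "\<not> r1 / q ^ j \<le> s" using not_less_Least[of j "\<lambda>k. r1 / q ^ k \<le> s"] Suc by (simp add: k_def)
    then show ?thesis using k Suc q by (intro exI[of _ j]) auto
  qed
qed

lemma upper_shells:
  assumes q: "q > 1" and s: "0 < r1" "(r1::real) < s"
  shows "\<exists>j. r1 * q ^ j \<le> s \<and> s \<le> q * (r1 * q ^ j)"
proof -
  obtain N where "s / r1 < q ^ N" using real_arch_pow[OF q] by blast
  then have ex: "s \<le> r1 * q ^ N" using s q by (simp add: field_simps)
  define k where "k = (LEAST k. s \<le> r1 * q ^ k)"
  have k: "s \<le> r1 * q ^ k" unfolding k_def using ex by (rule LeastI)
  have "k \<noteq> 0" using k s by (cases k) auto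
  then obtain j where j: "k = Suc j" by (cases k) auto
  have "\<not> s \<le> r1 * q ^ j" using not_less_Least[of j "\<lambda>k. s \<le> r1 * q ^ k"] j by (simp add: k_def)
  then show ?thesis using k j by (intro exI[of _ j]) (auto simp: mult_ac)
qed

text \<open>The maximum of \<open>phi\<close> is at r > \<gamma>. The midpoint r1 allows the
  shortest length to exceed the unit radius by the factor s1 = r1 / \<gamma> > 1, while the
  numerator's vectors stay below r1, where \<open>phi\<close> is at most \<open>phi c r1\<close> and
  so below the maximum.\<close>

lemma Pi_lambda_tendsto_0:
  fixes \<mu> :: "nat \<Rightarrow> real vec set measure"
  assumes mu: "\<And>n. n \<ge> 1 \<Longrightarrow> invariant_lattice_prob n (\<mu> n)"
    and g: "\<gamma> > 1" and c: "0 < c" and r: "r > 1" "c * r\<^sup>2 = 1" "\<gamma> < r" and eps: "\<epsilon> > 0"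
  shows "(\<lambda>n. measure (\<mu> n) {L \<in> space (\<mu> n). \<bar>Pi_lambda n c \<gamma> L - 0\<bar> > \<epsilon>}) \<longlonglongrightarrow> 0"
proof -
  define r1 where "r1 = (\<gamma> + r) / 2"
  have r1: "\<gamma> < r1" "r1 < r" "r1 > 0" using r g by (auto simp: r1_def)
  define s1 where "s1 = r1 / \<gamma>"
  have s1: "s1 > 1" using r1 g by (simp add: s1_def)
  define x where "x = phi c r1"
  have x: "0 < x" "x < phi c r"
    unfolding x_def using phi_pos[OF r1(3)] phi_less_max[OF r1(3) _ r(2)] r1 by auto
  define q where "q = (x + phi c r) / (2 * x)"
  have q: "q > 1" using x by (simp add: q_def)
  define t where "t j = r1 / q ^ (j + 1)" for j
  have t0: "t j > 0" for j using r1 q by (simp add: t_def)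
  have tle: "t j \<le> r1" for j
    using r1 q one_le_power[of q "j + 1"] by (simp add: t_def pos_divide_le_eq mult_ge1_I del: power_Suc)
  have cr1: "c * r1\<^sup>2 \<le> 1"
  proof -
    have "r1\<^sup>2 \<le> r\<^sup>2" using r1 by (intro power_mono) auto
    then show ?thesis using mult_left_mono[of "r1\<^sup>2" "r\<^sup>2" c] c r(2) by simp
  qed
  have tphi: "phi c (t j) \<le> x" for j
    unfolding x_def
  proof (rule phi_le[OF t0 r1(3)])
    have "(t j)\<^sup>2 \<le> r1\<^sup>2" using tle t0 by (intro power_mono) (auto simp: less_imp_le)
    then show "((t j)\<^sup>2 - r1\<^sup>2) * (c * r1\<^sup>2 - 1) \<ge> 0" using cr1 by (intro mult_nonpos_nonpos) auto
  qed
  \<comment> \<open>The Gaussian factor is at most exp (c / 2), so \<open>phi\<close> is at most a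
    multiple of t and decays geometrically along the descending shells.\<close>
  have S: "summable (\<lambda>j. phi c (t j))"
  proof (rule summable_comparison_test')
    show "summable (\<lambda>j. exp (c / 2) * r1 / q * (1 / q) ^ j)"
      using q by (intro summable_mult summable_geometric) auto
    fix j :: nat
    have "exp (- (c / 2) * ((t j)\<^sup>2 - 1)) \<le> exp (c / 2)" using c by (simp add: algebra_simps)
    then have "phi c (t j) \<le> t j * exp (c / 2)" unfolding phi_def using t0[of j] by (intro mult_left_mono) auto
    also have "\<dots> = exp (c / 2) * r1 / q * (1 / q) ^ j" by (simp add: t_def power_divide)
    finally show "norm (phi c (t j)) \<le> exp (c / 2) * r1 / q * (1 / q) ^ j" using phi_pos[OF t0] by (simp add: less_imp_le)
  qed
  define E1 where "E1 n = {L \<in> space (\<mu> n). real (prim_count L (unit_radius n * s1)) < s1 ^ n / 10}" for n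
  show ?thesis
  proof (rule bad_prob_limit[where t = t and Ev = E1 and err = "\<lambda>n. 40 / s1 ^ n", OF mu r(1) x q_def t0 tphi S _ _ _ _ _ eps])
    fix n :: nat assume n: "n \<ge> 3"
    then have mun: "invariant_lattice_prob n (\<mu> n)" by (intro mu) simp
    then have sets: "sets (\<mu> n) = sets (lattice_borel n)" by (simp add: invariant_lattice_prob_def)
    have [measurable]: "(\<lambda>L. real (prim_count L (unit_radius n * s1))) \<in> borel_measurable (\<mu> n)"
      using measurable_prim_count measurable_cong_sets[OF sets refl] by blast
    show "E1 n \<in> sets (\<mu> n)" unfolding E1_def by measurable
    show "emeasure (\<mu> n) (E1 n) \<le> ennreal (40 / s1 ^ n)"
      unfolding E1_def using s1 by (intro prim_count_small_prob[OF mun n]) simp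
    fix a :: real and L assume a: "a > 0" and L: "L \<in> space (\<mu> n)" "L \<notin> E1 n"
      "r ^ n / 10 \<le> real (prim_count L (unit_radius n * r))" "shell_sum n c q t L < ennreal a"
    have "L \<in> unimodular_lattices n" using L(1) sets_eq_imp_space_eq[OF sets] by simp
    then obtain A where A: "A \<in> SL n" "L = lattice_of A" by (auto simp: unimodular_lattices_def)
    have n0: "n > 0" using n by simp
    have "s1 ^ n / 10 \<le> real (prim_count L (unit_radius n * s1))" using L by (simp add: E1_def)
    moreover have "s1 ^ n / 10 > 0" using s1 by simp
    ultimately have "lambda1 (lattice_of A) \<le> unit_radius n * s1"
      unfolding A(2) by (intro lambda1_le_of_prim_count[OF A(1) n0]) linarith
    then have "\<gamma> * lambda1 (lattice_of A) \<le> \<gamma> * (unit_radius n * s1)" using g by (intro mult_left_mono) auto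
    also have "\<dots> = unit_radius n * r1" using g by (simp add: s1_def)
    finally have lam: "\<gamma> * lambda1 (lattice_of A) \<le> unit_radius n * r1" .
    have "\<bar>Pi_lambda n c \<gamma> (lattice_of A)\<bar> \<le> 20 * a / phi c r ^ n"
    proof (rule Pi_lambda_near_0[OF A(1) n0 c _ a t0 _ lam])
      show "\<exists>j. t j \<le> s \<and> s \<le> q * t j" if "0 < s" "s \<le> r1" for s
        unfolding t_def by (rule lower_shells[OF q that])
    qed (use r L A in auto)
    then show "\<bar>Pi_lambda n c \<gamma> L - 0\<bar> \<le> 20 * a / phi c r ^ n" by (simp add: A)
  next
    show "40 / s1 ^ n \<ge> 0" for n using s1 by simp
    have "(\<lambda>n. 40 * (1 / s1) ^ n) \<longlonglongrightarrow> 40 * 0"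
      using s1 by (intro tendsto_intros LIMSEQ_realpow_zero) auto
    then show "(\<lambda>n. 40 / s1 ^ n) \<longlonglongrightarrow> 0" by (simp add: power_divide)
  qed
qed

text \<open>Now the cut-off lies beyond the maximum. A shortest length of at least s1 = r1 /
  \<gamma> < 1 unit radii, which fails with probability at most s1^n, keeps all omitted vectors
  beyond r1 > r.\<close>

lemma Pi_lambda_tendsto_1:
  fixes \<mu> :: "nat \<Rightarrow> real vec set measure"
  assumes mu: "\<And>n. n \<ge> 1 \<Longrightarrow> invariant_lattice_prob n (\<mu> n)"
    and g: "\<gamma> > 1" and c: "0 < c" and r: "r > 1" "c * r\<^sup>2 = 1" "r < \<gamma>" and eps: "\<epsilon> > 0"
  shows "(\<lambda>n. measure (\<mu> n) {L \<in> space (\<mu> n). \<bar>Pi_lambda n c \<gamma> L - 1\<bar> > \<epsilon>}) \<longlonglongrightarrow> 0"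
proof -
  define r1 where "r1 = (\<gamma> + r) / 2"
  have r1: "r1 < \<gamma>" "r < r1" "r1 > 0" using r g by (auto simp: r1_def)
  define s1 where "s1 = r1 / \<gamma>"
  have s1: "s1 < 1" "s1 > 0" using r1 g by (auto simp: s1_def)
  define x where "x = phi c r1"
  have r0: "r > 0" using r by simp
  have x: "0 < x" "x < phi c r"
    unfolding x_def using phi_pos[OF r1(3)] phi_less_max[OF r1(3) r0 r(2)] r1 by auto
  define q where "q = (x + phi c r) / (2 * x)"
  have q: "q > 1" using x by (simp add: q_def)
  define t where "t j = r1 * q ^ j" for j
  have t0: "t j > 0" for j using r1 q by (simp add: t_def)
  have tge: "r1 \<le> t j" for j
    using r1 q one_le_power[of q j] mult_left_mono[of 1 "q ^ j" r1] by (simp add: t_def)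
  have cr1: "c * r1\<^sup>2 \<ge> 1"
  proof -
    have "r\<^sup>2 \<le> r1\<^sup>2" using r1 r0 by (intro power_mono) auto
    then show ?thesis using mult_left_mono[of "r\<^sup>2" "r1\<^sup>2" c] c r(2) by simp
  qed
  have tphi: "phi c (t j) \<le> x" for j
    unfolding x_def
  proof (rule phi_le[OF t0 r1(3)])
    have "r1\<^sup>2 \<le> (t j)\<^sup>2" using tge r1 by (intro power_mono) (auto simp: less_imp_le)
    then show "((t j)\<^sup>2 - r1\<^sup>2) * (c * r1\<^sup>2 - 1) \<ge> 0" using cr1 by (intro mult_nonneg_nonneg) auto
  qed
  have S: "summable (\<lambda>j. phi c (t j))"
  proof (rule summable_comparison_test')
    show "summable (\<lambda>j. exp (c / 2) * (2 / c) / r1 * (1 / q) ^ j)"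
      using q by (intro summable_mult summable_geometric) auto
    fix j :: nat
    \<comment> \<open>With u = c t^2 / 2 the bound exp (-u) \<le> 1 / u makes \<open>phi\<close> at
      most a multiple of 1 / t, which decays geometrically along the ascending shells.\<close>
    define u where "u = c / 2 * (t j)\<^sup>2"
    have u0: "u > 0" using c t0[of j] by (simp add: u_def)
    have "u \<le> exp u" using exp_ge_add_one_self[of u] by linarith
    then have "u * exp (- u) \<le> 1" by (simp add: exp_minus field_simps)
    then have "exp (- u) \<le> 1 / u" using u0 by (simp add: field_simps)
    have "phi c (t j) = t j * (exp (c / 2) * exp (- u))"
      by (simp add: phi_def u_def exp_add[symmetric] algebra_simps)
    also have "\<dots> \<le> t j * (exp (c / 2) * (1 / u))"
      using t0[of j] \<open>exp (- u) \<le> 1 / u\<close> by (intro mult_left_mono) auto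
    also have "\<dots> = exp (c / 2) * (2 / c) / t j"
      using t0[of j] c by (simp add: u_def power2_eq_square)
    also have "\<dots> = exp (c / 2) * (2 / c) / r1 * (1 / q) ^ j" by (simp add: t_def power_divide)
    finally show "norm (phi c (t j)) \<le> exp (c / 2) * (2 / c) / r1 * (1 / q) ^ j" using phi_pos[OF t0] by (simp add: less_imp_le)
  qed
  define E1 where "E1 n = {L \<in> space (\<mu> n). nz_count L (unit_radius n * s1) \<noteq> 0}" for n
  show ?thesis
  proof (rule bad_prob_limit[where t = t and Ev = E1 and err = "\<lambda>n. s1 ^ n", OF mu r(1) x q_def t0 tphi S _ _ _ _ _ eps])
    fix n :: nat assume n: "n \<ge> 3"
    then have mun: "invariant_lattice_prob n (\<mu> n)" by (intro mu) simp
    then have sets: "sets (\<mu> n) = sets (lattice_borel n)" by (simp add: invariant_lattice_prob_def)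
    have [measurable]: "(\<lambda>L. real (nz_count L (unit_radius n * s1))) \<in> borel_measurable (\<mu> n)"
      using measurable_nz_count measurable_cong_sets[OF sets refl] by blast
    have "E1 n = {L \<in> space (\<mu> n). real (nz_count L (unit_radius n * s1)) \<noteq> 0}" by (simp add: E1_def)
    also have "\<dots> \<in> sets (\<mu> n)" by measurable
    finally show "E1 n \<in> sets (\<mu> n)" .
    show "emeasure (\<mu> n) (E1 n) \<le> ennreal (s1 ^ n)"
      unfolding E1_def using s1 n by (intro nz_count_nonzero_prob[OF mun]) auto
    fix a :: real and L assume a: "a > 0" and L: "L \<in> space (\<mu> n)" "L \<notin> E1 n"
      "r ^ n / 10 \<le> real (prim_count L (unit_radius n * r))" "shell_sum n c q t L < ennreal a"
    have "L \<in> unimodular_lattices n" using L(1) sets_eq_imp_space_eq[OF sets] by simp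
    then obtain A where A: "A \<in> SL n" "L = lattice_of A" by (auto simp: unimodular_lattices_def)
    have n0: "n > 0" using n by simp
    have "nz_count (lattice_of A) (unit_radius n * s1) = 0" using L A by (simp add: E1_def)
    then have "unit_radius n * s1 \<le> lambda1 (lattice_of A)"
      by (rule lambda1_ge_of_nz_count[OF A(1) n0])
    then have "\<gamma> * (unit_radius n * s1) \<le> \<gamma> * lambda1 (lattice_of A)" using g by (intro mult_left_mono) auto
    moreover have "\<gamma> * (unit_radius n * s1) = unit_radius n * r1" using g by (simp add: s1_def)
    ultimately have lam: "unit_radius n * r1 \<le> \<gamma> * lambda1 (lattice_of A)" by simp
    have "\<bar>Pi_lambda n c \<gamma> (lattice_of A) - 1\<bar> \<le> 20 * a / phi c r ^ n"
    proof (rule Pi_lambda_near_1[OF A(1) n0 c r0 a t0 _ lam])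
      show "\<exists>j. t j \<le> s \<and> s \<le> q * t j" if "r1 < s" for s
        unfolding t_def by (rule upper_shells[OF q r1(3) that])
    qed (use L A in auto)
    then show "\<bar>Pi_lambda n c \<gamma> L - 1\<bar> \<le> 20 * a / phi c r ^ n" by (simp add: A)
  next
    show "s1 ^ n \<ge> 0" for n using s1 by simp
    show "(\<lambda>n. s1 ^ n) \<longlonglongrightarrow> 0" using s1 by (intro LIMSEQ_realpow_zero) auto
  qed
qed

theorem corollary14:
  fixes \<mu> :: "nat \<Rightarrow> real vec set measure"
    and P :: "nat \<Rightarrow> 'w measure"
    and L :: "nat \<Rightarrow> 'w \<Rightarrow> real vec set"
    and \<gamma> c :: real
  assumes "\<And>n. n \<ge> 1 \<Longrightarrow> invariant_lattice_prob n (\<mu> n)"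
    and "\<And>n. n \<ge> 1 \<Longrightarrow> prob_space (P n)"
    and "\<And>n. n \<ge> 1 \<Longrightarrow> L n \<in> P n \<rightarrow>\<^sub>M lattice_borel n"
    and "\<And>n. n \<ge> 1 \<Longrightarrow> distr (P n) (lattice_borel n) (L n) = \<mu> n"
    and "\<gamma> > 1" and "0 < c" and "c < 1"
  shows "(c < \<gamma> powi (-2) \<longrightarrow>
            converges_in_prob P (\<lambda>n \<omega>. Pi_lambda n c \<gamma> (L n \<omega>)) 0) \<and>
         (\<gamma> powi (-2) < c \<longrightarrow>
            converges_in_prob P (\<lambda>n \<omega>. Pi_lambda n c \<gamma> (L n \<omega>)) 1)"
proof -
  \<comment> \<open>Probabilities depend only on the law of the random lattice, so limits pass from
    \<open>\<mu>\<close> to \<open>P\<close>. The laws are prescribed for n \<ge> 1, hence the two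
    sequences are compared eventually.\<close>
  have transfer: "converges_in_prob P (\<lambda>n \<omega>. Pi_lambda n c \<gamma> (L n \<omega>)) l"
    if lim: "\<And>\<epsilon>. \<epsilon> > 0 \<Longrightarrow> (\<lambda>n. measure (\<mu> n) {L \<in> space (\<mu> n). \<bar>Pi_lambda n c \<gamma> L - l\<bar> > \<epsilon>}) \<longlonglongrightarrow> 0" for l
    unfolding converges_in_prob_def
  proof (intro conjI allI impI)
    fix n :: nat assume n: "1 \<le> n"
    show "(\<lambda>\<omega>. Pi_lambda n c \<gamma> (L n \<omega>)) \<in> borel_measurable (P n)"
      using n by (intro measurable_compose[OF assms(3) measurable_Pi_lambda]) auto
  next
    fix \<epsilon> :: real assume eps: "0 < \<epsilon>"
    have "\<forall>\<^sub>F n in sequentially. measure (\<mu> n) {L \<in> space (\<mu> n). \<bar>Pi_lambda n c \<gamma> L - l\<bar> > \<epsilon>}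
        = measure (P n) {\<omega> \<in> space (P n). \<bar>Pi_lambda n c \<gamma> (L n \<omega>) - l\<bar> > \<epsilon>}"
      using eventually_ge_at_top[of 1]
    proof eventually_elim
      case (elim n)
      define B where "B = {L \<in> space (lattice_borel n). \<bar>Pi_lambda n c \<gamma> L - l\<bar> > \<epsilon>}"
      have [measurable]: "Pi_lambda n c \<gamma> \<in> borel_measurable (lattice_borel n)"
        using elim by (intro measurable_Pi_lambda) simp
      have B: "B \<in> sets (lattice_borel n)" unfolding B_def by measurable
      have mun: "\<mu> n = distr (P n) (lattice_borel n) (L n)" using assms(4)[OF elim] by simp
      have "measure (\<mu> n) B = measure (P n) (L n -` B \<inter> space (P n))"
        unfolding mun by (rule measure_distr[OF assms(3)[OF elim] B])
      also have "L n -` B \<inter> space (P n) = {\<omega> \<in> space (P n). \<bar>Pi_lambda n c \<gamma> (L n \<omega>) - l\<bar> > \<epsilon>}"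
        using measurable_space[OF assms(3)[OF elim]] by (auto simp: B_def)
      finally show ?case by (simp add: B_def mun)
    qed
    with lim[OF eps] show "(\<lambda>n. measure (P n) {\<omega> \<in> space (P n). \<bar>Pi_lambda n c \<gamma> (L n \<omega>) - l\<bar> > \<epsilon>}) \<longlonglongrightarrow> 0"
      by (rule Lim_transform_eventually)
  qed
  \<comment> \<open>The point where \<open>phi c\<close> is maximal; comparing c with \<gamma>^(-2)
    amounts to comparing r with \<gamma>.\<close>
  define r where "r = 1 / sqrt c"
  have r: "r > 1" "c * r\<^sup>2 = 1" using assms(6,7) by (auto simp: r_def power_divide)
  have gp: "\<gamma> powi (-2) = 1 / \<gamma>\<^sup>2" using assms(5) by (simp add: power_int_minus inverse_eq_divide)
  have c_r: "c = 1 / r\<^sup>2" using r by (simp add: field_simps)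
  show ?thesis
  proof (intro conjI impI)
    assume "c < \<gamma> powi (-2)"
    then have "\<gamma>\<^sup>2 < r\<^sup>2" using assms(5) r(1) unfolding gp c_r by (simp add: field_simps)
    then have gr: "\<gamma> < r" by (rule power2_less_imp_less) (use r(1) in simp)
    show "converges_in_prob P (\<lambda>n \<omega>. Pi_lambda n c \<gamma> (L n \<omega>)) 0"
      by (rule transfer, rule Pi_lambda_tendsto_0[OF assms(1,5,6) r gr])
  next
    assume "\<gamma> powi (-2) < c"
    then have "r\<^sup>2 < \<gamma>\<^sup>2" using assms(5) r(1) unfolding gp c_r by (simp add: field_simps)
    then have gr: "r < \<gamma>" by (rule power2_less_imp_less) (use assms(5) in simp)
    show "converges_in_prob P (\<lambda>n \<omega>. Pi_lambda n c \<gamma> (L n \<omega>)) 1"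
      by (rule transfer, rule Pi_lambda_tendsto_1[OF assms(1,5,6) r gr])
  qed
qed

end
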